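(* Let $X,Y$ be real nonzero Banach spaces, $S:X\rightrightarrows X^*$ and $T:Y\rightrightarrows Y^*$ maximal monotone operators of Gossez type (D) with strong representative functions $h_S,h_T$, and $A:X\to Y$ linear continuous with $\big(\operatorname{dom}h_T\times\operatorname{pr}_{X^*}(\operatorname{dom}h_S)\big)\cap\big(\operatorname{im}A\times\Delta_{Y^*}^{A^*}\big)\neq\emptyset$ and $D(\overline S)\subseteq X$. Assume condition (a) or (b): (a) $(0,0,0)\in{}^{ic}\big(\operatorname{dom}h_T\times\operatorname{pr}_{X^*}(\operatorname{dom}h_S)-\operatorname{im}A\times\Delta_{Y^*}^{A^*}\big)$; (b) the set $\{(u^*,A^*v^*,A^{**}u^{**}+v^{**},r): r\in\mathbb R,\ h_S^*(u^*,u^{**})+h_T^*(v^*,v^{**})\le r\}$ is closed regarding $\Delta_{X^*}\times\operatorname{im}A^{**}\times\mathbb R$ in $(X^*,w^* )\times(X^*,w^* )\times(Y^{**},w^* )\times\mathbb R$. Then $h:=\operatorname{cl}_{\|\cdot\|\times\|\cdot\|_*}(h_S\bigcirc_1^A h_T)$ is a strong representative function of $S\|_A T$, and $S\|_A T$ is a maximal monotone operator of Gossez type (D).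
   Context: $X$ is identified with its canonical image in $X^{**}$ (same for $Y$). For an operator $M$, $G(M)$ is its graph, $D(M)$ its domain, $M^{-1}$ its inverse. Coupling $c(x,x^* )=\langle x^*,x\rangle$. Conjugate of $h:X\times X^*\to\overline{\mathbb R}$: $h^*(x^*,x^{**})=\sup_{(x,y^* )}\{\langle x^*,x\rangle+\langle x^{**},y^*\rangle-h(x,y^* )\}$. A representative function of a monotone $S$ is a convex, norm-lsc $h_S$ with $h_S\ge c$ and $G(S)\subseteq\{h_S=c\}$; it is strong if also $h_S^*(x^*,x^{**})\ge\langle x^{**},x^*\rangle$ for all $(x^*,x^{**})$. Gossez's closure $\overline S:X^{**}\rightrightarrows X^*$ has graph $\{(x^{**},x^* ):\langle x^{**}-y,x^*-y^*\rangle\ge0\ \forall(y,y^* )\in G(S)\}$; maximal monotone $S$ is of Gossez type (D) if each point of $G(\overline S)$ is the $w^*\times\|\cdot\|_*$-limit of a bounded net in $G(S)$. $A^*,A^{**}$ adjoint/biadjoint; $\operatorname{im}A=A(X)$; $\Delta_{X^*}=\{(x^*,x^* )\}$; $\Delta_{Y^*}^{A^*}=\{(y^*,A^*y^* )\}$. $(h_S\bigcirc_1^A h_T)(x,x^* )=\inf\{h_S(u,x^* )+h_T(Aw,v^* ):u+w=x,\ A^*v^*=x^*\}$. The generalized parallel sum is $S\|_AT(x)=(S^{-1}+(A^*TA)^{-1})^{-1}(x)$. Closed regarding $W$: $\operatorname{cl}D\cap W=D\cap W$. ${}^{ic}D=\operatorname{icr}D$ if $\operatorname{aff}D$ closed,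 else $\emptyset$, where $\operatorname{icr}D=\{u:\forall x\in\operatorname{aff}(D-D)\ \exists\delta>0\ \forall\lambda\in[0,\delta]:u+\lambda x\in D\}$. *)

theory Defs
  imports "HOL-Analysis.Analysis"
begin

type_synonym 'a dual = "'a \<Rightarrow>\<^sub>L real"

definition emb :: "'a::real_normed_vector \<Rightarrow> ('a dual) dual" where
  "emb x = Blinfun (\<lambda>f. blinfun_apply f x)"

definition adj :: "('a::real_normed_vector \<Rightarrow>\<^sub>L 'b::real_normed_vector) \<Rightarrow> ('b dual \<Rightarrow>\<^sub>L 'a dual)" where
  "adj A = Blinfun (\<lambda>v. v o\<^sub>L A)"

text \<open>Weak-star topology on a dual space Z* (pointwise convergence on Z).\<close>
definition wstar :: "('a::real_normed_vector dual) topology" where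
  "wstar = pullback_topology UNIV blinfun_apply euclidean"

definition monotone_op :: "('a::real_normed_vector \<times> 'a dual) set \<Rightarrow> bool" where
  "monotone_op S \<longleftrightarrow> (\<forall>(x,x')\<in>S. \<forall>(y,y')\<in>S. blinfun_apply (x' - y') (x - y) \<ge> 0)"

definition maximal_monotone :: "('a::real_normed_vector \<times> 'a dual) set \<Rightarrow> bool" where
  "maximal_monotone S \<longleftrightarrow> monotone_op S \<and> (\<forall>S'. monotone_op S' \<and> S \<subseteq> S' \<longrightarrow> S' = S)"

definition gossez_closure :: "('a::real_normed_vector \<times> 'a dual) set \<Rightarrow> (('a dual) dual \<times> 'a dual) set" where
  "gossez_closure S = {(z, x'). \<forall>(y,y')\<in>S. blinfun_apply (z - emb y) (x' - y') \<ge> 0}"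

text \<open>Gossez type (D): every point of the Gossez closure is the
  w* \<times> norm limit of a bounded net in G(S) (nets represented by proper filters).\<close>
definition gossez_type_D :: "('a::real_normed_vector \<times> 'a dual) set \<Rightarrow> bool" where
  "gossez_type_D S \<longleftrightarrow> maximal_monotone S \<and>
     (\<forall>(z, x') \<in> gossez_closure S. \<exists>F :: ('a \<times> 'a dual) filter.
        F \<noteq> bot \<and> eventually (\<lambda>p. p \<in> S) F \<and>
        (\<exists>M. eventually (\<lambda>p. norm (fst p) \<le> M \<and> norm (snd p) \<le> M) F) \<and>
        limitin wstar (\<lambda>p. emb (fst p)) z F \<and> ((\<lambda>p. snd p) \<longlongrightarrow> x') F)"

definition edom :: "('p \<Rightarrow> ereal) \<Rightarrow> 'p set" where
  "edom h = {p. h p < \<infinity>}"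

definition epigraph :: "('p \<Rightarrow> ereal) \<Rightarrow> ('p \<times> real) set" where
  "epigraph h = {(p, r). h p \<le> ereal r}"

definition econvex :: "('p::real_vector \<Rightarrow> ereal) \<Rightarrow> bool" where
  "econvex h \<longleftrightarrow> convex (epigraph h)"

definition elsc :: "('p::topological_space \<Rightarrow> ereal) \<Rightarrow> bool" where
  "elsc h \<longleftrightarrow> closed (epigraph h)"

definition fconj :: "('a::real_normed_vector \<times> 'a dual \<Rightarrow> ereal) \<Rightarrow> ('a dual \<times> ('a dual) dual \<Rightarrow> ereal)" where
  "fconj h = (\<lambda>(x', z). Sup {ereal (blinfun_apply x' x + blinfun_apply z y') - h (x, y') | x y'. True})"

definition representative :: "('a::real_normed_vector \<times> 'a dual) set \<Rightarrow> ('a \<times> 'a dual \<Rightarrow> ereal) \<Rightarrow> bool" where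
  "representative S h \<longleftrightarrow> econvex h \<and> elsc h \<and>
     (\<forall>x x'. h (x, x') \<ge> ereal (blinfun_apply x' x)) \<and>
     (\<forall>(x, x')\<in>S. h (x, x') = ereal (blinfun_apply x' x))"

definition strong_representative :: "('a::real_normed_vector \<times> 'a dual) set \<Rightarrow> ('a \<times> 'a dual \<Rightarrow> ereal) \<Rightarrow> bool" where
  "strong_representative S h \<longleftrightarrow> representative S h \<and>
     (\<forall>x' z. fconj h (x', z) \<ge> ereal (blinfun_apply z x'))"

text \<open>Graph of S \<parallel>_A T = (S\<inverse> + (A*TA)\<inverse>)\<inverse>.\<close>
definition par_sum :: "('a::real_normed_vector \<times> 'a dual) set \<Rightarrow> ('a \<Rightarrow>\<^sub>L 'b::real_normed_vector) \<Rightarrow> ('b \<times> 'b dual) set \<Rightarrow> ('a \<times> 'a dual) set" where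
  "par_sum S A T = {(u + w, x') | u w x'. (u, x') \<in> S \<and> (\<exists>v'. (blinfun_apply A w, v') \<in> T \<and> x' = blinfun_apply (adj A) v')}"

definition infconv1 :: "('a::real_normed_vector \<times> 'a dual \<Rightarrow> ereal) \<Rightarrow> ('a \<Rightarrow>\<^sub>L 'b::real_normed_vector) \<Rightarrow> ('b \<times> 'b dual \<Rightarrow> ereal) \<Rightarrow> ('a \<times> 'a dual \<Rightarrow> ereal)" where
  "infconv1 hS A hT = (\<lambda>(x, x'). Inf {hS (u, x') + hT (blinfun_apply A w, v') | u w v'. u + w = x \<and> blinfun_apply (adj A) v' = x'})"

definition lsc_hull :: "('p::topological_space \<Rightarrow> ereal) \<Rightarrow> ('p \<Rightarrow> ereal)" where
  "lsc_hull h = (\<lambda>p. Inf {ereal r | r. (p, r) \<in> closure (epigraph h)})"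

definition icr :: "'v::real_vector set \<Rightarrow> 'v set" where
  "icr D = {u. \<forall>x \<in> affine hull {a - b | a b. a \<in> D \<and> b \<in> D}.
                 \<exists>\<delta>>0. \<forall>t\<in>{0..\<delta>}. u + t *\<^sub>R x \<in> D}"

definition ic :: "'v::real_normed_vector set \<Rightarrow> 'v set" where
  "ic D = (if closed (affine hull D) then icr D else {})"

definition closed_regarding :: "'t topology \<Rightarrow> 't set \<Rightarrow> 't set \<Rightarrow> bool" where
  "closed_regarding Top D W \<longleftrightarrow> (Top closure_of D) \<inter> W = D \<inter> W"

end

theory Submission
  imports Defs
begin

text \<open>The conjugate of \<open>h = cl (h_S \<circle>\<^sub>1\<^sup>A h_T)\<close> at \<open>(x\<^sup>*, x\<^sup>*\<^sup>*)\<close> is the minimum of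
  \<open>h_S\<^sup>*(x\<^sup>*, u) + h_T\<^sup>*(b, A\<^sup>*\<^sup>*(x\<^sup>*\<^sup>* - u))\<close> over \<open>u\<close> and \<open>b\<close> with \<open>A\<^sup>* b = x\<^sup>*\<close>: under (a) by
  Robinson--Ursescu and a Lagrange multiplier, under (b) by weak-star separation. Hence \<open>h\<^sup>* \<ge> c\<close>, and at
  a point where \<open>h = c\<close> the minimizer satisfies \<open>(u, x\<^sup>*) \<in> G(closure S)\<close>, so \<open>u \<in> X\<close> by the domain
  hypothesis and the point decomposes into points of \<open>S\<close> and \<open>T\<close>; so \<open>{h = c}\<close> is the parallel sum.

  A function \<open>h \<ge> c\<close> with \<open>h\<^sup>* \<ge> c\<close> has the Broendsted--Rockafellar property: almost-minimizers of
  \<open>h - c\<close> are near \<open>M = {h = c}\<close>. This gives that \<open>M\<close> is maximal monotone and that the infimum over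
  \<open>(y, y\<^sup>*) \<in> M\<close> of \<open>\<langle>z - y, x\<^sup>* - y\<^sup>*\<rangle>\<close> is never positive. If a point of the Gossez closure
  of \<open>M\<close> were not a bounded limit of points of \<open>M\<close>, a separating functional would give a direction
  along which that infimum becomes positive.\<close>

section \<open>The Hahn--Banach theorem\<close>

text \<open>In a nonreflexive space few infima are attained, so the proof works with points of
  epigraphs and tolerances: a bound on a conjugate becomes an inequality over all points of an
  epigraph, and infinite values disappear. An exact minimum is needed in the dual decomposition.
  There, the strong representatives make the two terms at least <u, x'> and <z - u, x'> (the second
  because the adjoint sends b to x'), and these add up to <z, x'>. Where h equals the coupling, the
  conjugate is at most the coupling as well, so at a minimizer both inequalities are equalities; the
  first, tested at points of \<open>S\<close>, is Gossez's inequality. Separation of convex sets,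
  Lagrange multipliers and weak-star separation all rest on one form of Hahn-Banach, the
  Mazur-Orlicz theorem: a sublinear functional against a convex set of pairs (w, r). In the
  weak-star case this yields evaluations at points of the underlying spaces, which can be read as
  primal points.\<close>

definition sublinear :: "('v::real_vector \<Rightarrow> real) \<Rightarrow> bool" where
  "sublinear p \<longleftrightarrow> (\<forall>x y. p (x + y) \<le> p x + p y) \<and> (\<forall>t x. 0 \<le> t \<longrightarrow> p (t *\<^sub>R x) = t * p x)"

lemma sublinearI:
  assumes "\<And>x y. p (x + y) \<le> p x + p y" "\<And>t x. 0 < t \<Longrightarrow> p (t *\<^sub>R x) \<le> t * p x" "p 0 = 0"
  shows "sublinear p"
proof -
  have "p (t *\<^sub>R x) = t * p x" if "0 \<le> t" for t x
  proof (cases "t = 0")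
    case False
    with that have t: "t > 0" by simp
    have "p (inverse t *\<^sub>R (t *\<^sub>R x)) \<le> inverse t * p (t *\<^sub>R x)"
      using t by (intro assms(2)) simp
    then have "t * p x \<le> p (t *\<^sub>R x)" using t by (simp add: field_simps)
    with assms(2)[OF t, of x] show ?thesis by simp
  qed (simp add: assms)
  with assms show ?thesis unfolding sublinear_def by blast
qed

lemma sublinear_add: "sublinear p \<Longrightarrow> p (x + y) \<le> p x + p y"
  and sublinear_scale: "sublinear p \<Longrightarrow> 0 \<le> t \<Longrightarrow> p (t *\<^sub>R x) = t * p x"
  by (auto simp: sublinear_def)

lemma sublinear_0: "sublinear p \<Longrightarrow> p 0 = 0"
  using sublinear_scale[of p 0 0] by simp

lemma sublinear_ge_neg: "sublinear p \<Longrightarrow> - p (- x) \<le> p x"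
  using sublinear_add[of p x "- x"] sublinear_0[of p] by simp

lemma sublinear_ge_diff: "sublinear p \<Longrightarrow> p y - p (- x) \<le> p (x + y)"
  using sublinear_add[of p "x + y" "- x"] by simp

text \<open>A minimal sublinear functional is linear, because
  \<open>x \<mapsto> inf {q (x + t y) - t q y | t \<ge> 0}\<close> is again sublinear and below \<open>q\<close>.\<close>

lemma sublinear_minimal_linear:
  assumes q: "sublinear q" and min: "\<And>q'. sublinear q' \<Longrightarrow> q' \<le> q \<Longrightarrow> q' = q"
  shows "linear q"
proof -
  have neg: "q (- y) \<le> - q y" for y
  proof -
    define Q where "Q x = (\<lambda>t. q (x + t *\<^sub>R y) - t * q y) ` {0..}" for x
    define r where "r x = Inf (Q x)" for x
    have lb: "- q (- x) \<le> s" if s: "s \<in> Q x" for s x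
    proof -
      obtain t where "0 \<le> t" "s = q (x + t *\<^sub>R y) - t * q y" using s by (auto simp: Q_def)
      then show ?thesis
        using sublinear_ge_diff[OF q, of "t *\<^sub>R y" x] sublinear_scale[OF q, of t y] by simp
    qed
    have bdd: "bdd_below (Q x)" for x using lb by (meson bdd_belowI)
    have ne: "Q x \<noteq> {}" for x by (auto simp: Q_def)
    have r_le: "r x \<le> q (x + t *\<^sub>R y) - t * q y" if "0 \<le> t" for t x
      unfolding r_def using that by (intro cInf_lower bdd) (auto simp: Q_def)
    have "sublinear r"
    proof (rule sublinearI)
      show "r (x + x') \<le> r x + r x'" for x x'
      proof (rule field_le_epsilon)
        fix e :: real assume e: "e > 0"
        obtain s where s: "s \<in> Q x" "s < r x + e/2"
          using cInf_lessD[OF ne, of x "r x + e/2"] e by (auto simp: r_def)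
        obtain s' where s': "s' \<in> Q x'" "s' < r x' + e/2"
          using cInf_lessD[OF ne, of x' "r x' + e/2"] e by (auto simp: r_def)
        obtain t t' where t: "0 \<le> t" "s = q (x + t *\<^sub>R y) - t * q y"
          "0 \<le> t'" "s' = q (x' + t' *\<^sub>R y) - t' * q y"
          using s s' by (auto simp: Q_def)
        have "r (x + x') \<le> q ((x + x') + (t + t') *\<^sub>R y) - (t + t') * q y"
          using t by (intro r_le) simp
        also have "(x + x') + (t + t') *\<^sub>R y = (x + t *\<^sub>R y) + (x' + t' *\<^sub>R y)"
          by (simp add: algebra_simps)
        also have "q \<dots> - (t + t') * q y \<le> s + s'"
          using sublinear_add[OF q, of "x + t *\<^sub>R y" "x' + t' *\<^sub>R y"] t by (simp add: algebra_simps)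
        finally show "r (x + x') \<le> r x + r x' + e" using s s' by simp
      qed
      show "r (c *\<^sub>R x) \<le> c * r x" if c: "0 < c" for c x
      proof -
        have "r (c *\<^sub>R x) / c \<le> r x"
          unfolding r_def[of x]
        proof (rule cInf_greatest[OF ne])
          fix s assume "s \<in> Q x"
          then obtain t where t: "0 \<le> t" "s = q (x + t *\<^sub>R y) - t * q y" by (auto simp: Q_def)
          have "r (c *\<^sub>R x) \<le> q (c *\<^sub>R x + (c * t) *\<^sub>R y) - (c * t) * q y"
            using c t by (intro r_le) simp
          also have "c *\<^sub>R x + (c * t) *\<^sub>R y = c *\<^sub>R (x + t *\<^sub>R y)" by (simp add: algebra_simps)
          also have "q \<dots> - (c * t) * q y = c * s"
            using c t by (simp add: sublinear_scale[OF q] right_diff_distrib del: scaleR_add_right)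
          finally show "r (c *\<^sub>R x) / c \<le> s" using c by (simp add: field_simps)
        qed
        then show ?thesis using c by (simp add: field_simps)
      qed
      have "Q 0 = {0}"
        using sublinear_scale[OF q, of _ y] by (force simp: Q_def)
      then show "r 0 = 0" by (simp add: r_def)
    qed
    moreover have "r \<le> q" using r_le[of 0] by (auto simp: le_fun_def)
    ultimately have "r = q" by (rule min)
    \<comment> \<open>Minimality has turned \<open>r\<close> into \<open>q\<close>, so t = 1 at the
      point -y bounds q(-y) by q 0 - q y.\<close>
    then show ?thesis using r_le[of 1 "- y"] sublinear_0[OF q] by simp
  qed
  then have neg_eq: "q (- y) = - q y" for y using sublinear_ge_neg[OF q, of "- y"] neg[of y] by simp
  show ?thesis
  proof (rule linearI)
    show "q (x + y) = q x + q y" for x y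
      using sublinear_add[OF q, of x y] sublinear_add[OF q, of "- x" "- y"]
      by (simp add: neg_eq[of x] neg_eq[of y] neg_eq[of "x + y", simplified])
    show "q (c *\<^sub>R x) = c *\<^sub>R q x" for c x
    proof (cases "c \<ge> 0")
      case False
      then have "q (c *\<^sub>R x) = q (- ((- c) *\<^sub>R x))" by simp
      also have "\<dots> = - ((- c) * q x)"
        using False by (simp only: neg_eq sublinear_scale[OF q])
      finally show ?thesis by simp
    qed (simp add: sublinear_scale[OF q])
  qed
qed

text \<open>Zorn's lemma with the pointwise order reversed, so that it delivers a minimal sublinear
  functional below \<open>p\<close>. A chain is bounded by its pointwise infimum, which is finite
  because every member stays above -p(-x).\<close>

lemma hahn_banach_sublinear:
  assumes p: "sublinear p"
  obtains L where "linear L" "\<And>x. L x \<le> p x"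
proof -
  define A where "A = {q. sublinear q \<and> q \<le> p}"
  have "\<exists>m\<in>A. \<forall>a\<in>A. (\<lambda>q r. r \<le> q) m a \<longrightarrow> a = m"
  proof (rule predicate_Zorn)
    show "partial_order_on A (relation_of (\<lambda>q r. r \<le> q) A)"
      by (rule partial_order_on_relation_ofI) auto
    fix C assume C: "C \<in> Chains (relation_of (\<lambda>q r. r \<le> q) A)"
    show "\<exists>u\<in>A. \<forall>a\<in>C. u \<le> a"
    proof (cases "C = {}")
      case True
      then show ?thesis using p by (auto simp: A_def)
    next
      case False
      have CA: "q \<in> A" if "q \<in> C" for q using C that by (auto simp: Chains_def relation_of_def)
      have total: "q \<le> r \<or> r \<le> q" if "q \<in> C" "r \<in> C" for q r
        using C that by (auto simp: Chains_def relation_of_def)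
      have sub: "sublinear q" and le: "q x \<le> p x" if "q \<in> C" for q x
        using CA[OF that] by (auto simp: A_def le_fun_def)
      define u where "u x = (INF q\<in>C. q x)" for x
      have bdd: "bdd_below ((\<lambda>q. q x) ` C)" for x
      proof (rule bdd_belowI2)
        fix q assume "q \<in> C"
        then show "- p (- x) \<le> q x"
          using sublinear_ge_neg[OF sub, of q x] le[of q "- x"] by linarith
      qed
      have u_le: "u x \<le> q x" if "q \<in> C" for q x
        unfolding u_def by (rule cINF_lower[OF bdd that])
      have approx: "\<exists>q\<in>C. q x < u x + e" if "e > 0" for x e
        using cInf_lessD[of "(\<lambda>q. q x) ` C" "u x + e"] False that by (auto simp: u_def)
      have "sublinear u"
      proof (rule sublinearI)
        show "u (x + y) \<le> u x + u y" for x y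
        proof (rule field_le_epsilon)
          fix e :: real assume "e > 0"
          then obtain q r where qr: "q \<in> C" "q x < u x + e/2" "r \<in> C" "r y < u y + e/2"
            using approx[of "e/2" x] approx[of "e/2" y] by auto
          obtain s where s: "s \<in> C" "s \<le> q" "s \<le> r" using total qr by blast
          have "u (x + y) \<le> s x + s y"
            using u_le[OF s(1), of "x + y"] sublinear_add[OF sub[OF s(1)], of x y] by linarith
          also have "\<dots> \<le> q x + r y" using s by (auto simp: le_fun_def intro: add_mono)
          finally show "u (x + y) \<le> u x + u y + e" using qr by simp
        qed
        show "u (t *\<^sub>R x) \<le> t * u x" if t: "0 < t" for t x
        proof -
          have "u (t *\<^sub>R x) / t \<le> u x"
            unfolding u_def[of x]
          proof (rule cINF_greatest[OF False])
            fix q assume "q \<in> C"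
            then show "u (t *\<^sub>R x) / t \<le> q x"
              using u_le[of q "t *\<^sub>R x"] t by (simp add: sublinear_scale[OF sub] field_simps)
          qed
          then show ?thesis using t by (simp add: field_simps)
        qed
        show "u 0 = 0" using False by (simp add: u_def sublinear_0[OF sub] cong: INF_cong_simp)
      qed
      moreover have "u \<le> p" using False u_le le by (meson equals0I le_funI order_trans)
      ultimately show ?thesis using u_le by (auto simp: A_def le_fun_def)
    qed
  qed
  then obtain m where m: "m \<in> A" "\<And>a. a \<in> A \<Longrightarrow> a \<le> m \<Longrightarrow> a = m" by blast
  have "linear m"
    by (rule sublinear_minimal_linear) (use m in \<open>auto simp: A_def\<close>)
  with m that show ?thesis by (auto simp: A_def le_fun_def)
qed

text \<open>\<open>P\<close> is a sublinear functional below \<open>p\<close>, built so that P(-w)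
  \<le> r - \<beta> for all (w, r) in \<open>G\<close>; a linear functional below \<open>P\<close>
  then satisfies both bounds. Convexity of \<open>G\<close> makes \<open>P\<close> subadditive: two
  points with multipliers t and t' merge into their weighted mean with multiplier t + t'.\<close>

lemma mazur_orlicz:
  fixes p :: "'v::real_vector \<Rightarrow> real" and G :: "('v \<times> real) set"
  assumes p: "sublinear p" and G: "convex G"
    and lower: "\<And>w r. (w, r) \<in> G \<Longrightarrow> \<beta> \<le> p w + r"
  obtains L where "linear L" "\<And>x. L x \<le> p x" "\<And>w r. (w, r) \<in> G \<Longrightarrow> \<beta> \<le> L w + r"
proof (cases "G = {}")
  case True
  then show ?thesis using hahn_banach_sublinear[OF p] that by (metis empty_iff)
next
  case False
  define Q where "Q x = (\<lambda>(t, w, r). p (x + t *\<^sub>R w) + t * (r - \<beta>)) ` ({0..} \<times> G)" for x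
  define P where "P x = Inf (Q x)" for x
  have lb: "- p (- x) \<le> s" if s: "s \<in> Q x" for s x
  proof -
    obtain t w r where *: "0 \<le> t" "(w, r) \<in> G" "s = p (x + t *\<^sub>R w) + t * (r - \<beta>)"
      using s by (auto simp: Q_def)
    have "0 \<le> t * (p w + r - \<beta>)" using * lower by simp
    then show ?thesis
      using sublinear_ge_diff[OF p, of "t *\<^sub>R w" x] * sublinear_scale[OF p, of t w]
      by (simp add: algebra_simps)
  qed
  have bdd: "bdd_below (Q x)" for x using lb by (meson bdd_belowI)
  have ne: "Q x \<noteq> {}" for x using False by (auto simp: Q_def)
  have P_le: "P x \<le> p (x + t *\<^sub>R w) + t * (r - \<beta>)" if "0 \<le> t" "(w, r) \<in> G" for t w r x
    unfolding P_def using that by (intro cInf_lower bdd) (force simp: Q_def)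
  have "sublinear P"
  proof (rule sublinearI)
    show "P (x + x') \<le> P x + P x'" for x x'
    proof (rule field_le_epsilon)
      fix e :: real assume e: "e > 0"
      obtain s where s: "s \<in> Q x" "s < P x + e/2"
        using cInf_lessD[OF ne, of x "P x + e/2"] e by (auto simp: P_def)
      obtain s' where s': "s' \<in> Q x'" "s' < P x' + e/2"
        using cInf_lessD[OF ne, of x' "P x' + e/2"] e by (auto simp: P_def)
      obtain t w r where t: "0 \<le> t" "(w, r) \<in> G" "s = p (x + t *\<^sub>R w) + t * (r - \<beta>)"
        using s by (auto simp: Q_def)
      obtain t' w' r' where t': "0 \<le> t'" "(w', r') \<in> G" "s' = p (x' + t' *\<^sub>R w') + t' * (r' - \<beta>)"
        using s' by (auto simp: Q_def)
      have "P (x + x') \<le> s + s'"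
      proof (cases "t + t' = 0")
        case True
        then have "t = 0" "t' = 0" using t t' by auto
        then show ?thesis
          using P_le[of 0 w r "x + x'"] t t' sublinear_add[OF p, of x x'] by simp
      next
        case False
        then have T: "t + t' > 0" using t t' by simp
        define w'' where "w'' = (t / (t + t')) *\<^sub>R w + (t' / (t + t')) *\<^sub>R w'"
        define r'' where "r'' = (t / (t + t')) * r + (t' / (t + t')) * r'"
        have "(t / (t + t')) *\<^sub>R (w, r) + (t' / (t + t')) *\<^sub>R (w', r') \<in> G"
          using t t' T by (intro convexD[OF G]) (auto simp: add_divide_distrib[symmetric])
        then have "(w'', r'') \<in> G" by (simp add: w''_def r''_def)
        then have "P (x + x') \<le> p ((x + x') + (t + t') *\<^sub>R w'') + (t + t') * (r'' - \<beta>)"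
          using T by (intro P_le) auto
        also have "(t + t') *\<^sub>R w'' = t *\<^sub>R w + t' *\<^sub>R w'"
          using T by (simp add: w''_def scaleR_add_right)
        also have "(t + t') * (r'' - \<beta>) = t * (r - \<beta>) + t' * (r' - \<beta>)"
        proof -
          have "(t + t') * r'' = t * r + t' * r'" using T by (simp add: r''_def distrib_left)
          then show ?thesis by (simp add: algebra_simps)
        qed
        also have "x + x' + (t *\<^sub>R w + t' *\<^sub>R w') = (x + t *\<^sub>R w) + (x' + t' *\<^sub>R w')"
          by (simp add: algebra_simps)
        also have "p \<dots> + (t * (r - \<beta>) + t' * (r' - \<beta>)) \<le> s + s'"
          using sublinear_add[OF p, of "x + t *\<^sub>R w" "x' + t' *\<^sub>R w'"] t t' by simp
        finally show ?thesis .
      qed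
      then show "P (x + x') \<le> P x + P x' + e" using s s' by simp
    qed
    show "P (c *\<^sub>R x) \<le> c * P x" if c: "0 < c" for c x
    proof -
      have "P (c *\<^sub>R x) / c \<le> P x"
        unfolding P_def[of x]
      proof (rule cInf_greatest[OF ne])
        fix s assume "s \<in> Q x"
        then obtain t w r where t: "0 \<le> t" "(w, r) \<in> G" "s = p (x + t *\<^sub>R w) + t * (r - \<beta>)"
          by (auto simp: Q_def)
        have "P (c *\<^sub>R x) \<le> p (c *\<^sub>R x + (c * t) *\<^sub>R w) + (c * t) * (r - \<beta>)"
          using c t by (intro P_le) auto
        also have "c *\<^sub>R x + (c * t) *\<^sub>R w = c *\<^sub>R (x + t *\<^sub>R w)" by (simp add: algebra_simps)
        also have "p \<dots> + (c * t) * (r - \<beta>) = c * s"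
          using c t by (simp add: sublinear_scale[OF p] distrib_left del: scaleR_add_right)
        finally show "P (c *\<^sub>R x) / c \<le> s" using c by (simp add: field_simps)
      qed
      then show ?thesis using c by (simp add: field_simps)
    qed
    have "P 0 = 0"
    proof (rule antisym)
      show "P 0 \<le> 0" using False P_le[of 0 _ _ 0] sublinear_0[OF p] by fastforce
      show "0 \<le> P 0" unfolding P_def
        by (rule cInf_greatest[OF ne]) (use lb[of _ 0] sublinear_0[OF p] in auto)
    qed
    then show "P 0 = 0" .
  qed
  then obtain L where L: "linear L" "\<And>x. L x \<le> P x" by (rule hahn_banach_sublinear) blast
  show ?thesis
  proof (rule that[OF L(1)])
    show "L x \<le> p x" for x
    proof -
      obtain w r where "(w, r) \<in> G" using False by auto
      then show ?thesis using P_le[of 0 w r x] L(2)[of x] by simp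
    qed
    show "\<beta> \<le> L w + r" if "(w, r) \<in> G" for w r
      using P_le[of 1 w r "- w"] that L(2)[of "- w"] sublinear_0[OF p] linear_neg[OF L(1), of w] by simp
  qed
qed

section \<open>Bounded functionals and separation of convex sets\<close>

lemma linear_bounded_above_blinfun:
  fixes L :: "'v::real_normed_vector \<Rightarrow> real"
  assumes "linear L" "\<And>x. L x \<le> K * norm x"
  obtains f :: "'v \<Rightarrow>\<^sub>L real" where "\<And>x. blinfun_apply f x = L x"
proof -
  have "\<bar>L x\<bar> \<le> norm x * K" for x
    using assms(2)[of x] assms(2)[of "- x"] linear_neg[OF assms(1), of x] by (simp add: mult.commute abs_le_iff)
  then have "bounded_linear L"
    using assms(1) by (intro bounded_linear_intro[of _ K]) (auto simp: linear_add linear_scale)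
  then show ?thesis by (intro that[of "Blinfun L"]) (simp add: bounded_linear_Blinfun_apply)
qed

lemma mazur_orlicz_blinfun:
  fixes G :: "('v::real_normed_vector \<times> real) set"
  assumes "0 \<le> K" "convex G" "\<And>w r. (w, r) \<in> G \<Longrightarrow> \<beta> \<le> K * norm w + r"
  obtains f :: "'v \<Rightarrow>\<^sub>L real" where "\<And>w r. (w, r) \<in> G \<Longrightarrow> \<beta> \<le> blinfun_apply f w + r"
proof -
  have "sublinear (\<lambda>x::'v. K * norm x)"
    using assms(1) norm_triangle_ineq
    by (intro sublinearI) (auto simp: distrib_left[symmetric] intro!: mult_left_mono)
  then obtain L where "linear L" "\<And>x. L x \<le> K * norm x" "\<And>w r. (w, r) \<in> G \<Longrightarrow> \<beta> \<le> L w + r"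
    using mazur_orlicz[OF _ assms(2), of "\<lambda>x. K * norm x" \<beta>] assms(3) by auto
  then show ?thesis using linear_bounded_above_blinfun that by metis
qed

text \<open>\<open>p\<close> is the Minkowski functional of \<open>U\<close> centred at
  \<open>u0\<close>: below 1 on U - u0 and at least 1 on C - u0. Mazur-Orlicz with \<beta> = 1 and
  the pairs (c - u0, 0) keeps the second bound for a linear functional below \<open>p\<close>; the
  ball inside \<open>U\<close> makes it bounded.\<close>

lemma separate_open_convex:
  fixes U C :: "'v::real_normed_vector set"
  assumes U: "open U" "convex U" "U \<noteq> {}" and C: "convex C" "U \<inter> C = {}"
  obtains f :: "'v \<Rightarrow>\<^sub>L real" and \<alpha> where "\<And>u. u \<in> U \<Longrightarrow> blinfun_apply f u < \<alpha>"
    "\<And>c. c \<in> C \<Longrightarrow> \<alpha> \<le> blinfun_apply f c"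
proof -
  obtain u0 where u0: "u0 \<in> U" using U by auto
  obtain \<rho> where \<rho>: "\<rho> > 0" "ball u0 \<rho> \<subseteq> U" using U u0 open_contains_ball by blast
  define Q where "Q x = {t. t > 0 \<and> u0 + x /\<^sub>R t \<in> U}" for x
  define p where "p x = Inf (Q x)" for x
  have mem: "t \<in> Q x" if "norm x / \<rho> < t" for t x
  proof -
    have t: "t > 0" using that \<rho> by (meson divide_nonneg_pos norm_ge_zero order_le_less_trans)
    have "norm (x /\<^sub>R t) < \<rho>" using that t \<rho> by (simp add: field_simps)
    then have "u0 + x /\<^sub>R t \<in> ball u0 \<rho>" by (simp add: dist_norm)
    then show ?thesis using t \<rho> by (auto simp: Q_def)
  qed
  have ne: "Q x \<noteq> {}" for x using mem[of x "norm x / \<rho> + 1"] by auto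
  have bdd: "bdd_below (Q x)" for x by (rule bdd_belowI[of _ 0]) (auto simp: Q_def)
  have p_le: "p x \<le> t" if "t \<in> Q x" for t x unfolding p_def by (rule cInf_lower[OF that bdd])
  have p_ge0: "0 \<le> p x" for x unfolding p_def by (rule cInf_greatest[OF ne]) (auto simp: Q_def)
  have p_norm: "p x \<le> (1 / \<rho>) * norm x" for x
  proof (rule field_le_epsilon)
    fix e :: real assume "e > 0"
    then show "p x \<le> (1 / \<rho>) * norm x + e" by (intro p_le mem) simp
  qed
  have approx: "\<exists>t\<in>Q x. t < p x + e" if "e > 0" for x e
    using cInf_lessD[OF ne, of x "p x + e"] that by (auto simp: p_def)
  have sub: "sublinear p"
  proof (rule sublinearI)
    show "p (x + y) \<le> p x + p y" for x y
    proof (rule field_le_epsilon)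
      fix e :: real assume "e > 0"
      then obtain s t where st: "s \<in> Q x" "s < p x + e/2" "t \<in> Q y" "t < p y + e/2"
        using approx[of "e/2" x] approx[of "e/2" y] by auto
      then have pos: "s > 0" "t > 0" by (auto simp: Q_def)
      have "(s / (s + t)) *\<^sub>R (u0 + x /\<^sub>R s) + (t / (s + t)) *\<^sub>R (u0 + y /\<^sub>R t) \<in> U"
        using st pos by (intro convexD[OF U(2)]) (auto simp: Q_def add_divide_distrib[symmetric])
      also have "(s / (s + t)) *\<^sub>R (u0 + x /\<^sub>R s) + (t / (s + t)) *\<^sub>R (u0 + y /\<^sub>R t)
          = (s / (s + t) + t / (s + t)) *\<^sub>R u0 + (x + y) /\<^sub>R (s + t)"
        using pos by (simp add: scaleR_add_right scaleR_add_left divide_inverse mult.assoc[symmetric] mult.commute)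
      also have "s / (s + t) + t / (s + t) = 1" using pos by (simp add: add_divide_distrib[symmetric])
      finally have "s + t \<in> Q (x + y)" using pos by (simp add: Q_def)
      then show "p (x + y) \<le> p x + p y + e" using p_le[of "s + t" "x + y"] st by simp
    qed
    show "p (c *\<^sub>R x) \<le> c * p x" if c: "0 < c" for c x
    proof -
      have "p (c *\<^sub>R x) / c \<le> p x" unfolding p_def[of x]
      proof (rule cInf_greatest[OF ne])
        fix t assume "t \<in> Q x"
        then have "c * t \<in> Q (c *\<^sub>R x)" using c by (simp add: Q_def mult.commute[of _ c] mult.assoc[symmetric])
        then show "p (c *\<^sub>R x) / c \<le> t" using p_le[of "c * t" "c *\<^sub>R x"] c by (simp add: field_simps)
      qed
      then show ?thesis using c by (simp add: field_simps)
    qed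
    show "p 0 = 0" using p_norm[of 0] p_ge0[of 0] by simp
  qed
  have lt1: "p (u - u0) < 1" if "u \<in> U" for u
  proof -
    \<comment> \<open>Openness lets the ray from \<open>u0\<close> through \<open>u\<close> continue
      inside \<open>U\<close> a little beyond \<open>u\<close>; this provides an admissible t below
      1, hence a strict inequality.\<close>
    have "isCont (\<lambda>t. u0 + (u - u0) /\<^sub>R t) 1" by (intro continuous_intros) auto
    then have "((\<lambda>t. u0 + (u - u0) /\<^sub>R t) \<longlongrightarrow> u) (at 1)" by (auto simp: isCont_def)
    then have "\<forall>\<^sub>F t in at 1. u0 + (u - u0) /\<^sub>R t \<in> U"
      using U(1) that by (rule topological_tendstoD)
    then obtain d where d: "d > 0" "\<And>t. t \<noteq> 1 \<Longrightarrow> dist t 1 < d \<Longrightarrow> u0 + (u - u0) /\<^sub>R t \<in> U"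
      by (auto simp: eventually_at)
    define t where "t = 1 - min (d / 2) (1 / 2)"
    have "t \<in> Q (u - u0)" using d by (auto simp: Q_def t_def dist_real_def)
    then have "p (u - u0) \<le> t" by (rule p_le)
    also have "t < 1" using d by (simp add: t_def)
    finally show ?thesis .
  qed
  have ge1: "1 \<le> p (c - u0)" if c: "c \<in> C" for c
  proof (rule ccontr)
    assume "\<not> 1 \<le> p (c - u0)"
    then obtain t where t: "t \<in> Q (c - u0)" "t < 1" using approx[of "1 - p (c - u0)" "c - u0"] by auto
    then have "(1 - t) *\<^sub>R u0 + t *\<^sub>R (u0 + (c - u0) /\<^sub>R t) \<in> U"
      using u0 by (intro convexD[OF U(2)]) (auto simp: Q_def)
    also have "(1 - t) *\<^sub>R u0 + t *\<^sub>R (u0 + (c - u0) /\<^sub>R t) = c"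
      using t by (simp add: Q_def algebra_simps)
    finally show False using c C by blast
  qed
  obtain L where L: "linear L" "\<And>x. L x \<le> p x"
    "\<And>w r. (w, r) \<in> (\<lambda>c. (c - u0, 0)) ` C \<Longrightarrow> 1 \<le> L w + r"
  proof (rule mazur_orlicz[OF sub])
    have "(\<lambda>c. (c - u0, 0::real)) ` C = (+) (- u0, 0) ` ((\<lambda>c. (c, 0)) ` C)"
      by (auto simp: image_image)
    moreover have "convex ((\<lambda>c. (c, 0::real)) ` C)"
      by (intro convex_linear_image C) (simp add: linear_iff)
    ultimately show "convex ((\<lambda>c. (c - u0, 0::real)) ` C)" by (metis convex_translation)
  qed (use ge1 in auto)
  obtain f :: "'v \<Rightarrow>\<^sub>L real" where f: "\<And>x. blinfun_apply f x = L x"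
    using linear_bounded_above_blinfun[OF L(1)] L(2) p_norm by (metis order_trans)
  show ?thesis
  proof (rule that[of f "1 + f u0"])
    show "f u < 1 + f u0" if "u \<in> U" for u
      using L(2)[of "u - u0"] lt1[OF that] f[of "u - u0"] by (simp add: blinfun.diff_right)
    show "1 + f u0 \<le> f c" if "c \<in> C" for c
      using L(3)[of "c - u0" 0] that f[of "c - u0"] by (auto simp: blinfun.diff_right)
  qed
qed

lemma blinfun_on_Times:
  fixes f :: "('a::real_normed_vector \<times> 'c::real_normed_vector) \<Rightarrow>\<^sub>L real"
  obtains a :: "'a \<Rightarrow>\<^sub>L real" and b :: "'c \<Rightarrow>\<^sub>L real"
    where "\<And>x y. f (x, y) = a x + b y"
proof -
  have bl: "bounded_linear (\<lambda>x. f (x, 0))" "bounded_linear (\<lambda>y. f (0, y))"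
    by (intro bounded_linear_compose[OF blinfun.bounded_linear_right] bounded_linear_Pair
        bounded_linear_ident bounded_linear_zero)+
  have "f (x, y) = Blinfun (\<lambda>x. f (x, 0)) x + Blinfun (\<lambda>y. f (0, y)) y" for x y
    using blinfun.add_right[of f "(x, 0)" "(0, y)"]
    by (simp add: bounded_linear_Blinfun_apply[OF bl(1)] bounded_linear_Blinfun_apply[OF bl(2)])
  then show ?thesis by (rule that)
qed

lemma blinfun_on_prod:
  fixes f :: "(('a::real_normed_vector \<times> 'c::real_normed_vector) \<times> real) \<Rightarrow>\<^sub>L real"
  obtains a :: "'a \<Rightarrow>\<^sub>L real" and b :: "'c \<Rightarrow>\<^sub>L real" and \<beta> :: real
    where "\<And>x y r. f ((x, y), r) = a x + b y + \<beta> * r"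
proof (rule blinfun_on_Times[of f])
  fix f' :: "('a \<times> 'c) \<Rightarrow>\<^sub>L real" and g :: "real \<Rightarrow>\<^sub>L real"
  assume fg: "\<And>q r. f (q, r) = blinfun_apply f' q + blinfun_apply g r"
  have g: "blinfun_apply g r = g 1 * r" for r
    using blinfun.scaleR_right[of g r 1] by simp
  show thesis
  proof (rule blinfun_on_Times[of f'])
    fix a b assume "\<And>x y. f' (x, y) = blinfun_apply a x + blinfun_apply b y"
    then show thesis by (intro that[of a b "g 1"]) (simp add: fg g[symmetric])
  qed
qed

section \<open>Duals, biduals and the Goldstine theorem\<close>

lemma emb_apply [simp]: "blinfun_apply (emb x) f = blinfun_apply f x"
  unfolding emb_def by (simp add: bounded_linear_Blinfun_apply blinfun.bounded_linear_left)

lemma adj_apply: "blinfun_apply (adj A) v = v o\<^sub>L A"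
  unfolding adj_def
  by (rule bounded_linear_Blinfun_apply[THEN fun_cong])
     (rule bounded_bilinear.bounded_linear_left[OF bounded_bilinear_blinfun_compose])

lemma adj_apply2 [simp]: "blinfun_apply (blinfun_apply (adj A) v) x = blinfun_apply v (blinfun_apply A x)"
  by (simp add: adj_apply)

lemma adj_adj_emb: "blinfun_apply (adj (adj A)) (emb x) = emb (blinfun_apply A x)"
  by (rule blinfun_eqI) simp

lemma emb_diff: "emb (x - y) = emb x - emb y"
  by (rule blinfun_eqI) (simp add: blinfun.diff_left blinfun.diff_right)

lemma blinfun_le: "blinfun_apply f x \<le> norm f * norm x" for f :: "'v::real_normed_vector dual"
  using norm_blinfun[of f x] by simp

lemma blinfun_ge: "- (norm f * norm x) \<le> blinfun_apply f x" for f :: "'v::real_normed_vector dual"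
  using norm_blinfun[of f x] by simp

text \<open>A near-minimizer \<open>y\<close> of \<open>y \<mapsto> \<Sum>\<^sub>f (f y - z f)\<^sup>2\<close> over the ball does the job: by first-order
  optimality, \<open>g = \<Sum>\<^sub>f (z f - f y) f\<close> nearly attains its supremum over the ball at \<open>y\<close>, and so
  \<open>z g\<close> cannot exceed \<open>g y\<close> by much.\<close>

lemma goldstine:
  fixes z :: "'a::real_normed_vector dual dual"
  assumes F: "finite F" and R: "norm z < R" and e: "e > 0"
  shows "\<exists>y. norm y < R \<and> (\<forall>f\<in>F. \<bar>blinfun_apply f y - blinfun_apply z f\<bar> < e)"
proof -
  define N where "N y = (\<Sum>f\<in>F. (blinfun_apply f y - blinfun_apply z f)\<^sup>2)" for y
  define C where "C = (\<Sum>f\<in>F. (norm f * (2 * R))\<^sup>2)"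
  have C0: "C \<ge> 0" unfolding C_def by (intro sum_nonneg) simp
  have R0: "R > 0" using R norm_ge_zero[of z] by linarith
  \<comment> \<open>\<open>C\<close> bounds the second-order term of \<open>N\<close> along segments
    in the ball. The step \<open>t\<close> keeps t * C at most e^2 / 2, and with \<open>y\<close>
    minimal up to t * e^2 / 2 the first-order condition \<open>gB\<close> has error e^2 / 2.\<close>
  define t where "t = min 1 (e\<^sup>2 / (2 * (C + 1)))"
  have t: "0 < t" "t \<le> 1" using C0 e by (auto simp: t_def)
  have tC: "t * C \<le> e\<^sup>2 / 2"
  proof -
    have "t * C \<le> e\<^sup>2 / (2 * (C + 1)) * C" using C0 by (intro mult_right_mono) (auto simp: t_def)
    also have "\<dots> \<le> e\<^sup>2 / 2" using C0 by (simp add: field_simps)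
    finally show ?thesis .
  qed
  define m where "m = Inf (N ` ball 0 R)"
  have bdd: "bdd_below (N ` ball 0 R)"
    by (rule bdd_belowI2[of _ 0]) (simp add: N_def sum_nonneg)
  have "m < m + t * e\<^sup>2 / 2" using t e by simp
  then obtain y where y: "norm y < R" "N y < m + t * e\<^sup>2 / 2"
    using cInf_lessD[of "N ` ball 0 R"] R0 unfolding m_def by fastforce
  define v where "v f = blinfun_apply z f - blinfun_apply f y" for f
  define g where "g = (\<Sum>f\<in>F. v f *\<^sub>R f)"
  have g_apply: "blinfun_apply g x = (\<Sum>f\<in>F. v f * blinfun_apply f x)" for x
    by (simp add: g_def blinfun.sum_left blinfun.scaleR_left)
  have zg: "blinfun_apply z g = blinfun_apply g y + N y"
    unfolding g_apply N_def
    by (simp add: g_def blinfun.sum_right blinfun.scaleR_right sum.distrib[symmetric] v_def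
        power2_eq_square blinfun.diff_right algebra_simps)
  define B where "B = blinfun_apply g y + e\<^sup>2 / 2"
  have gB: "blinfun_apply g y' \<le> B" if y': "norm y' < R" for y'
  proof -
    define w where "w = y' - y"
    have "y + t *\<^sub>R w = (1 - t) *\<^sub>R y + t *\<^sub>R y'" by (simp add: w_def algebra_simps)
    also have "\<dots> \<in> ball 0 R" using t y y' by (intro convexD[OF convex_ball]) auto
    finally have "m \<le> N (y + t *\<^sub>R w)" unfolding m_def by (intro cINF_lower bdd)
    also have "N (y + t *\<^sub>R w) = (\<Sum>f\<in>F. (blinfun_apply f y - blinfun_apply z f)\<^sup>2
        - 2 * t * (v f * blinfun_apply f w) + t\<^sup>2 * (blinfun_apply f w)\<^sup>2)"
      unfolding N_def v_def
      by (intro sum.cong) (auto simp: blinfun.add_right blinfun.scaleR_right power2_eq_square algebra_simps)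
    also have "\<dots> = N y - 2 * t * blinfun_apply g w + t\<^sup>2 * (\<Sum>f\<in>F. (blinfun_apply f w)\<^sup>2)"
      by (simp add: sum.distrib sum_subtractf N_def g_apply sum_distrib_left)
    also have "(\<Sum>f\<in>F. (blinfun_apply f w)\<^sup>2) \<le> C" unfolding C_def
    proof (intro sum_mono)
      fix f
      have "norm w \<le> 2 * R" using norm_triangle_ineq4[of y' y] y y' by (simp add: w_def)
      then have "\<bar>blinfun_apply f w\<bar> \<le> norm f * (2 * R)"
        using norm_blinfun[of f w] by (smt (verit) mult_left_mono norm_ge_zero real_norm_def)
      then show "(blinfun_apply f w)\<^sup>2 \<le> (norm f * (2 * R))\<^sup>2"
        using R0 by (metis abs_ge_zero power2_abs power_mono)
    qed
    finally have "2 * t * blinfun_apply g w \<le> t * e\<^sup>2 / 2 + t\<^sup>2 * C" using y(2) t by (simp add: mult_left_mono)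
    also have "\<dots> = t * (e\<^sup>2 / 2 + t * C)" by (simp add: power2_eq_square algebra_simps)
    also have "\<dots> \<le> t * (e\<^sup>2)" using tC t by (intro mult_left_mono) auto
    finally have "blinfun_apply g w \<le> e\<^sup>2 / 2" using t by simp
    then show ?thesis by (simp add: w_def B_def blinfun.diff_right)
  qed
  \<comment> \<open>\<open>gB\<close> holds in the open ball of radius \<open>R\<close> only, so the
    norm of \<open>g\<close> is estimated on a smaller sphere whose radius is still at least norm
    z.\<close>
  define R' where "R' = (R + norm z) / 2"
  have R': "0 < R'" "norm z \<le> R'" "R' < R" using R R0 by (auto simp: R'_def add_pos_nonneg)
  have B0: "B \<ge> 0" using gB[of 0] R0 by simp
  have "norm g \<le> B / R'"
  proof (rule norm_blinfun_bound)
    show "0 \<le> B / R'" using B0 R' by simp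
    fix x
    have *: "blinfun_apply g u \<le> B / R' * norm u" for u
    proof (cases "u = 0")
      case False
      have "blinfun_apply g ((R' / norm u) *\<^sub>R u) \<le> B" using R' False by (intro gB) simp
      then show ?thesis using False R' by (simp add: blinfun.scaleR_right field_simps)
    qed (use B0 R' in simp)
    show "norm (blinfun_apply g x) \<le> B / R' * norm x"
      using *[of x] *[of "- x"] by (simp add: blinfun.minus_right abs_le_iff)
  qed
  then have "blinfun_apply z g \<le> norm z * (B / R')"
    using blinfun_le[of z g] by (meson mult_left_mono norm_ge_zero order_trans)
  also have "\<dots> \<le> R' * (B / R')" using R' B0 by (intro mult_right_mono) auto
  finally have "N y \<le> e\<^sup>2 / 2" using zg R' by (simp add: B_def)
  moreover have "e\<^sup>2 > 0" using e by simp
  ultimately have Ny: "N y < e\<^sup>2" by linarith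
  have "\<bar>blinfun_apply f y - blinfun_apply z f\<bar> < e" if "f \<in> F" for f
  proof -
    have "(blinfun_apply f y - blinfun_apply z f)\<^sup>2 \<le> N y"
      unfolding N_def by (rule member_le_sum[OF that]) (use F in auto)
    with Ny have "(blinfun_apply f y - blinfun_apply z f)\<^sup>2 < e\<^sup>2" by linarith
    then show ?thesis using e by (metis abs_of_pos power2_less_imp_less power2_abs less_imp_le)
  qed
  with y show ?thesis by blast
qed

section \<open>Affine minorants, geometric series and quadratic estimates\<close>

lemma separate_point_closed_convex:
  fixes H :: "'v::real_normed_vector set"
  assumes "closed H" "convex H" "q \<notin> H"
  obtains f :: "'v \<Rightarrow>\<^sub>L real" and \<alpha> where "blinfun_apply f q < \<alpha>" "\<And>c. c \<in> H \<Longrightarrow> \<alpha> \<le> blinfun_apply f c"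
proof -
  obtain e where e: "e > 0" "ball q e \<subseteq> - H"
    using assms by (metis ComplI open_Compl open_contains_ball)
  obtain f :: "'v \<Rightarrow>\<^sub>L real" and \<alpha> where "\<And>u. u \<in> ball q e \<Longrightarrow> blinfun_apply f u < \<alpha>"
    "\<And>c. c \<in> H \<Longrightarrow> \<alpha> \<le> blinfun_apply f c"
    by (rule separate_open_convex[of "ball q e" H]) (use e assms in auto)
  with e that show ?thesis by (metis centre_in_ball)
qed

text \<open>The functional separating the given point from \<open>H\<close> may have weight 0 on the
  last coordinate. The one separating (p0, r0') from \<open>H\<close> has positive weight, because
  \<open>H\<close> has a point over the same \<open>p0\<close>. Adding it to a large multiple of the
  first keeps the separation and makes the weight positive.\<close>

lemma affine_minorant_above_point:
  fixes H :: "(('a::real_normed_vector \<times> 'c::real_normed_vector) \<times> real) set"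
  assumes H: "closed H" "convex H" and up: "\<And>p r r'. (p, r) \<in> H \<Longrightarrow> r \<le> r' \<Longrightarrow> (p, r') \<in> H"
    and p0: "(p0, r0) \<in> H" "(p0, r0') \<notin> H" and q: "((x, y), r) \<notin> H"
  obtains a :: "'a \<Rightarrow>\<^sub>L real" and b :: "'c \<Rightarrow>\<^sub>L real" and s :: real
    where "r < a x + b y + s" "\<And>u v t. ((u, v), t) \<in> H \<Longrightarrow> a u + b v + s \<le> t"
proof -
  obtain f :: "(('a \<times> 'c) \<times> real) \<Rightarrow>\<^sub>L real" and \<alpha> where f: "blinfun_apply f ((x, y), r) < \<alpha>"
    "\<And>c. c \<in> H \<Longrightarrow> \<alpha> \<le> blinfun_apply f c"
    using separate_point_closed_convex[OF H q] by blast
  obtain f0 :: "(('a \<times> 'c) \<times> real) \<Rightarrow>\<^sub>L real" and \<alpha>0 where f0: "blinfun_apply f0 (p0, r0') < \<alpha>0"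
    "\<And>c. c \<in> H \<Longrightarrow> \<alpha>0 \<le> blinfun_apply f0 c"
    using separate_point_closed_convex[OF H p0(2)] by blast
  obtain a1 b1 \<beta>1 where d1: "\<And>x y r. f ((x, y), r) = blinfun_apply a1 x + blinfun_apply b1 y + \<beta>1 * r"
    using blinfun_on_prod by blast
  obtain a2 b2 \<beta>2 where d2: "\<And>x y r. f0 ((x, y), r) = blinfun_apply a2 x + blinfun_apply b2 y + \<beta>2 * r"
    using blinfun_on_prod by blast
  obtain x0 y0 where xy0: "p0 = (x0, y0)" by (cases p0)
  have lt: "r0' < r0" using p0 up by (metis not_le)
  have \<beta>2: "\<beta>2 > 0"
  proof -
    have "\<beta>2 * r0' < \<beta>2 * r0" using f0(1) f0(2)[OF p0(1)] by (simp add: xy0 d2)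
    with lt show ?thesis by (metis mult_less_cancel_left_disj not_less_iff_gr_or_eq)
  qed
  have \<beta>1: "\<beta>1 \<ge> 0"
  proof (rule ccontr)
    assume n: "\<not> \<beta>1 \<ge> 0"
    define k where "k = (blinfun_apply a1 x0 + blinfun_apply b1 y0 + \<beta>1 * r0 - \<alpha> + 1) / (- \<beta>1)"
    have "0 \<le> blinfun_apply a1 x0 + blinfun_apply b1 y0 + \<beta>1 * r0 - \<alpha>"
      using f(2)[OF p0(1)] by (simp add: xy0 d1)
    then have "k \<ge> 0" unfolding k_def using n by (intro divide_nonneg_pos) auto
    then have "\<alpha> \<le> f (p0, r0 + k)" using up[OF p0(1), of "r0 + k"] by (intro f) simp
    also have "f (p0, r0 + k) = \<alpha> - 1" using n by (simp add: xy0 d1 k_def field_simps)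
    finally show False by simp
  qed
  \<comment> \<open>Large enough for \<open>t\<close> times the first gap to outweigh a deficit of
    the second functional at the point.\<close>
  define t where "t = (\<bar>f0 ((x, y), r) - \<alpha>0\<bar> + 1) / (\<alpha> - f ((x, y), r))"
  have t0: "t > 0" using f(1) by (simp add: t_def)
  have teq: "t * (\<alpha> - f ((x, y), r)) = \<bar>f0 ((x, y), r) - \<alpha>0\<bar> + 1" using f(1) by (simp add: t_def)
  define \<beta> where "\<beta> = t * \<beta>1 + \<beta>2"
  have \<beta>: "\<beta> > 0" using t0 \<beta>1 \<beta>2 by (simp add: \<beta>_def add_nonneg_pos)
  define a where "a = - (1 / \<beta>) *\<^sub>R (t *\<^sub>R a1 + a2)"
  define b where "b = - (1 / \<beta>) *\<^sub>R (t *\<^sub>R b1 + b2)"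
  have ab: "\<beta> * (k - a u - b v) = t * f ((u, v), k) + f0 ((u, v), k)" for u v k
  proof -
    have "\<beta> * a u = - (t * a1 u + a2 u)" "\<beta> * b v = - (t * b1 v + b2 v)"
      using \<beta> by (simp_all add: a_def b_def blinfun.add_left blinfun.scaleR_left blinfun.minus_left)
    then have "\<beta> * (k - a u - b v) = \<beta> * k + (t * a1 u + a2 u) + (t * b1 v + b2 v)"
      by (simp add: right_diff_distrib)
    then show ?thesis by (simp add: d1 d2 \<beta>_def algebra_simps)
  qed
  show ?thesis
  proof (rule that[of a b "(t * \<alpha> + \<alpha>0) / \<beta>"])
    have "\<beta> * (r - a x - b y) < t * \<alpha> + \<alpha>0" unfolding ab using teq by (simp add: algebra_simps)
    then show "r < a x + b y + (t * \<alpha> + \<alpha>0) / \<beta>" using \<beta> by (simp add: field_simps)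
    show "a u + b v + (t * \<alpha> + \<alpha>0) / \<beta> \<le> k" if "((u, v), k) \<in> H" for u v k
    proof -
      have "t * \<alpha> + \<alpha>0 \<le> \<beta> * (k - a u - b v)" unfolding ab
        using f(2)[OF that] f0(2)[OF that] t0 by (intro add_mono mult_left_mono) auto
      then show ?thesis using \<beta> by (simp add: field_simps)
    qed
  qed
qed

lemma geometric_increments_limit:
  fixes f :: "nat \<Rightarrow> 'v::banach"
  assumes "\<And>n. norm (f (Suc n) - f n) \<le> \<sigma> * (1/2) ^ n"
  obtains l where "f \<longlonglongrightarrow> l" "norm (l - f 0) \<le> 2 * \<sigma>"
proof -
  define g where "g n = f (Suc n) - f n" for n
  have geo: "(\<lambda>n. \<sigma> * (1/2) ^ n) sums (\<sigma> * 2)"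
    using sums_mult[OF geometric_sums[of "1/2::real"], of \<sigma>] by simp
  have g: "summable g" "norm (suminf g) \<le> 2 * \<sigma>"
  proof -
    show "summable g"
      by (rule summable_comparison_test[OF _ sums_summable[OF geo]]) (use assms in \<open>auto simp: g_def\<close>)
    have "norm (suminf g) \<le> (\<Sum>n. \<sigma> * (1/2) ^ n)"
      by (rule norm_suminf_le) (use assms geo in \<open>auto simp: g_def sums_iff\<close>)
    then show "norm (suminf g) \<le> 2 * \<sigma>" using geo by (simp add: sums_iff)
  qed
  have "(\<lambda>n. (\<Sum>k<n. g k) + f 0) \<longlonglongrightarrow> suminf g + f 0"
    by (intro tendsto_intros) (use g(1) in \<open>simp add: summable_sums sums_def[symmetric]\<close>)
  moreover have "(\<lambda>n. (\<Sum>k<n. g k) + f 0) = f"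
    by (simp add: g_def sum_lessThan_telescope)
  ultimately have "f \<longlonglongrightarrow> suminf g + f 0" by simp
  then show ?thesis by (rule that) (use g in simp)
qed

text \<open>This is the conjugate of d / 2 times the squared norm, computed line by line: on each
  line the quadratic in the scalar \<open>t\<close> is minimized exactly.\<close>

lemma quadratic_lower_bound_norm:
  fixes f :: "'v::real_normed_vector dual"
  assumes d: "d > 0" and ge: "\<And>v. 0 \<le> m + blinfun_apply f v + d / 2 * (norm v)\<^sup>2"
  shows "(norm f)\<^sup>2 \<le> 2 * d * m"
proof -
  have m: "0 \<le> m" using ge[of 0] by simp
  have "norm f \<le> sqrt (2 * d * m)"
  proof (rule norm_blinfun_bound)
    show "0 \<le> sqrt (2 * d * m)" using d m by simp
    show "norm (blinfun_apply f v) \<le> sqrt (2 * d * m) * norm v" for v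
    proof (cases "v = 0")
      case False
      define n where "n = (norm v)\<^sup>2"
      have n: "n > 0" using False by (simp add: n_def)
      define t where "t = - blinfun_apply f v / (d * n)"
      have "0 \<le> m + t * blinfun_apply f v + d / 2 * (t\<^sup>2 * n)"
        using ge[of "t *\<^sub>R v"] by (simp add: blinfun.scaleR_right power_mult_distrib n_def)
      also have "\<dots> = m - (blinfun_apply f v)\<^sup>2 / (2 * d * n)"
        using n d by (simp add: t_def power2_eq_square field_simps)
      finally have "(blinfun_apply f v)\<^sup>2 \<le> 2 * d * m * n" using n d by (simp add: field_simps)
      then have "sqrt ((blinfun_apply f v)\<^sup>2) \<le> sqrt (2 * d * m * n)" by (rule real_sqrt_le_mono)
      then show ?thesis by (simp add: real_sqrt_mult n_def)
    qed simp
  qed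
  then have "(norm f)\<^sup>2 \<le> (sqrt (2 * d * m))\<^sup>2" by (intro power_mono) auto
  then show ?thesis using d m by simp
qed

lemma norm_sq_convex:
  fixes a b :: "'v::real_normed_vector"
  assumes "0 \<le> u" "0 \<le> v" "u + v = 1"
  shows "(norm (u *\<^sub>R a + v *\<^sub>R b))\<^sup>2 \<le> u * (norm a)\<^sup>2 + v * (norm b)\<^sup>2"
proof -
  have "norm (u *\<^sub>R a + v *\<^sub>R b) \<le> u * norm a + v * norm b"
    using norm_triangle_ineq[of "u *\<^sub>R a" "v *\<^sub>R b"] assms by simp
  then have "(norm (u *\<^sub>R a + v *\<^sub>R b))\<^sup>2 \<le> (u * norm a + v * norm b)\<^sup>2" by (intro power_mono) auto
  also have "\<dots> = u * (norm a)\<^sup>2 + v * (norm b)\<^sup>2 - u * v * (norm a - norm b)\<^sup>2"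
  proof -
    have v: "v = 1 - u" using assms by simp
    show ?thesis unfolding v by (simp add: power2_eq_square algebra_simps)
  qed
  also have "\<dots> \<le> u * (norm a)\<^sup>2 + v * (norm b)\<^sup>2" using assms by simp
  finally show ?thesis .
qed

section \<open>Strong representative functions and Gossez type (D)\<close>

lemma convex_norm_affine_less:
  fixes g :: "'v::real_vector \<Rightarrow> 'w::real_normed_vector"
  assumes "\<And>p q u v. u + v = 1 \<Longrightarrow> g (u *\<^sub>R p + v *\<^sub>R q) = u *\<^sub>R g p + v *\<^sub>R g q"
  shows "convex {q. norm (g q) < e}"
proof (rule convexI, clarify)
  fix p q and u v :: real assume *: "norm (g p) < e" "norm (g q) < e" and uv: "0 \<le> u" "0 \<le> v" "u + v = 1"
  have "u *\<^sub>R g p + v *\<^sub>R g q \<in> ball 0 e" using * uv by (intro convexD[OF convex_ball]) auto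
  then show "norm (g (u *\<^sub>R p + v *\<^sub>R q)) < e" using uv by (simp add: assms)
qed

lemma topspace_wstar [simp]: "topspace wstar = UNIV"
  by (simp add: wstar_def topspace_pullback_topology)

lemma wstar_neighbourhood:
  fixes z :: "'v::real_normed_vector dual"
  assumes "openin wstar U" "z \<in> U"
  obtains F e where "finite F" "e > 0"
    "\<And>y. (\<And>x. x \<in> F \<Longrightarrow> \<bar>blinfun_apply y x - blinfun_apply z x\<bar> < e) \<Longrightarrow> y \<in> U"
proof -
  obtain V :: "('v \<Rightarrow> real) set" where V: "open V" "U = blinfun_apply -` V"
    using assms(1) by (auto simp: wstar_def openin_pullback_topology)
  have "openin (product_topology (\<lambda>i. euclidean) UNIV) V" using V(1) by (simp add: open_fun_def)
  then obtain X where X: "blinfun_apply z \<in> (\<Pi>\<^sub>E i\<in>UNIV. X i)" "\<And>i. open (X i)"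
    "finite {i. X i \<noteq> UNIV}" "(\<Pi>\<^sub>E i\<in>UNIV. X i) \<subseteq> V"
    using product_topology_open_contains_basis[of "\<lambda>i. euclidean" UNIV V "blinfun_apply z"] assms(2) V(2)
    by auto
  have "\<exists>e>0. \<forall>s. \<bar>s - blinfun_apply z i\<bar> < e \<longrightarrow> s \<in> X i" for i
    using X(1,2) by (metis PiE_mem UNIV_I dist_real_def open_dist)
  then obtain \<epsilon> where \<epsilon>: "\<And>i. \<epsilon> i > 0" "\<And>i s. \<bar>s - blinfun_apply z i\<bar> < \<epsilon> i \<Longrightarrow> s \<in> X i" by metis
  show ?thesis
  proof (rule that[of "{i. X i \<noteq> UNIV}" "Min (insert 1 (\<epsilon> ` {i. X i \<noteq> UNIV}))"])
    \<comment> \<open>The 1 keeps the minimum defined when no coordinate is restricted.\<close>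
    show "Min (insert 1 (\<epsilon> ` {i. X i \<noteq> UNIV})) > 0" using X(3) \<epsilon>(1) by (subst Min_gr_iff) auto
    fix y :: "'v dual"
    assume *: "\<And>x. x \<in> {i. X i \<noteq> UNIV} \<Longrightarrow> \<bar>blinfun_apply y x - blinfun_apply z x\<bar> < Min (insert 1 (\<epsilon> ` {i. X i \<noteq> UNIV}))"
    have "blinfun_apply y i \<in> X i" for i
    proof (cases "X i = UNIV")
      case False
      then have "Min (insert 1 (\<epsilon> ` {i. X i \<noteq> UNIV})) \<le> \<epsilon> i" using X(3) by (intro Min_le) auto
      with *[of i] False show ?thesis by (intro \<epsilon>(2)) auto
    qed simp
    then show "y \<in> U" using X(4) V(2) by auto
  qed (use X in simp)
qed

text \<open>\<open>H\<close> plays the role of the epigraph of a strong representative function \<open>h\<close>: the last two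
  assumptions are \<open>h \<ge> c\<close> and \<open>h\<^sup>* \<ge> c\<close>, and \<open>M\<close> below is the set \<open>{h = c}\<close>.\<close>

locale strong_epigraph =
  fixes H :: "(('a::banach \<times> 'a dual) \<times> real) set"
  assumes cvx: "convex H" and closed: "closed H"
    and up: "\<And>p r r'. (p, r) \<in> H \<Longrightarrow> r \<le> r' \<Longrightarrow> (p, r') \<in> H"
    and ge: "\<And>x x' r. ((x, x'), r) \<in> H \<Longrightarrow> blinfun_apply x' x \<le> r"
    and conj_ge: "\<And>b z s. (\<And>x x' r. ((x, x'), r) \<in> H \<Longrightarrow> blinfun_apply b x + blinfun_apply z x' - r \<le> s)
        \<Longrightarrow> blinfun_apply z b \<le> s"
begin

definition M :: "('a \<times> 'a dual) set" where
  "M = {(x, x'). ((x, x'), blinfun_apply x' x) \<in> H}"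

text \<open>For an empty \<open>H\<close> the premise of \<open>conj_ge\<close> holds with every
  bound, and b = z = 0 with bound -1 would give 0 \<le> -1.\<close>

lemma nonempty: "H \<noteq> {}"
  using conj_ge[of 0 0 "-1"] by auto

text \<open>Fenchel duality between \<open>h\<close> and a quadratic: were the infimum positive, a separating functional
  would be a point where \<open>h\<^sup>*\<close> is below the coupling.\<close>

lemma approximate_minimizer:
  assumes d: "d > 0" and e: "e > 0"
  obtains y y' r where "((y, y'), r) \<in> H"
    "r - blinfun_apply x' y - blinfun_apply y' x + blinfun_apply x' x
      + d / 2 * (norm (y - x))\<^sup>2 + 1 / (2 * d) * (norm (y' - x'))\<^sup>2 \<le> e"
proof (rule ccontr)
  assume neg: "\<not> thesis"
  note witness = that
  define g where "g q = - blinfun_apply x' (fst q) - blinfun_apply (snd q) x + blinfun_apply x' x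
      + d / 2 * (norm (fst q - x))\<^sup>2 + 1 / (2 * d) * (norm (snd q - x'))\<^sup>2 - e" for q
  have gH: "r + g q > 0" if "(q, r) \<in> H" for q r
    using neg witness[of "fst q" "snd q" r] that by (fastforce simp: g_def not_le)
  \<comment> \<open>The strict hypograph of the concave function -g; a hyperplane between it and
    \<open>H\<close> encodes the dual point.\<close>
  define U where "U = {q. snd q < - g (fst q)}"
  have "open U" unfolding U_def g_def
    by (intro open_Collect_less continuous_intros blinfun.continuous_on)
  moreover have "convex U"
  proof (rule convexI)
    fix p q and u v :: real assume pq: "p \<in> U" "q \<in> U" and uv: "0 \<le> u" "0 \<le> v" "u + v = 1"
    have v: "v = 1 - u" using uv by simp
    have *: "u *\<^sub>R a + v *\<^sub>R b - c = u *\<^sub>R (a - c) + v *\<^sub>R (b - c)" for a b c :: "'z::real_vector"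
      unfolding v by (simp add: algebra_simps)
    have "g (u *\<^sub>R fst p + v *\<^sub>R fst q) \<le> u * g (fst p) + v * g (fst q)"
    proof -
      have "(norm (u *\<^sub>R fst (fst p) + v *\<^sub>R fst (fst q) - x))\<^sup>2
          \<le> u * (norm (fst (fst p) - x))\<^sup>2 + v * (norm (fst (fst q) - x))\<^sup>2"
        unfolding * by (rule norm_sq_convex) (use uv in auto)
      then have 1: "d / 2 * (norm (u *\<^sub>R fst (fst p) + v *\<^sub>R fst (fst q) - x))\<^sup>2
          \<le> d / 2 * (u * (norm (fst (fst p) - x))\<^sup>2 + v * (norm (fst (fst q) - x))\<^sup>2)"
        using d by (intro mult_left_mono) auto
      have "(norm (u *\<^sub>R snd (fst p) + v *\<^sub>R snd (fst q) - x'))\<^sup>2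
          \<le> u * (norm (snd (fst p) - x'))\<^sup>2 + v * (norm (snd (fst q) - x'))\<^sup>2"
        unfolding * by (rule norm_sq_convex) (use uv in auto)
      then have 2: "1 / (2 * d) * (norm (u *\<^sub>R snd (fst p) + v *\<^sub>R snd (fst q) - x'))\<^sup>2
          \<le> 1 / (2 * d) * (u * (norm (snd (fst p) - x'))\<^sup>2 + v * (norm (snd (fst q) - x'))\<^sup>2)"
        using d by (intro mult_left_mono) auto
      have "g (u *\<^sub>R fst p + v *\<^sub>R fst q) \<le> - (u * blinfun_apply x' (fst (fst p)) + v * blinfun_apply x' (fst (fst q)))
        - (u * blinfun_apply (snd (fst p)) x + v * blinfun_apply (snd (fst q)) x) + blinfun_apply x' x
        + d / 2 * (u * (norm (fst (fst p) - x))\<^sup>2 + v * (norm (fst (fst q) - x))\<^sup>2)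
        + 1 / (2 * d) * (u * (norm (snd (fst p) - x'))\<^sup>2 + v * (norm (snd (fst q) - x'))\<^sup>2) - e"
        using 1 2 unfolding g_def
        by (simp add: blinfun.add_left blinfun.scaleR_left blinfun.add_right blinfun.scaleR_right)
      also have "\<dots> = u * g (fst p) + v * g (fst q)"
        unfolding g_def v by (simp add: algebra_simps diff_divide_distrib)
      finally show ?thesis .
    qed
    also have "u * g (fst p) + v * g (fst q) < - (u * snd p + v * snd q)"
    proof (cases "u = 0")
      case True
      then show ?thesis using pq uv by (simp add: U_def)
    next
      case False
      then have "u * (snd p + g (fst p)) < 0" using pq uv by (intro mult_pos_neg) (auto simp: U_def)
      moreover have "v * (snd q + g (fst q)) \<le> 0"
        using pq uv by (intro mult_nonneg_nonpos) (auto simp: U_def)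
      ultimately have "u * (snd p + g (fst p)) + v * (snd q + g (fst q)) < 0" by simp
      then show ?thesis by (simp add: algebra_simps)
    qed
    finally show "u *\<^sub>R p + v *\<^sub>R q \<in> U" by (simp add: U_def)
  qed
  moreover have U_ne: "(q, - g q - k) \<in> U" if "k > 0" for q k using that by (simp add: U_def)
  then have "U \<noteq> {}" by (metis equals0D zero_less_one)
  moreover have "U \<inter> H = {}" using gH by (fastforce simp: U_def)
  ultimately obtain f :: "(('a \<times> 'a dual) \<times> real) \<Rightarrow>\<^sub>L real" and \<alpha> where f: "\<And>u. u \<in> U \<Longrightarrow> blinfun_apply f u < \<alpha>"
    "\<And>c. c \<in> H \<Longrightarrow> \<alpha> \<le> blinfun_apply f c"
    using separate_open_convex[OF _ _ _ cvx] by blast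
  obtain a b \<beta> where fd: "\<And>x y r. f ((x, y), r) = blinfun_apply a x + blinfun_apply b y + \<beta> * r"
    using blinfun_on_prod by blast
  obtain p r0 where p: "(p, r0) \<in> H" using nonempty by auto
  have \<beta>: "\<beta> > 0"
  proof -
    define s where "s = - g p - 1"
    have "f (p, s) < f (p, r0)"
      using f(1)[OF U_ne[of 1 p]] f(2)[OF p] by (simp add: s_def)
    then have "\<beta> * s < \<beta> * r0" by (cases p) (simp add: fd)
    moreover have "s < r0" using gH[OF p] by (simp add: s_def)
    ultimately show ?thesis by (metis mult_less_cancel_left_disj not_less_iff_gr_or_eq)
  qed
  \<comment> \<open>After this normalization the hyperplane says that the conjugate of
    \<open>h\<close> at (bb, zz) is at most \<open>S\<close>, and that \<open>S\<close> is at most g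
    + bb + zz everywhere.\<close>
  define bb where "bb = (- (1 / \<beta>)) *\<^sub>R a"
  define zz where "zz = (- (1 / \<beta>)) *\<^sub>R b"
  define S where "S = - \<alpha> / \<beta>"
  have fd': "f ((y, y'), r) = \<beta> * (r - bb y - zz y')" for y y' r
    using \<beta> by (simp add: fd bb_def zz_def blinfun.scaleR_left blinfun.minus_left algebra_simps)
  have "zz bb \<le> S"
  proof (rule conj_ge)
    fix y y' r assume "((y, y'), r) \<in> H"
    then have "\<alpha> \<le> \<beta> * (r - bb y - zz y')" using f(2) fd' by metis
    then show "bb y + zz y' - r \<le> S" using \<beta> by (simp add: S_def field_simps)
  qed
  moreover have S_le: "S \<le> g (y, y') + bb y + zz y'" for y y'
  proof (rule field_le_epsilon)
    fix k :: real assume "k > 0"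
    then have "f ((y, y'), - g (y, y') - k) < \<alpha>" using f(1) U_ne by blast
    then have "\<beta> * (- g (y, y') - k - bb y - zz y') < \<alpha>" by (simp add: fd')
    then show "S \<le> g (y, y') + bb y + zz y' + k" using \<beta> by (simp add: S_def field_simps)
  qed
  ultimately have S_le': "zz bb \<le> g (y, y') + bb y + zz y'" for y y' by (meson order_trans)
  \<comment> \<open>\<open>B\<close> and \<open>C\<close> are the slopes relative to the centre (x,
    x'). The two quadratics are then minimized one after the other, first in \<open>v\<close>, then
    in \<open>v'\<close>.\<close>
  define B where "B = bb - x'"
  define C where "C = zz - emb x"
  define K where "K = - e - C B"
  have key: "0 \<le> K + B v + d / 2 * (norm v)\<^sup>2 + (C v' + 1 / (2 * d) * (norm v')\<^sup>2)" for v v'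
    using S_le'[of "x + v" "x' + v'"]
    by (simp add: g_def B_def C_def K_def blinfun.add_left blinfun.add_right blinfun.diff_left
        blinfun.diff_right algebra_simps)
  have "0 \<le> (2 * d * K - (norm B)\<^sup>2) / (2 * d) + C v' + 1 / d / 2 * (norm v')\<^sup>2" for v'
  proof -
    have "(norm B)\<^sup>2 \<le> 2 * d * (K + (C v' + 1 / (2 * d) * (norm v')\<^sup>2))"
      using key[of _ v'] by (intro quadratic_lower_bound_norm d) (simp add: algebra_simps)
    then have "(norm B)\<^sup>2 / (2 * d) \<le> K + (C v' + 1 / (2 * d) * (norm v')\<^sup>2)"
      using d by (simp add: pos_divide_le_eq mult.commute)
    then show ?thesis using d by (simp add: diff_divide_distrib)
  qed
  then have "(norm C)\<^sup>2 \<le> 2 * (1 / d) * ((2 * d * K - (norm B)\<^sup>2) / (2 * d))"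
    using d by (intro quadratic_lower_bound_norm) auto
  then have "(norm C)\<^sup>2 * d\<^sup>2 \<le> 2 * d * K - (norm B)\<^sup>2"
    using d by (simp add: field_simps power2_eq_square)
  then have "(norm C * d)\<^sup>2 + (norm B)\<^sup>2 \<le> 2 * d * K" by (simp add: power_mult_distrib)
  \<comment> \<open>In the product the weight \<open>d\<close> cancels: norm C * norm B \<le> -e - C
    B, which contradicts the norm bound on C B because e > 0.\<close>
  moreover have "2 * (norm C * d) * norm B \<le> (norm C * d)\<^sup>2 + (norm B)\<^sup>2" by (rule sum_squares_bound)
  ultimately have "d * (norm C * norm B) \<le> d * K" by (simp add: algebra_simps)
  then have "norm C * norm B \<le> K" using d by simp
  then show False using blinfun_ge[of C B] e by (simp add: K_def)
qed

section \<open>Approximate monotonicity and the Broendsted-Rockafellar property\<close>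

lemma pairing_shift:
  "r - blinfun_apply x' y - blinfun_apply y' x + blinfun_apply x' x
    = r - blinfun_apply y' y + blinfun_apply (y' - x') (y - x)"
  by (simp add: blinfun.diff_left blinfun.diff_right)

lemma pairing_sq_ge: "0 \<le> blinfun_apply v' v + 1 / 2 * (norm v)\<^sup>2 + 1 / 2 * (norm v')\<^sup>2"
  using blinfun_ge[of v' v] sum_squares_bound[of "norm v'" "norm v"] by simp

text \<open>At a midpoint the coupling is the mean of the two couplings minus a quarter of the
  pairing of the differences; \<open>ge\<close> bounds this by the mean of the two heights.\<close>

lemma approximately_monotone:
  assumes "((x, x'), blinfun_apply x' x + e) \<in> H" "((y, y'), blinfun_apply y' y + e') \<in> H"
  shows "- 2 * (e + e') \<le> blinfun_apply (y' - x') (y - x)"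
proof -
  have "(1/2) *\<^sub>R ((x, x'), blinfun_apply x' x + e) + (1/2) *\<^sub>R ((y, y'), blinfun_apply y' y + e') \<in> H"
    using assms by (intro convexD[OF cvx]) auto
  then have "(((1/2) *\<^sub>R x + (1/2) *\<^sub>R y, (1/2) *\<^sub>R x' + (1/2) *\<^sub>R y'),
      (blinfun_apply x' x + e) / 2 + (blinfun_apply y' y + e') / 2) \<in> H" by simp
  from ge[OF this] show ?thesis
    by (simp add: blinfun.bilinear_simps field_simps)
qed

text \<open>Take an approximate minimizer centred at (x, x') with d = 1. Pairing plus half the
  squares is nonnegative, so its gap is at most e'; the pairing is at least -2 (e + e'), so half the
  squares are at most 2 e + 3 e'. The new gap e' can be chosen independently of \<open>e\<close>,
  which makes iteration possible.\<close>

lemma improve_approximation: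
  assumes p: "((x, x'), blinfun_apply x' x + e) \<in> H" and e': "e' > 0"
  obtains y y' where "((y, y'), blinfun_apply y' y + e') \<in> H"
    "(norm (y - x))\<^sup>2 + (norm (y' - x'))\<^sup>2 \<le> 4 * e + 6 * e'"
proof -
  obtain y y' r where y: "((y, y'), r) \<in> H"
    "r - blinfun_apply x' y - blinfun_apply y' x + blinfun_apply x' x
      + 1 / 2 * (norm (y - x))\<^sup>2 + 1 / (2 * 1) * (norm (y' - x'))\<^sup>2 \<le> e'"
    using approximate_minimizer[of 1 e' x' x] e' by auto
  from y(2) have y2: "r - blinfun_apply y' y + blinfun_apply (y' - x') (y - x)
      + 1 / 2 * (norm (y - x))\<^sup>2 + 1 / 2 * (norm (y' - x'))\<^sup>2 \<le> e'"
    unfolding pairing_shift by simp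
  then have "r \<le> blinfun_apply y' y + e'" using pairing_sq_ge[of "y' - x'" "y - x"] by linarith
  with y have H: "((y, y'), blinfun_apply y' y + e') \<in> H" using up by blast
  have mono: "- 2 * e - 2 * e' \<le> blinfun_apply (y' - x') (y - x)"
    using approximately_monotone[OF p H] by simp
  have "(norm (y - x))\<^sup>2 + (norm (y' - x'))\<^sup>2 \<le> 4 * e + 6 * e'"
    using mono y2 ge[OF y(1)] by linarith
  then show ?thesis by (rule that[OF H])
qed

lemma closed_M: "closed M"
proof -
  have "M = (\<lambda>p. (p, blinfun_apply (snd p) (fst p))) -` H" by (auto simp: M_def)
  moreover have "closed \<dots>"
    by (intro closed_vimage closed continuous_intros blinfun.continuous_on)
  ultimately show ?thesis by simp
qed

text \<open>Iterating the preceding lemma with geometrically decreasing tolerances gives a Cauchy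
  sequence whose limit lies in \<open>M\<close>.\<close>

lemma broendsted_rockafellar:
  assumes \<eta>: "\<eta> > 0"
  obtains e where "e > 0" "\<And>x x'. ((x, x'), blinfun_apply x' x + e) \<in> H
      \<Longrightarrow> \<exists>m m'. (m, m') \<in> M \<and> norm (m - x) \<le> \<eta> \<and> norm (m' - x') \<le> \<eta>"
proof (rule that[of "\<eta>\<^sup>2 / 40"])
  \<comment> \<open>With gap ?e / 4^n at stage n, the squared step is at most (4 + 6/4) ?e / 4^n,
    rounded up to 10 ?e / 4^n = (\<eta> / 2)^2 / 4^n. The steps are thus at most \<eta> / 2 times
    2^-n and add up to \<eta>.\<close>
  let ?e = "\<eta>\<^sup>2 / 40"
  let ?c = "\<lambda>p::'a \<times> 'a dual. blinfun_apply (snd p) (fst p)"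
  show "0 < ?e" using \<eta> by simp
  fix x x' assume x: "((x, x'), blinfun_apply x' x + ?e) \<in> H"
  have "\<exists>f. \<forall>n. ((f n, ?c (f n) + ?e * (1/4) ^ n) \<in> H \<and> (n = 0 \<longrightarrow> f n = (x, x')))
      \<and> norm (f (Suc n) - f n) \<le> \<eta> / 2 * (1/2) ^ n"
  proof (rule dependent_nat_choice)
    show "\<exists>p. (p, ?c p + ?e * (1/4) ^ 0) \<in> H \<and> (0 = (0::nat) \<longrightarrow> p = (x, x'))" using x by auto
    fix p n assume "(p, ?c p + ?e * (1/4) ^ n) \<in> H \<and> (n = 0 \<longrightarrow> p = (x, x'))"
    then have p: "((fst p, snd p), ?c p + ?e * (1/4) ^ n) \<in> H" by simp
    obtain y y' where y: "((y, y'), blinfun_apply y' y + ?e * (1/4) ^ Suc n) \<in> H"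
      "(norm (y - fst p))\<^sup>2 + (norm (y' - snd p))\<^sup>2 \<le> 4 * (?e * (1/4) ^ n) + 6 * (?e * (1/4) ^ Suc n)"
      using improve_approximation[OF p, of "?e * (1/4) ^ Suc n"] \<eta> by auto
    have "(norm ((y, y') - p))\<^sup>2 = (norm (y - fst p))\<^sup>2 + (norm (y' - snd p))\<^sup>2"
      by (cases p) (simp add: norm_Pair)
    also have "\<dots> \<le> 10 * (?e * (1/4) ^ n)" proof -
      have "0 \<le> ?e * (1/4) ^ n" by simp
      with y(2) show ?thesis unfolding power_Suc by linarith
    qed
    also have "\<dots> = (\<eta> / 2 * (1/2) ^ n)\<^sup>2"
    proof -
      have "((1/2::real) ^ n)\<^sup>2 = (1/4) ^ n" by (simp add: power2_eq_square power_mult_distrib[symmetric])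
      then show ?thesis by (simp only: power_mult_distrib) (simp add: power2_eq_square)
    qed
    finally have "norm ((y, y') - p) \<le> \<eta> / 2 * (1/2) ^ n" by (rule power2_le_imp_le) (use \<eta> in simp)
    then show "\<exists>q. ((q, ?c q + ?e * (1/4) ^ Suc n) \<in> H \<and> (Suc n = 0 \<longrightarrow> q = (x, x')))
        \<and> norm (q - p) \<le> \<eta> / 2 * (1/2) ^ n"
      using y(1) by (intro exI[of _ "(y, y')"]) simp
  qed
  then obtain f where f: "\<And>n. (f n, ?c (f n) + ?e * (1/4) ^ n) \<in> H" "f 0 = (x, x')"
    "\<And>n. norm (f (Suc n) - f n) \<le> \<eta> / 2 * (1/2) ^ n" by metis
  obtain l where l: "f \<longlonglongrightarrow> l" "norm (l - f 0) \<le> 2 * (\<eta> / 2)"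
    using geometric_increments_limit[OF f(3)] by blast
  have "(\<lambda>n. (f n, ?c (f n) + ?e * (1/4) ^ n)) \<longlonglongrightarrow> (l, ?c l + ?e * 0)"
    by (intro tendsto_intros l blinfun.tendsto LIMSEQ_power_zero) simp
  then have "(l, ?c l + ?e * 0) \<in> H"
    by (rule closed_sequentially[OF closed, rotated]) (use f in auto)
  then have "l \<in> M" by (simp add: M_def split_beta)
  moreover have "norm (fst l - x) \<le> \<eta>" "norm (snd l - x') \<le> \<eta>"
    using l(2) norm_fst_le[of "fst l - x" "snd l - x'"] norm_snd_le[of "snd l - x'" "fst l - x"] f(2)
    by (cases l, simp)+
  ultimately show "\<exists>m m'. (m, m') \<in> M \<and> norm (m - x) \<le> \<eta> \<and> norm (m' - x') \<le> \<eta>"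
    by (metis prod.collapse)
qed

lemma monotone_M: "monotone_op M"
  unfolding monotone_op_def
proof clarify
  fix x x' y y' assume "(x, x') \<in> M" "(y, y') \<in> M"
  then show "0 \<le> blinfun_apply (x' - y') (x - y)"
    using approximately_monotone[of y y' 0 x x' 0] by (simp add: M_def)
qed

text \<open>\<open>M\<close> is closed, so points of \<open>M\<close> near (x, x') suffice. An
  approximate minimizer centred there is moved into \<open>M\<close>; the pairing with the moved
  point is nonnegative by assumption, so nothing can offset the squared distances and they must be
  small.\<close>

lemma monotonically_related_mem:
  assumes rel: "\<And>m m'. (m, m') \<in> M \<Longrightarrow> 0 \<le> blinfun_apply (x' - m') (x - m)"
  shows "(x, x') \<in> M"
proof -
  have "\<exists>p\<in>M. dist p (x, x') < \<epsilon>" if \<epsilon>: "\<epsilon> > 0" for \<epsilon>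
  proof -
    \<comment> \<open>The point of \<open>M\<close> found below is within 5 \<delta> in each
      component, hence within 10 \<delta> < \<epsilon> in the product.\<close>
    define \<delta> where "\<delta> = \<epsilon> / 11"
    have \<delta>: "\<delta> > 0" using \<epsilon> by (simp add: \<delta>_def)
    obtain e where e: "e > 0" "\<And>x x'. ((x, x'), blinfun_apply x' x + e) \<in> H
      \<Longrightarrow> \<exists>m m'. (m, m') \<in> M \<and> norm (m - x) \<le> \<delta> \<and> norm (m' - x') \<le> \<delta>"
      using broendsted_rockafellar[OF \<delta>] by blast
    define k where "k = min e (\<delta>\<^sup>2)"
    have k: "k > 0" "k \<le> e" "k \<le> \<delta>\<^sup>2" using e \<delta> by (auto simp: k_def)
    obtain y y' r where y: "((y, y'), r) \<in> H"
      "r - blinfun_apply x' y - blinfun_apply y' x + blinfun_apply x' x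
        + 1 / 2 * (norm (y - x))\<^sup>2 + 1 / (2 * 1) * (norm (y' - x'))\<^sup>2 \<le> k"
      using approximate_minimizer[of 1 k x' x] k by auto
    from y(2) have y2: "r - blinfun_apply y' y + blinfun_apply (y' - x') (y - x)
        + 1 / 2 * (norm (y - x))\<^sup>2 + 1 / 2 * (norm (y' - x'))\<^sup>2 \<le> k"
      unfolding pairing_shift by simp
    then have "r \<le> blinfun_apply y' y + e" using pairing_sq_ge[of "y' - x'" "y - x"] k by linarith
    with y have "((y, y'), blinfun_apply y' y + e) \<in> H" using up by blast
    then obtain m m' where m: "(m, m') \<in> M" "norm (m - y) \<le> \<delta>" "norm (m' - y') \<le> \<delta>"
      using e(2) by blast
    define a where "a = norm (y - x)"
    define b where "b = norm (y' - x')"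
    have mb: "norm (m' - x') \<le> b + \<delta>" "norm (m - x) \<le> a + \<delta>"
      using norm_triangle_ineq[of "m' - y'" "y' - x'"] norm_triangle_ineq[of "m - y" "y - x"] m
      by (auto simp: a_def b_def)
    have "0 \<le> blinfun_apply (m' - x') (m - x)"
      using rel[OF m(1)] by (simp add: blinfun.bilinear_simps)
    moreover have "blinfun_apply (y' - x') (y - x) = blinfun_apply (m' - x') (m - x)
        + blinfun_apply (y' - m') (y - x) + blinfun_apply (m' - x') (y - m)"
      by (simp add: blinfun.diff_left blinfun.diff_right)
    moreover have "- (\<delta> * a) \<le> blinfun_apply (y' - m') (y - x)"
      using blinfun_ge[of "y' - m'" "y - x"] mult_right_mono[OF m(3), of a]
      by (simp add: a_def norm_minus_commute)
    moreover have "- ((b + \<delta>) * \<delta>) \<le> blinfun_apply (m' - x') (y - m)"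
    proof -
      have "norm (m' - x') * norm (y - m) \<le> (b + \<delta>) * \<delta>"
        using mb m by (intro mult_mono) (auto simp: norm_minus_commute b_def intro: order_trans[OF norm_ge_zero])
      then show ?thesis using blinfun_ge[of "m' - x'" "y - m"] by linarith
    qed
    ultimately have "- (\<delta> * a) - (b + \<delta>) * \<delta> + 1 / 2 * a\<^sup>2 + 1 / 2 * b\<^sup>2 \<le> \<delta>\<^sup>2"
      using y2 ge[OF y(1)] k by (simp add: a_def b_def)
    then have sq: "(a - \<delta>)\<^sup>2 + (b - \<delta>)\<^sup>2 \<le> 6 * \<delta>\<^sup>2"
      by (simp add: power2_eq_square algebra_simps)
    have "(3 * \<delta>)\<^sup>2 = 9 * \<delta>\<^sup>2" by (simp add: power_mult_distrib)
    with sq zero_le_power2[of "a - \<delta>"] zero_le_power2[of "b - \<delta>"] zero_le_power2[of \<delta>]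
    have "(a - \<delta>)\<^sup>2 \<le> (3 * \<delta>)\<^sup>2 \<and> (b - \<delta>)\<^sup>2 \<le> (3 * \<delta>)\<^sup>2" by linarith
    then have "a - \<delta> \<le> 3 * \<delta>" "b - \<delta> \<le> 3 * \<delta>"
      using \<delta> power2_le_imp_le[of "a - \<delta>" "3 * \<delta>"] power2_le_imp_le[of "b - \<delta>" "3 * \<delta>"] by auto
    then have "norm (m - x) \<le> 5 * \<delta>" "norm (m' - x') \<le> 5 * \<delta>" using mb by auto
    then have "dist (m, m') (x, x') \<le> 10 * \<delta>"
      using norm_Pair_le[of "m - x" "m' - x'"] by (simp add: dist_norm)
    also have "\<dots> < \<epsilon>" using \<epsilon> by (simp add: \<delta>_def)
    finally show ?thesis using m(1) by blast
  qed
  then show ?thesis using closed_M closed_approachable by blast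
qed

lemma maximal_monotone_M: "maximal_monotone M"
  unfolding maximal_monotone_def
proof (intro conjI monotone_M allI impI)
  fix S' assume S': "monotone_op S' \<and> M \<subseteq> S'"
  have "p \<in> M" if "p \<in> S'" for p
  proof (cases p)
    case (Pair x x')
    have "(x, x') \<in> M"
    proof (rule monotonically_related_mem)
      fix m m' assume "(m, m') \<in> M"
      then show "0 \<le> blinfun_apply (x' - m') (x - m)"
        using S' that unfolding monotone_op_def Pair by fast
    qed
    then show ?thesis using Pair by simp
  qed
  with S' show "S' = M" by blast
qed

text \<open>Type (NI): this uses the approximate minimizers around \<open>(0, \<xi>)\<close> for a small weight \<open>d\<close>
  on the first component.\<close>

lemma negative_infimum:
  fixes z :: "'a dual dual"
  assumes \<kappa>: "\<kappa> > 0"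
  obtains m m' where "(m, m') \<in> M" "blinfun_apply (z - emb m) (\<xi> - m') \<le> \<kappa>"
proof -
  define Z where "Z = norm z + 1"
  have Z: "Z \<ge> 1" by (simp add: Z_def)
  \<comment> \<open>\<open>d\<close> makes the supremum over t of (norm z + \<eta>) t - t^2 / (2 d)
    at most \<kappa> / 4. The choice of \<eta> gives \<kappa> / 4 for \<eta> (norm z + \<eta>), and
    \<kappa> / 16 for the supremum over R of \<eta> R - d R^2 / 2; the norm R of the minimizer has
    no bound of its own and must be absorbed in this way.\<close>
  define d where "d = \<kappa> / (2 * Z\<^sup>2)"
  define \<eta> where "\<eta> = min 1 (\<kappa> / (4 * Z))"
  have d: "d > 0" using \<kappa> Z by (simp add: d_def)
  have \<eta>: "0 < \<eta>" "\<eta> \<le> 1" "\<eta> * Z \<le> \<kappa> / 4"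
  proof -
    show "0 < \<eta>" "\<eta> \<le> 1" using \<kappa> Z by (auto simp: \<eta>_def)
    have "\<eta> * Z \<le> \<kappa> / (4 * Z) * Z" using Z by (intro mult_right_mono) (auto simp: \<eta>_def)
    then show "\<eta> * Z \<le> \<kappa> / 4" using Z by simp
  qed
  obtain e where e: "e > 0" "\<And>x x'. ((x, x'), blinfun_apply x' x + e) \<in> H
      \<Longrightarrow> \<exists>m m'. (m, m') \<in> M \<and> norm (m - x) \<le> \<eta> \<and> norm (m' - x') \<le> \<eta>"
    using broendsted_rockafellar[OF \<eta>(1)] by blast
  define k where "k = min e (\<kappa> / 4)"
  have k: "k > 0" "k \<le> e" "k \<le> \<kappa> / 4" using e \<kappa> by (auto simp: k_def)
  obtain y y' r where y: "((y, y'), r) \<in> H"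
    "r - blinfun_apply \<xi> y - blinfun_apply y' 0 + blinfun_apply \<xi> 0
      + d / 2 * (norm (y - 0))\<^sup>2 + 1 / (2 * d) * (norm (y' - \<xi>))\<^sup>2 \<le> k"
    using approximate_minimizer[of d k \<xi> 0] k d by auto
  define R where "R = norm y"
  define t where "t = norm (y' - \<xi>)"
  have y2: "r - blinfun_apply y' y + blinfun_apply (y' - \<xi>) y + d / 2 * R\<^sup>2 + 1 / (2 * d) * t\<^sup>2 \<le> k"
    using y(2) unfolding pairing_shift by (simp add: R_def t_def)
  have "- (t * R) \<le> blinfun_apply (y' - \<xi>) y" unfolding t_def R_def by (rule blinfun_ge)
  moreover have "t * R \<le> d / 2 * R\<^sup>2 + 1 / (2 * d) * t\<^sup>2"
  proof -
    have "2 * (d * R) * t \<le> (d * R)\<^sup>2 + t\<^sup>2" by (rule sum_squares_bound)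
    then show ?thesis using d by (simp add: field_simps power2_eq_square)
  qed
  ultimately have "r \<le> blinfun_apply y' y + e" using y2 k by linarith
  with y have "((y, y'), blinfun_apply y' y + e) \<in> H" using up by blast
  then obtain m m' where m: "(m, m') \<in> M" "norm (m - y) \<le> \<eta>" "norm (m' - y') \<le> \<eta>"
    using e(2) by blast
  define u where "u = m - y"
  define u' where "u' = m' - y'"
  have my: "m = y + u" "m' = y' + u'" by (simp_all add: u_def u'_def)
  have u: "norm u \<le> \<eta>" "norm u' \<le> \<eta>" using m by (auto simp: u_def u'_def)
  have 1: "blinfun_apply (y' - \<xi>) u \<le> t * \<eta>"
    using blinfun_le[of "y' - \<xi>" u] mult_left_mono[OF u(1), of t] by (simp add: t_def)
  have 2: "blinfun_apply u' y \<le> \<eta> * R"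
    using blinfun_le[of u' y] mult_right_mono[OF u(2), of R] by (simp add: R_def)
  have 3: "blinfun_apply u' u \<le> \<eta> * \<eta>"
    using blinfun_le[of u' u] mult_mono[OF u(2) u(1)] \<eta> by simp
  have 4: "- blinfun_apply z (y' - \<xi>) \<le> norm z * t"
    using blinfun_ge[of z "y' - \<xi>"] by (simp add: t_def)
  have 5: "- blinfun_apply z u' \<le> norm z * \<eta>"
    using blinfun_ge[of z u'] mult_left_mono[OF u(2), of "norm z"] by simp
  have "blinfun_apply (z - emb m) (\<xi> - m') = blinfun_apply (y' - \<xi>) y + blinfun_apply (y' - \<xi>) u
      + blinfun_apply u' y + blinfun_apply u' u - blinfun_apply z (y' - \<xi>) - blinfun_apply z u'"
    by (simp add: my blinfun.bilinear_simps)
  also have "\<dots> \<le> (k - d / 2 * R\<^sup>2 - 1 / (2 * d) * t\<^sup>2) + t * \<eta> + \<eta> * R + \<eta> * \<eta> + norm z * t + norm z * \<eta>"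
    using 1 2 3 4 5 y2 ge[OF y(1)] by linarith
  also have "\<dots> = k + \<eta> * (norm z + \<eta>) + (\<eta> * R - d / 2 * R\<^sup>2) + ((norm z + \<eta>) * t - 1 / (2 * d) * t\<^sup>2)"
    by (simp add: algebra_simps)
  also have "\<dots> \<le> \<kappa> / 4 + \<kappa> / 4 + \<kappa> / 16 + \<kappa> / 4"
  proof (intro add_mono)
    show "k \<le> \<kappa> / 4" by (rule k)
    have nz: "norm z + \<eta> \<le> Z" "0 \<le> norm z + \<eta>" using \<eta> by (auto simp: Z_def)
    then show "\<eta> * (norm z + \<eta>) \<le> \<kappa> / 4" using \<eta> by (meson mult_left_mono less_imp_le order_trans)
    have "2 * \<eta> * (d * R) \<le> \<eta>\<^sup>2 + (d * R)\<^sup>2" by (rule sum_squares_bound)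
    then have "\<eta> * R - d / 2 * R\<^sup>2 \<le> \<eta>\<^sup>2 / (2 * d)"
      using d by (simp add: field_simps power2_eq_square)
    also have "\<dots> = (\<eta> * Z)\<^sup>2 / \<kappa>" using \<kappa> Z by (simp add: d_def power_mult_distrib)
    also have "\<dots> \<le> (\<kappa> / 4)\<^sup>2 / \<kappa>" using \<eta> Z \<kappa> by (intro divide_right_mono power_mono) auto
    also have "\<dots> = \<kappa> / 16" using \<kappa> by (simp add: power2_eq_square)
    finally show "\<eta> * R - d / 2 * R\<^sup>2 \<le> \<kappa> / 16" .
    have "2 * (d * (norm z + \<eta>)) * t \<le> (d * (norm z + \<eta>))\<^sup>2 + t\<^sup>2" by (rule sum_squares_bound)
    then have "(norm z + \<eta>) * t - 1 / (2 * d) * t\<^sup>2 \<le> d * (norm z + \<eta>)\<^sup>2 / 2"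
      using d by (simp add: field_simps power2_eq_square)
    also have "\<dots> \<le> d * Z\<^sup>2 / 2" using d nz by (intro divide_right_mono mult_left_mono power_mono) auto
    also have "\<dots> = \<kappa> / 4" using Z by (simp add: d_def)
    finally show "(norm z + \<eta>) * t - 1 / (2 * d) * t\<^sup>2 \<le> \<kappa> / 4" .
  qed
  also have "\<dots> \<le> \<kappa>" using \<kappa> by simp
  finally show ?thesis by (rule that[OF m(1)])
qed

text \<open>Separating the graph of the coupling over \<open>M\<close> from the neighbourhood produces a direction
  \<open>(e, d)\<close> along which \<open>(z - t e, x' - t d)\<close> violates type (NI) for small \<open>t\<close>.\<close>

lemma convex_combination_near_closure_point:
  fixes z :: "'a dual dual"
  assumes zx: "(z, x') \<in> gossez_closure M" and F: "finite F" and e: "e > 0"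
  obtains y y' r where "((y, y'), r) \<in> convex hull ((\<lambda>p. (p, blinfun_apply (snd p) (fst p))) ` M)"
    "norm y < norm z + 1" "norm (y' - x') < e" "\<And>f. f \<in> F \<Longrightarrow> \<bar>blinfun_apply f y - blinfun_apply z f\<bar> < e"
    "r < blinfun_apply z x' + e"
proof (rule ccontr)
  assume neg: "\<not> thesis"
  note witness = that
  define C where "C = convex hull ((\<lambda>p. (p, blinfun_apply (snd p) (fst p))) ` M)"
  define U where "U = {q. norm (fst (fst q)) < norm z + 1} \<inter> {q. norm (snd (fst q) - x') < e}
    \<inter> (\<Inter>f\<in>F. {q. norm (blinfun_apply f (fst (fst q)) - blinfun_apply z f) < e})
    \<inter> {q. snd q < blinfun_apply z x' + e}"
  have U_iff: "((y, y'), r) \<in> U \<longleftrightarrow> norm y < norm z + 1 \<and> norm (y' - x') < e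
      \<and> (\<forall>f\<in>F. \<bar>blinfun_apply f y - blinfun_apply z f\<bar> < e) \<and> r < blinfun_apply z x' + e" for y y' r
    by (auto simp: U_def)
  have "U \<inter> C = {}"
  proof -
    have "((y, y'), r) \<notin> U" if "((y, y'), r) \<in> C" for y y' r
      using that neg witness[of y y' r] unfolding U_iff C_def by blast
    then show ?thesis by (metis disjoint_iff prod.collapse)
  qed
  moreover have "open U" unfolding U_def
    by (intro open_Int open_INT F ballI open_Collect_less continuous_intros blinfun.continuous_on)
  moreover have "convex U" unfolding U_def
  proof (intro convex_Int convex_INT convex_norm_affine_less)
    show "convex {q. snd q < blinfun_apply z x' + e}"
    proof -
      have eq: "{q. snd q < blinfun_apply z x' + e} = snd -` {..< blinfun_apply z x' + e}" by auto
      show ?thesis unfolding eq by (intro convex_linear_vimage linear_snd convex_real_interval)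
    qed
  next
    fix p q :: "('a \<times> 'a dual) \<times> real" and u v :: real assume uv: "u + v = 1"
    have v: "v = 1 - u" using uv by simp
    show "fst (fst (u *\<^sub>R p + v *\<^sub>R q)) = u *\<^sub>R fst (fst p) + v *\<^sub>R fst (fst q)" by simp
    show "snd (fst (u *\<^sub>R p + v *\<^sub>R q)) - x' = u *\<^sub>R (snd (fst p) - x') + v *\<^sub>R (snd (fst q) - x')"
      unfolding v by (simp add: algebra_simps)
    fix f
    show "blinfun_apply f (fst (fst (u *\<^sub>R p + v *\<^sub>R q))) - blinfun_apply z f
      = u *\<^sub>R (blinfun_apply f (fst (fst p)) - blinfun_apply z f) + v *\<^sub>R (blinfun_apply f (fst (fst q)) - blinfun_apply z f)"
      unfolding v by (simp add: blinfun.add_right blinfun.diff_right blinfun.scaleR_right algebra_simps)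
  qed
  moreover obtain y0 where y0: "norm y0 < norm z + 1" "\<forall>f\<in>F. \<bar>blinfun_apply f y0 - blinfun_apply z f\<bar> < e"
    using goldstine[OF F _ e, of z "norm z + 1"] by auto
  have low: "((y0, x'), blinfun_apply z x' - k) \<in> U" if "k \<ge> 0" for k
    using y0 e that by (simp add: U_iff)
  then have "U \<noteq> {}" by blast
  moreover have "convex C" by (simp add: C_def)
  ultimately obtain f :: "(('a \<times> 'a dual) \<times> real) \<Rightarrow>\<^sub>L real" and \<alpha> where
    f: "\<And>u. u \<in> U \<Longrightarrow> blinfun_apply f u < \<alpha>" "\<And>c. c \<in> C \<Longrightarrow> \<alpha> \<le> blinfun_apply f c"
    using separate_open_convex[of U C] by blast
  obtain a b \<beta> where fd: "\<And>x y r. f ((x, y), r) = blinfun_apply a x + blinfun_apply b y + \<beta> * r"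
    using blinfun_on_prod by blast
  \<comment> \<open>\<open>U\<close> is unbounded below in its last coordinate, so a negative weight
    would make \<open>f\<close> unbounded above on it.\<close>
  have \<beta>: "\<beta> \<ge> 0"
  proof (rule ccontr)
    assume n: "\<not> \<beta> \<ge> 0"
    define k where "k = (\<alpha> - f ((y0, x'), blinfun_apply z x')) / (- \<beta>)"
    have "k \<ge> 0" unfolding k_def using n f(1)[OF low[of 0]] by (intro divide_nonneg_pos) auto
    then have "f ((y0, x'), blinfun_apply z x' - k) < \<alpha>" by (intro f low)
    moreover have "f ((y0, x'), blinfun_apply z x' - k) = f ((y0, x'), blinfun_apply z x') - \<beta> * k"
      by (simp add: fd algebra_simps)
    moreover have "\<beta> * k = - (\<alpha> - f ((y0, x'), blinfun_apply z x'))" using n by (simp add: k_def)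
    ultimately show False by simp
  qed
  obtain m0 where m0: "m0 \<in> M" using negative_infimum[of 1 0 0] by (metis zero_less_one)
  define c0 where "c0 = (m0, blinfun_apply (snd m0) (fst m0))"
  \<comment> \<open>\<open>f\<close> increases strictly from the centre of \<open>U\<close> to a
    point over \<open>M\<close>. A small multiple \<open>v\<close> of this direction fits into the
    slack of \<open>U\<close> and gives a uniform margin \<kappa>, which survives the passage from
    points y of the space to z in the bidual.\<close>
  define w where "w = c0 - ((y0, x'), blinfun_apply z x')"
  have "c0 \<in> C" using m0 by (auto simp: C_def c0_def intro!: hull_inc)
  then have fw: "f w > 0" using f(1)[OF low[of 0]] f(2)[of c0] by (simp add: w_def blinfun.diff_right)
  define K where "K = (\<Sum>f\<in>F. norm f)"
  have K: "K \<ge> 0" "\<And>f. f \<in> F \<Longrightarrow> norm f \<le> K"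
    unfolding K_def by (auto intro: sum_nonneg member_le_sum F)
  define \<delta> where "\<delta> = min (1/2) (e / (2 * (K + 1)))"
  have \<delta>: "\<delta> > 0" "\<delta> \<le> 1/2" "\<delta> < e" "\<delta> * K < e / 2"
  proof -
    show "\<delta> > 0" using e K by (simp add: \<delta>_def)
    show "\<delta> \<le> 1/2" unfolding \<delta>_def by (rule min.cobounded1)
    have "\<delta> * (K + 1) \<le> e / (2 * (K + 1)) * (K + 1)" using K by (intro mult_right_mono) (auto simp: \<delta>_def)
    also have "\<dots> = e / 2" using K(1) by (simp add: field_simps)
    finally have *: "\<delta> * K + \<delta> \<le> e / 2" by (simp add: algebra_simps)
    then show "\<delta> * K < e / 2" using \<open>\<delta> > 0\<close> by simp
    have "\<delta> * K \<ge> 0" using \<open>\<delta> > 0\<close> K by simp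
    with * e show "\<delta> < e" by linarith
  qed
  define v where "v = (\<delta> / (norm w + 1)) *\<^sub>R w"
  have "norm v \<le> \<delta>"
  proof -
    have "norm v = \<delta> * (norm w / (norm w + 1))" using \<delta> by (simp add: v_def)
    also have "\<dots> \<le> \<delta> * 1" using \<delta>
      by (intro mult_left_mono) (auto simp: divide_le_eq add_nonneg_pos intro: add_nonneg_pos)
    finally show ?thesis by simp
  qed
  define \<kappa> where "\<kappa> = f v"
  have \<kappa>: "\<kappa> > 0" using fw \<delta> by (simp add: \<kappa>_def v_def blinfun.scaleR_right add_nonneg_pos)
  obtain v1 v2 v3 where v: "v = ((v1, v2), v3)" by (metis prod.collapse)
  have vn: "norm v1 \<le> \<delta>" "norm v2 \<le> \<delta>" "\<bar>v3\<bar> \<le> \<delta>"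
    using \<open>norm v \<le> \<delta>\<close> norm_fst_le[of "(v1, v2)" v3] norm_snd_le[of v3 "(v1, v2)"]
      norm_fst_le[of v1 v2] norm_snd_le[of v2 v1] by (auto simp: v)
  \<comment> \<open>Goldstine with \<open>a\<close> added to the test functionals: \<open>y\<close>
    imitates \<open>z\<close> at \<open>a\<close> too, and half of each tolerance is left for the
    shift \<open>v\<close>.\<close>
  have \<alpha>_ge: "blinfun_apply z a + b x' + \<beta> * blinfun_apply z x' + \<kappa> \<le> \<alpha>"
  proof (rule field_le_epsilon)
    fix k :: real assume k: "k > 0"
    obtain y where y: "norm y < norm z + 1/2"
      "\<forall>f\<in>insert a F. \<bar>blinfun_apply f y - blinfun_apply z f\<bar> < min k (e/2)"
      using goldstine[of "insert a F" z "norm z + 1/2" "min k (e/2)"] F k e by auto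
    have "((y + v1, x' + v2), blinfun_apply z x' + v3) \<in> U"
      unfolding U_iff
    proof (intro conjI ballI)
      show "norm (y + v1) < norm z + 1" using norm_triangle_ineq[of y v1] y vn \<delta> by linarith
      show "norm (x' + v2 - x') < e" using vn \<delta> by simp
      show "blinfun_apply z x' + v3 < blinfun_apply z x' + e" using vn \<delta> by simp
      fix g assume g: "g \<in> F"
      have "\<bar>blinfun_apply g v1\<bar> \<le> norm g * norm v1" using norm_blinfun[of g v1] by simp
      also have "\<dots> \<le> K * \<delta>" using K g vn by (intro mult_mono) auto
      finally have "\<bar>blinfun_apply g v1\<bar> < e / 2" using \<delta> by (simp add: mult.commute)
      moreover have "\<bar>blinfun_apply g y - blinfun_apply z g\<bar> < e / 2" using y g by auto
      ultimately have "\<bar>blinfun_apply g y - blinfun_apply z g\<bar> + \<bar>blinfun_apply g v1\<bar> < e" by simp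
      then show "\<bar>blinfun_apply g (y + v1) - blinfun_apply z g\<bar> < e"
        using abs_triangle_ineq[of "blinfun_apply g y - blinfun_apply z g" "blinfun_apply g v1"]
        by (simp add: blinfun.add_right algebra_simps)
    qed
    then have "f ((y + v1, x' + v2), blinfun_apply z x' + v3) < \<alpha>" by (rule f)
    then have "a y + b x' + \<beta> * blinfun_apply z x' + \<kappa> < \<alpha>"
      by (simp add: \<kappa>_def v fd blinfun.add_right algebra_simps)
    moreover have "\<bar>blinfun_apply a y - blinfun_apply z a\<bar> < k" using y by auto
    ultimately show "blinfun_apply z a + b x' + \<beta> * blinfun_apply z x' + \<kappa> \<le> \<alpha> + k" by linarith
  qed
  \<comment> \<open>Expanded around (z, x'), the separating functional on the graph is \<beta> times
    the pairing plus a linear part with coefficients \<open>d\<close> and \<open>ee\<close>.\<close>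
  define d where "d = a + \<beta> *\<^sub>R x'"
  define ee where "ee = b + \<beta> *\<^sub>R z"
  have on_M: "\<beta> * (z - emb m) (x' - m') + (d m - z d) + ee (m' - x') \<ge> \<kappa>"
    if "(m, m') \<in> M" for m m'
  proof -
    have "((m, m'), blinfun_apply m' m) \<in> C" using that by (force simp: C_def intro!: hull_inc)
    then have "\<alpha> \<le> a m + b m' + \<beta> * blinfun_apply m' m" using f(2) fd by metis
    moreover have "\<beta> * (z - emb m) (x' - m') + (d m - z d) + ee (m' - x')
        = (a m + b m' + \<beta> * blinfun_apply m' m) - blinfun_apply z a - b x' - \<beta> * blinfun_apply z x'"
      by (simp add: d_def ee_def blinfun.bilinear_simps algebra_simps)
    ultimately show ?thesis using \<alpha>_ge by linarith
  qed
  \<comment> \<open>t \<beta> \<le> 1 lets the nonnegative \<open>q\<close> cover the loss t \<beta>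
    q, and t |ee d| \<le> \<kappa> / 2 leaves half of the gain t \<kappa> after the second-order
    term. The pairing is then at least t \<kappa> / 2, against t \<kappa> / 4 from
    \<open>negative_infimum\<close>.\<close>
  define t where "t = min (1 / (\<beta> + 1)) (\<kappa> / (2 * (\<bar>ee d\<bar> + 1)))"
  have t: "t > 0" using \<beta> \<kappa> by (simp add: t_def add_nonneg_pos)
  have t\<beta>: "t * \<beta> \<le> 1"
  proof -
    have "t * \<beta> \<le> 1 / (\<beta> + 1) * \<beta>" using \<beta> by (intro mult_right_mono) (auto simp: t_def)
    also have "\<dots> \<le> 1" using \<beta> by simp
    finally show ?thesis .
  qed
  have t\<kappa>: "t * \<bar>ee d\<bar> \<le> \<kappa> / 2"
  proof -
    have "t * \<bar>ee d\<bar> \<le> \<kappa> / (2 * (\<bar>ee d\<bar> + 1)) * \<bar>ee d\<bar>" by (intro mult_right_mono) (auto simp: t_def)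
    also have "\<dots> \<le> \<kappa> / 2" using \<kappa> by (simp add: field_simps)
    finally show ?thesis .
  qed
  obtain m m' where m: "(m, m') \<in> M" "(z - t *\<^sub>R ee - emb m) ((x' - t *\<^sub>R d) - m') \<le> t * \<kappa> / 4"
    using negative_infimum[of "t * \<kappa> / 4" "z - t *\<^sub>R ee" "x' - t *\<^sub>R d"] t \<kappa> by auto
  define q where "q = (z - emb m) (x' - m')"
  have q: "q \<ge> 0" using zx m(1) by (auto simp: gossez_closure_def q_def)
  have "(z - t *\<^sub>R ee - emb m) ((x' - t *\<^sub>R d) - m')
      = q + t * (d m - z d + ee (m' - x')) + t * (t * ee d)"
    by (simp add: q_def blinfun.bilinear_simps algebra_simps)
  moreover have "t * (\<kappa> - \<beta> * q) \<le> t * (d m - z d + ee (m' - x'))"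
    using on_M[OF m(1)] t by (intro mult_left_mono) (auto simp: q_def)
  moreover have "t * (- (\<kappa> / 2)) \<le> t * (t * ee d)"
  proof (intro mult_left_mono)
    have "- (t * \<bar>ee d\<bar>) \<le> t * ee d" using t by (simp add: abs_if)
    then show "- (\<kappa> / 2) \<le> t * ee d" using t\<kappa> by linarith
  qed (use t in simp)
  moreover have "t * \<beta> * q \<le> 1 * q" using t\<beta> q by (intro mult_right_mono)
  ultimately have "t * \<kappa> / 2 \<le> t * \<kappa> / 4" using m(2) by (simp add: algebra_simps)
  then show False using t \<kappa> by simp
qed

text \<open>The convex combination lies in \<open>H\<close>, because \<open>H\<close> is convex and
  contains the coupling over \<open>M\<close>. Its height exceeds <z, x'> only slightly, and <z, x'>
  is close to x' y and then to y' y; so it is an almost-minimizer of h - c and can be moved into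
  \<open>M\<close>.\<close>

lemma bounded_approximation_of_closure_point:
  fixes z :: "'a dual dual"
  assumes zx: "(z, x') \<in> gossez_closure M" and F: "finite F" and e: "e > 0"
  obtains m m' where "(m, m') \<in> M" "norm m \<le> norm z + 2" "norm (m' - x') < e"
    "\<And>f. f \<in> F \<Longrightarrow> \<bar>blinfun_apply f m - blinfun_apply z f\<bar> < e"
proof -
  define K where "K = (\<Sum>f\<in>F. norm f)"
  have K: "K \<ge> 0" "\<And>f. f \<in> F \<Longrightarrow> norm f \<le> K"
    unfolding K_def by (auto intro: sum_nonneg member_le_sum F)
  define \<eta> where "\<eta> = min 1 (e / (2 * (K + 1)))"
  have \<eta>: "\<eta> > 0" "\<eta> \<le> 1" "\<eta> \<le> e / 2" "\<eta> * K \<le> e / 2"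
  proof -
    show "\<eta> > 0" "\<eta> \<le> 1" using e K by (auto simp: \<eta>_def)
    have "\<eta> * (K + 1) \<le> e / (2 * (K + 1)) * (K + 1)" using K by (intro mult_right_mono) (auto simp: \<eta>_def)
    also have "\<dots> = e / 2" using K(1) by (simp add: field_simps)
    finally have *: "\<eta> * K + \<eta> \<le> e / 2" by (simp add: algebra_simps)
    moreover have "\<eta> * K \<ge> 0" using \<open>\<eta> > 0\<close> K by simp
    ultimately show "\<eta> * K \<le> e / 2" "\<eta> \<le> e / 2" using \<open>\<eta> > 0\<close> by linarith+
  qed
  obtain \<epsilon> where \<epsilon>: "\<epsilon> > 0" "\<And>x x'. ((x, x'), blinfun_apply x' x + \<epsilon>) \<in> H
      \<Longrightarrow> \<exists>m m'. (m, m') \<in> M \<and> norm (m - x) \<le> \<eta> \<and> norm (m' - x') \<le> \<eta>"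
    using broendsted_rockafellar[OF \<eta>(1)] by blast
  define R where "R = norm z + 1"
  have R: "R \<ge> 1" by (simp add: R_def)
  \<comment> \<open>Comparing the height with y' y costs k for r against z x', k for z x' against x'
    y, and k R for x' y against y' y.\<close>
  define k where "k = min (e / 2) (\<epsilon> / (2 + R))"
  have k: "k > 0" "k \<le> e / 2" "k * (2 + R) \<le> \<epsilon>"
  proof -
    show "k > 0" using e \<epsilon> R by (simp add: k_def)
    show "k \<le> e / 2" unfolding k_def by (rule min.cobounded1)
    have "k \<le> \<epsilon> / (2 + R)" by (simp add: k_def)
    then show "k * (2 + R) \<le> \<epsilon>" using R by (simp add: pos_le_divide_eq)
  qed
  obtain y y' r where y: "((y, y'), r) \<in> convex hull ((\<lambda>p. (p, blinfun_apply (snd p) (fst p))) ` M)"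
    "norm y < norm z + 1" "norm (y' - x') < k"
    "\<And>f. f \<in> insert x' F \<Longrightarrow> \<bar>blinfun_apply f y - blinfun_apply z f\<bar> < k" "r < blinfun_apply z x' + k"
    using convex_combination_near_closure_point[OF zx _ k(1), of "insert x' F"] F by blast
  have "convex hull ((\<lambda>p. (p, blinfun_apply (snd p) (fst p))) ` M) \<subseteq> H"
    by (intro hull_minimal cvx) (auto simp: M_def)
  with y(1) have yH: "((y, y'), r) \<in> H" by blast
  have "- (k * R) \<le> blinfun_apply (y' - x') y"
  proof -
    have "norm (y' - x') * norm y \<le> k * R" using y k(1) by (intro mult_mono) (auto simp: R_def)
    then show ?thesis using blinfun_ge[of "y' - x'" y] by linarith
  qed
  moreover have "\<bar>blinfun_apply x' y - blinfun_apply z x'\<bar> < k" using y(4) by simp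
  ultimately have "r \<le> blinfun_apply y' y + k * (2 + R)"
    using y(5) by (simp add: blinfun.diff_left algebra_simps)
  with up[OF yH] k have "((y, y'), blinfun_apply y' y + \<epsilon>) \<in> H" by simp
  then obtain m m' where m: "(m, m') \<in> M" "norm (m - y) \<le> \<eta>" "norm (m' - y') \<le> \<eta>"
    using \<epsilon>(2) by blast
  show ?thesis
  proof (rule that[OF m(1)])
    show "norm m \<le> norm z + 2" using norm_triangle_ineq[of "m - y" y] m y(2) \<eta> by simp
    show "norm (m' - x') < e" using norm_triangle_ineq[of "m' - y'" "y' - x'"] m y(3) \<eta> k by simp
    fix f assume f: "f \<in> F"
    have "\<bar>blinfun_apply f (m - y)\<bar> \<le> norm f * norm (m - y)" using norm_blinfun[of f "m - y"] by simp
    also have "\<dots> \<le> K * \<eta>" using K f m by (intro mult_mono) auto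
    finally have "\<bar>blinfun_apply f m - blinfun_apply f y\<bar> \<le> e / 2"
      using \<eta> by (simp add: blinfun.diff_right mult.commute)
    then show "\<bar>blinfun_apply f m - blinfun_apply z f\<bar> < e" using y(4)[of f] f k(2)
      abs_triangle_ineq[of "blinfun_apply f m - blinfun_apply f y" "blinfun_apply f y - blinfun_apply z f"] by simp
  qed
qed

theorem gossez_type_D_M: "gossez_type_D M"
  unfolding gossez_type_D_def
proof (intro conjI maximal_monotone_M ballI, clarify)
  fix z x' assume zx: "(z, x') \<in> gossez_closure M"
  define B where "B = (\<lambda>(F, e). {p \<in> M. norm (fst p) \<le> norm z + 2 \<and> norm (snd p - x') < e
      \<and> (\<forall>f\<in>F. \<bar>blinfun_apply f (fst p) - blinfun_apply z f\<bar> < e)})"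
  define I where "I = {(F :: 'a dual set, e :: real). finite F \<and> e > 0}"
  \<comment> \<open>The index set of the net, as a filter base: \<open>B\<close> shrinks when F
    grows or e decreases, and the bound norm z + 2 is common to all its members.\<close>
  define \<F> where "\<F> = (INF i\<in>I. principal (B i))"
  have ev: "eventually P \<F> \<longleftrightarrow> (\<exists>i\<in>I. \<forall>p\<in>B i. P p)" for P
    unfolding \<F>_def
  proof (subst eventually_INF_base)
    show "I \<noteq> {}" by (auto simp: I_def intro: exI[of _ "{}"] exI[of _ 1])
    fix i j assume "i \<in> I" "j \<in> I"
    then show "\<exists>k\<in>I. principal (B k) \<le> inf (principal (B i)) (principal (B j))"
      by (intro bexI[of _ "(fst i \<union> fst j, min (snd i) (snd j))"]) (auto simp: B_def I_def split_beta)
  qed (auto simp: eventually_principal)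
  have ev_in: "eventually (\<lambda>p. p \<in> B (F, e)) \<F>" if "finite F" "e > 0" for F e
    unfolding ev using that by (intro bexI[of _ "(F, e)"]) (auto simp: I_def)
  show "\<exists>\<F>. \<F> \<noteq> bot \<and> (\<forall>\<^sub>F p in \<F>. p \<in> M)
      \<and> (\<exists>N. \<forall>\<^sub>F p in \<F>. norm (fst p) \<le> N \<and> norm (snd p) \<le> N)
      \<and> limitin wstar (\<lambda>p. emb (fst p)) z \<F> \<and> (snd \<longlongrightarrow> x') \<F>"
  proof (intro exI[of _ \<F>] conjI)
    have "B i \<noteq> {}" if "i \<in> I" for i
    proof -
      obtain F e where i: "i = (F, e)" "finite F" "e > 0" using \<open>i \<in> I\<close> by (auto simp: I_def)
      obtain m m' where "(m, m') \<in> M" "norm m \<le> norm z + 2" "norm (m' - x') < e"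
        "\<And>f. f \<in> F \<Longrightarrow> \<bar>blinfun_apply f m - blinfun_apply z f\<bar> < e"
        using bounded_approximation_of_closure_point[OF zx i(2,3)] by blast
      then have "(m, m') \<in> B i" by (simp add: B_def i)
      then show ?thesis by blast
    qed
    then show "\<F> \<noteq> bot" unfolding trivial_limit_def ev by blast
    show "\<forall>\<^sub>F p in \<F>. p \<in> M"
      using ev_in[of "{}" 1] by (rule eventually_mono) (auto simp: B_def)
    show "\<exists>N. \<forall>\<^sub>F p in \<F>. norm (fst p) \<le> N \<and> norm (snd p) \<le> N"
    proof (intro exI)
      show "\<forall>\<^sub>F p in \<F>. norm (fst p) \<le> norm z + norm x' + 2 \<and> norm (snd p) \<le> norm z + norm x' + 2"
        using ev_in[of "{}" 1, simplified]
      proof (rule eventually_mono)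
        fix p assume "p \<in> B ({}, 1)"
        then have p: "norm (fst p) \<le> norm z + 2" "norm (snd p - x') < 1" by (auto simp: B_def)
        show "norm (fst p) \<le> norm z + norm x' + 2 \<and> norm (snd p) \<le> norm z + norm x' + 2"
          using p norm_triangle_ineq2[of "snd p" x'] norm_ge_zero[of x'] norm_ge_zero[of z] by linarith
      qed
    qed
    show "limitin wstar (\<lambda>p. emb (fst p)) z \<F>"
      unfolding limitin_def
    proof (intro conjI allI impI)
      show "z \<in> topspace wstar" by (simp add: topspace_wstar)
      fix U assume "openin wstar U \<and> z \<in> U"
      then obtain F e where F: "finite F" "e > 0"
        "\<And>y. (\<And>f. f \<in> F \<Longrightarrow> \<bar>blinfun_apply y f - blinfun_apply z f\<bar> < e) \<Longrightarrow> y \<in> U"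
        using wstar_neighbourhood[of U z] by blast
      show "\<forall>\<^sub>F p in \<F>. emb (fst p) \<in> U"
        using ev_in[OF F(1,2)] by (rule eventually_mono) (auto simp: B_def intro: F(3))
    qed
    show "(snd \<longlongrightarrow> x') \<F>"
    proof (rule tendstoI)
      fix e :: real assume "e > 0"
      then show "\<forall>\<^sub>F p in \<F>. dist (snd p) x' < e"
        using ev_in[of "{}" e] by (auto elim!: eventually_mono simp: B_def dist_norm)
    qed
  qed
qed

end

section \<open>Weak-star separation, open mappings and multipliers\<close>

text \<open>If some \<open>w0\<close> is killed by \<open>I\<close> but not by \<open>g\<close>,
  subtracting the multiple \<nu> of \<open>g\<close> that matches \<open>L\<close> at
  \<open>w0\<close> reduces the claim to \<open>I\<close>; otherwise \<open>g\<close> vanishes on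
  the common kernel of \<open>I\<close> and gets coefficient 0.\<close>

lemma linear_combination_of_common_kernel:
  fixes L :: "'v::real_vector \<Rightarrow> real" and I :: "('v \<Rightarrow> real) set"
  assumes "finite I" "\<And>l. l \<in> I \<Longrightarrow> linear l" "linear L" "\<And>w. (\<And>l. l \<in> I \<Longrightarrow> l w = 0) \<Longrightarrow> L w = 0"
  shows "\<exists>c. \<forall>w. L w = (\<Sum>l\<in>I. c l * l w)"
  using assms
proof (induction I arbitrary: L rule: finite_induct)
  case empty
  then show ?case by simp
next
  case (insert g I)
  show ?case
  proof (cases "\<exists>w0. (\<forall>l\<in>I. l w0 = 0) \<and> g w0 \<noteq> 0")
    case True
    then obtain w0 where w0: "\<And>l. l \<in> I \<Longrightarrow> l w0 = 0" "g w0 \<noteq> 0" by blast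
    define \<nu> where "\<nu> = L w0 / g w0"
    have "\<exists>c. \<forall>w. L w - \<nu> * g w = (\<Sum>l\<in>I. c l * l w)"
    proof (rule insert.IH)
      show "linear (\<lambda>w. L w - \<nu> * g w)"
        using insert.prems by (simp add: linear_iff algebra_simps)
      fix w assume w: "\<And>l. l \<in> I \<Longrightarrow> l w = 0"
      have "L (w - (g w / g w0) *\<^sub>R w0) = 0"
      proof (rule insert.prems(3))
        fix l assume l: "l \<in> insert g I"
        then have "linear l" by (rule insert.prems(1))
        then have "l (w - (g w / g w0) *\<^sub>R w0) = l w - (g w / g w0) * l w0"
          by (simp add: linear_diff linear_scale)
        then show "l (w - (g w / g w0) *\<^sub>R w0) = 0" 
          using l w[of l] w0(1)[of l] w0(2) by (cases "l = g") auto
      qed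
      then show "L w - \<nu> * g w = 0"
        using insert.prems(2) by (simp add: linear_diff linear_scale \<nu>_def)
    qed (use insert.prems in auto)
    then obtain c where c: "\<And>w. L w - \<nu> * g w = (\<Sum>l\<in>I. c l * l w)" by blast
    have "(\<Sum>l\<in>I. (if l = g then \<nu> else c l) * l w) = (\<Sum>l\<in>I. c l * l w)" for w
      using insert.hyps by (intro sum.cong) auto
    then have "L w = (\<Sum>l\<in>insert g I. (if l = g then \<nu> else c l) * l w)" for w
      using insert.hyps c[of w] by simp
    then show ?thesis by (intro exI[of _ "\<lambda>l. if l = g then \<nu> else c l"] allI)
  next
    case False
    have "\<exists>c. \<forall>w. L w = (\<Sum>l\<in>I. c l * l w)"
    proof (rule insert.IH)
      show "L w = 0" if w: "\<And>l. l \<in> I \<Longrightarrow> l w = 0" for w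
      proof (rule insert.prems(3))
        have "g w = 0" using False w by blast
        then show "l w = 0" if "l \<in> insert g I" for l using that w[of l] by (cases "l = g") auto
      qed
    qed (use insert.prems in auto)
    then obtain c where c: "\<And>w. L w = (\<Sum>l\<in>I. c l * l w)" by blast
    have "(\<Sum>l\<in>I. (if l = g then 0 else c l) * l w) = (\<Sum>l\<in>I. c l * l w)" for w
      using insert.hyps by (intro sum.cong) auto
    then have "L w = (\<Sum>l\<in>insert g I. (if l = g then 0 else c l) * l w)" for w
      using insert.hyps c[of w] by simp
    then show ?thesis by (intro exI[of _ "\<lambda>l. if l = g then 0 else c l"] allI)
  qed
qed

text \<open>Mazur-Orlicz for the seminorm given by the sum of the |l|: a linear functional below it
  vanishes on the common kernel, so it is a combination of \<open>I\<close>.\<close>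

lemma separation_by_finitely_many_functionals:
  fixes E :: "'v::real_vector set" and I :: "('v \<Rightarrow> real) set"
  assumes I: "finite I" "\<And>l. l \<in> I \<Longrightarrow> linear l" and E: "convex E"
    and far: "\<And>e. e \<in> E \<Longrightarrow> \<epsilon> \<le> (\<Sum>l\<in>I. \<bar>l (e - q)\<bar>)"
  obtains c where "\<And>e. e \<in> E \<Longrightarrow> \<epsilon> \<le> (\<Sum>l\<in>I. c l * l (e - q))"
proof -
  define p where "p w = (\<Sum>l\<in>I. \<bar>l w\<bar>)" for w
  have sub: "sublinear p"
  proof (rule sublinearI)
    show "p (x + y) \<le> p x + p y" for x y
      unfolding p_def sum.distrib[symmetric]
      using I(2) by (intro sum_mono) (simp add: linear_add abs_triangle_ineq)
    show "p (t *\<^sub>R x) \<le> t * p x" if "0 < t" for t x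
      unfolding p_def sum_distrib_left
      using I(2) that by (intro sum_mono) (simp add: linear_scale abs_mult)
    show "p 0 = 0" unfolding p_def using I(2) by (intro sum.neutral) (simp add: linear_0)
  qed
  have conv: "convex ((\<lambda>e. (e - q, 0::real)) ` E)"
  proof -
    have "(\<lambda>e. (e - q, 0::real)) ` E = (+) (- q, 0) ` ((\<lambda>e. (e, 0)) ` E)"
      by (auto simp: image_image)
    moreover have "convex ((\<lambda>e. (e, 0::real)) ` E)"
      by (intro convex_linear_image E) (simp add: linear_iff)
    ultimately show ?thesis by (metis convex_translation)
  qed
  have lower: "\<epsilon> \<le> p w + r" if "(w, r) \<in> (\<lambda>e. (e - q, 0)) ` E" for w r
    using that far by (auto simp: p_def)
  obtain L where L: "linear L" "\<And>x. L x \<le> p x"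
    "\<And>w r. (w, r) \<in> (\<lambda>e. (e - q, 0)) ` E \<Longrightarrow> \<epsilon> \<le> L w + r"
    using mazur_orlicz[OF sub conv lower] by blast
  have "L w = 0" if w: "\<And>l. l \<in> I \<Longrightarrow> l w = 0" for w
  proof -
    have "p w = 0" "p (- w) = 0" using I(2) w by (auto simp: p_def linear_neg intro!: sum.neutral)
    then show ?thesis using L(2)[of w] L(2)[of "- w"] linear_neg[OF L(1), of w] by simp
  qed
  then obtain c where c: "\<And>w. L w = (\<Sum>l\<in>I. c l * l w)"
    using linear_combination_of_common_kernel[OF I L(1)] by blast
  show ?thesis
  proof (rule that)
    fix e assume "e \<in> E"
    then have "\<epsilon> \<le> L (e - q) + 0" by (intro L(3)) auto
    then show "\<epsilon> \<le> (\<Sum>l\<in>I. c l * l (e - q))" by (simp add: c)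
  qed
qed

text \<open>A basic neighbourhood missing \<open>E\<close> restricts finitely many evaluations, so
  their absolute values sum to at least \<epsilon> on E - q. The separating functional is a
  combination of these evaluations, and collecting terms in each factor leaves one point of each
  space.\<close>

lemma wstar_separation:
  fixes E :: "('a::real_normed_vector dual \<times> 'b::real_normed_vector dual \<times> 'c::real_normed_vector dual \<times> real) set"
  assumes E: "convex E"
    and q: "(q1, q2, q3, q4) \<notin> prod_topology wstar (prod_topology wstar (prod_topology wstar euclideanreal)) closure_of E"
  obtains a b c \<rho> \<epsilon> where "\<epsilon> > 0"
    "\<And>e1 e2 e3 e4. (e1, e2, e3, e4) \<in> E \<Longrightarrow>
      \<epsilon> \<le> blinfun_apply (e1 - q1) a + blinfun_apply (e2 - q2) b + blinfun_apply (e3 - q3) c + \<rho> * (e4 - q4)"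
proof -
  let ?X = "prod_topology wstar (prod_topology wstar (prod_topology wstar euclideanreal))"
  have "\<exists>T. openin ?X T \<and> (q1, q2, q3, q4) \<in> T \<and> (\<forall>e\<in>E. e \<notin> T)"
  proof (rule ccontr)
    assume n: "\<not> ?thesis"
    have "(q1, q2, q3, q4) \<in> ?X closure_of E"
      unfolding in_closure_of
    proof (intro conjI allI impI)
      fix T assume "(q1, q2, q3, q4) \<in> T \<and> openin ?X T"
      with n show "\<exists>y. y \<in> E \<and> y \<in> T" by blast
    qed simp
    with q show False by contradiction
  qed
  then obtain T where T: "openin ?X T" "(q1, q2, q3, q4) \<in> T" "\<forall>e\<in>E. e \<notin> T" by blast
  obtain U1 V1 where 1: "openin wstar U1" "openin (prod_topology wstar (prod_topology wstar euclideanreal)) V1"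
    "q1 \<in> U1" "(q2, q3, q4) \<in> V1" "U1 \<times> V1 \<subseteq> T"
    using openin_prod_topology_alt[THEN iffD1, rule_format, OF T(1,2)] by metis
  obtain U2 V2 where 2: "openin wstar U2" "openin (prod_topology wstar euclideanreal) V2"
    "q2 \<in> U2" "(q3, q4) \<in> V2" "U2 \<times> V2 \<subseteq> V1"
    using openin_prod_topology_alt[THEN iffD1, rule_format, OF 1(2,4)] by metis
  obtain U3 U4 where 3: "openin wstar U3" "open U4"
    "q3 \<in> U3" "q4 \<in> U4" "U3 \<times> U4 \<subseteq> V2"
    using openin_prod_topology_alt[THEN iffD1, rule_format, OF 2(2,4)] by (metis open_openin)
  obtain F1 \<epsilon>1 where F1: "finite F1" "\<epsilon>1 > 0"
    "\<And>y. (\<And>x. x \<in> F1 \<Longrightarrow> \<bar>blinfun_apply y x - blinfun_apply q1 x\<bar> < \<epsilon>1) \<Longrightarrow> y \<in> U1"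
    using wstar_neighbourhood[OF 1(1,3)] by blast
  obtain F2 \<epsilon>2 where F2: "finite F2" "\<epsilon>2 > 0"
    "\<And>y. (\<And>x. x \<in> F2 \<Longrightarrow> \<bar>blinfun_apply y x - blinfun_apply q2 x\<bar> < \<epsilon>2) \<Longrightarrow> y \<in> U2"
    using wstar_neighbourhood[OF 2(1,3)] by blast
  obtain F3 \<epsilon>3 where F3: "finite F3" "\<epsilon>3 > 0"
    "\<And>y. (\<And>x. x \<in> F3 \<Longrightarrow> \<bar>blinfun_apply y x - blinfun_apply q3 x\<bar> < \<epsilon>3) \<Longrightarrow> y \<in> U3"
    using wstar_neighbourhood[OF 3(1,3)] by blast
  obtain \<epsilon>4 where \<epsilon>4: "\<epsilon>4 > 0" "\<And>y. \<bar>y - q4\<bar> < \<epsilon>4 \<Longrightarrow> y \<in> U4"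
    using 3(2,4) by (metis dist_real_def open_dist)
  define \<epsilon> where "\<epsilon> = min (min \<epsilon>1 \<epsilon>2) (min \<epsilon>3 \<epsilon>4)"
  have \<epsilon>: "\<epsilon> > 0" using F1 F2 F3 \<epsilon>4 by (simp add: \<epsilon>_def)
  define P1 where "P1 x = (\<lambda>w::'a dual \<times> 'b dual \<times> 'c dual \<times> real. blinfun_apply (fst w) x)" for x
  define P2 where "P2 x = (\<lambda>w::'a dual \<times> 'b dual \<times> 'c dual \<times> real. blinfun_apply (fst (snd w)) x)" for x
  define P3 where "P3 x = (\<lambda>w::'a dual \<times> 'b dual \<times> 'c dual \<times> real. blinfun_apply (fst (snd (snd w))) x)" for x
  define P4 where "P4 = (\<lambda>w::'a dual \<times> 'b dual \<times> 'c dual \<times> real. snd (snd (snd w)))"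
  define I where "I = P1 ` F1 \<union> P2 ` F2 \<union> P3 ` F3 \<union> {P4}"
  have I: "finite I" using F1 F2 F3 by (simp add: I_def)
  have I_form: "\<exists>a b c \<rho>. \<forall>w. l w = P1 a w + P2 b w + P3 c w + \<rho> * P4 w" if "l \<in> I" for l
  proof -
    consider x where "l = P1 x" | x where "l = P2 x" | x where "l = P3 x" | "l = P4"
      using \<open>l \<in> I\<close> by (auto simp: I_def)
    then show ?thesis
    proof cases
      case (1 x)
      have "l w = P1 x w + P2 0 w + P3 0 w + 0 * P4 w" for w by (simp add: 1 P2_def P3_def)
      then show ?thesis by (intro exI allI)
    next
      case (2 x)
      have "l w = P1 0 w + P2 x w + P3 0 w + 0 * P4 w" for w by (simp add: 2 P1_def P3_def)
      then show ?thesis by (intro exI allI)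
    next
      case (3 x)
      have "l w = P1 0 w + P2 0 w + P3 x w + 0 * P4 w" for w by (simp add: 3 P1_def P2_def)
      then show ?thesis by (intro exI allI)
    next
      case 4
      have "l w = P1 0 w + P2 0 w + P3 0 w + 1 * P4 w" for w by (simp add: 4 P1_def P2_def P3_def)
      then show ?thesis by (intro exI allI)
    qed
  qed
  have lin: "linear l" if "l \<in> I" for l
    using that unfolding I_def P1_def P2_def P3_def P4_def
    by (auto simp: linear_iff blinfun.add_left blinfun.scaleR_left)
  have far: "\<epsilon> \<le> (\<Sum>l\<in>I. \<bar>l (e - (q1, q2, q3, q4))\<bar>)" if e: "e \<in> E" for e
  proof (rule ccontr)
    assume n: "\<not> ?thesis"
    obtain e1 e2 e3 e4 where ee: "e = (e1, e2, e3, e4)" by (metis prod.collapse)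
    have lt: "\<bar>l (e - (q1, q2, q3, q4))\<bar> < \<epsilon>" if "l \<in> I" for l
    proof -
      have "\<bar>l (e - (q1, q2, q3, q4))\<bar> \<le> (\<Sum>l\<in>I. \<bar>l (e - (q1, q2, q3, q4))\<bar>)"
        by (rule member_le_sum[OF that _ I]) simp
      then show ?thesis using n by simp
    qed
    have "e1 \<in> U1"
    proof (rule F1(3))
      fix x assume "x \<in> F1"
      then show "\<bar>blinfun_apply e1 x - blinfun_apply q1 x\<bar> < \<epsilon>1"
        using lt[of "P1 x"] by (auto simp: I_def P1_def ee blinfun.diff_left \<epsilon>_def)
    qed
    moreover have "e2 \<in> U2"
    proof (rule F2(3))
      fix x assume "x \<in> F2"
      then show "\<bar>blinfun_apply e2 x - blinfun_apply q2 x\<bar> < \<epsilon>2"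
        using lt[of "P2 x"] by (auto simp: I_def P2_def ee blinfun.diff_left \<epsilon>_def)
    qed
    moreover have "e3 \<in> U3"
    proof (rule F3(3))
      fix x assume "x \<in> F3"
      then show "\<bar>blinfun_apply e3 x - blinfun_apply q3 x\<bar> < \<epsilon>3"
        using lt[of "P3 x"] by (auto simp: I_def P3_def ee blinfun.diff_left \<epsilon>_def)
    qed
    moreover have "e4 \<in> U4"
      using lt[of P4] by (intro \<epsilon>4(2)) (auto simp: I_def P4_def ee \<epsilon>_def)
    ultimately have "e \<in> T" using 1(5) 2(5) 3(5) ee by blast
    with T(3) e show False by blast
  qed
  obtain c where c: "\<And>e. e \<in> E \<Longrightarrow> \<epsilon> \<le> (\<Sum>l\<in>I. c l * l (e - (q1, q2, q3, q4)))"
    using separation_by_finitely_many_functionals[OF I lin E far] by blast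
  have "\<exists>a b d \<rho>. \<forall>w. (\<Sum>l\<in>J. c l * l w) = P1 a w + P2 b w + P3 d w + \<rho> * P4 w" if "J \<subseteq> I" for J
    using finite_subset[OF that I] that
  proof (induction J rule: finite_induct)
    case empty
    have "(\<Sum>l\<in>{}. c l * l w) = P1 0 w + P2 0 w + P3 0 w + 0 * P4 w" for w
      by (simp add: P1_def P2_def P3_def)
    then show ?case by (intro exI allI)
  next
    case (insert l J)
    then obtain a b d \<rho> where 1: "\<And>w. (\<Sum>l\<in>J. c l * l w) = P1 a w + P2 b w + P3 d w + \<rho> * P4 w" by auto
    obtain a' b' d' \<rho>' where 2: "\<And>w. l w = P1 a' w + P2 b' w + P3 d' w + \<rho>' * P4 w"
      using I_form insert.prems by blast
    have "(\<Sum>l\<in>insert l J. c l * l w) = P1 (a + c l *\<^sub>R a') w + P2 (b + c l *\<^sub>R b') w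
        + P3 (d + c l *\<^sub>R d') w + (\<rho> + c l * \<rho>') * P4 w" for w
      using insert.hyps 1[of w] 2[of w]
      by (simp add: P1_def P2_def P3_def blinfun.add_right blinfun.scaleR_right algebra_simps)
    then show ?case by (intro exI allI)
  qed
  from this[OF order_refl] obtain a b d \<rho>
    where eq: "\<And>w. (\<Sum>l\<in>I. c l * l w) = P1 a w + P2 b w + P3 d w + \<rho> * P4 w" by blast
  show ?thesis
  proof (rule that[OF \<epsilon>])
    fix e1 e2 e3 e4 assume "(e1, e2, e3, e4) \<in> E"
    from c[OF this] show "\<epsilon> \<le> blinfun_apply (e1 - q1) a + blinfun_apply (e2 - q2) b
        + blinfun_apply (e3 - q3) d + \<rho> * (e4 - q4)"
      unfolding eq by (simp add: P1_def P2_def P3_def P4_def)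
  qed
qed

text \<open>The Robinson--Ursescu theorem: Baire's theorem makes the closure of some \<open>j (Q n)\<close> a
  neighbourhood of \<open>0\<close> in \<open>L\<close>, and a geometric series in the bounded closed convex set \<open>Q n\<close>
  removes the closure.\<close>

lemma convex_image_neighbourhood_zero:
  fixes j :: "'v::banach \<Rightarrow>\<^sub>L 'w::banach" and Q :: "nat \<Rightarrow> 'v set"
  assumes Q: "\<And>n. closed (Q n)" "\<And>n. convex (Q n)" "\<And>m n. m \<le> n \<Longrightarrow> Q m \<subseteq> Q n" "\<And>n. bounded (Q n)"
    and L: "subspace L" "closed L" "\<And>n. blinfun_apply j ` Q n \<subseteq> L"
    and absorb: "\<And>w. w \<in> L \<Longrightarrow> \<exists>\<delta>>0. \<exists>n. \<delta> *\<^sub>R w \<in> blinfun_apply j ` Q n"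
  obtains r n where "r > 0" "\<And>w. w \<in> L \<Longrightarrow> norm w \<le> r \<Longrightarrow> w \<in> blinfun_apply j ` Q n"
proof -
  define D where "D n = blinfun_apply j ` Q n" for n
  have Dc: "convex (D n)" for n
    unfolding D_def by (intro convex_linear_image Q bounded_linear.linear blinfun.bounded_linear_right)
  have Dmono: "D m \<subseteq> D n" if "m \<le> n" for m n using Q(3)[OF that] by (auto simp: D_def)
  have zero_L: "0 \<in> L" using L(1) by (rule subspace_0)
  obtain n0 where n0: "0 \<in> D n0" using absorb[OF zero_L] by (auto simp: D_def)
  have shrink: "s *\<^sub>R w \<in> D n" if "w \<in> D n" "n0 \<le> n" "0 \<le> s" "s \<le> 1" for s w n
  proof -
    have "s *\<^sub>R w + (1 - s) *\<^sub>R 0 \<in> D n"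
      using that n0 Dmono by (intro convexD[OF Dc]) auto
    then show ?thesis by simp
  qed
  define K where "K n = (*\<^sub>R) (real (Suc n)) ` closure (D n)" for n
  have "closedin (top_of_set L) (K n)" for n
  proof (rule closed_subset)
    show "closed (K n)" unfolding K_def by (intro closed_scaling closed_closure)
    have "closure (D n) \<subseteq> L" using L by (intro closure_minimal) (auto simp: D_def)
    then show "K n \<subseteq> L" using L(1) by (auto simp: K_def subspace_scale)
  qed
  moreover have cover: "L \<subseteq> \<Union> (range K)"
  proof
    fix w assume "w \<in> L"
    then obtain \<delta> m where \<delta>: "\<delta> > 0" "\<delta> *\<^sub>R w \<in> D m" unfolding D_def using absorb by meson
    obtain k where k: "1 / \<delta> < real k" using reals_Archimedean2 by blast
    define n where "n = max (max m n0) k"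
    have n: "1 / \<delta> < real (Suc n)" "m \<le> n" "n0 \<le> n" using k by (auto simp: n_def)
    have ge1: "1 \<le> \<delta> * real (Suc n)" using n(1) \<delta> by (simp add: field_simps del: of_nat_Suc)
    have "(1 / (\<delta> * real (Suc n))) *\<^sub>R (\<delta> *\<^sub>R w) \<in> D n"
    proof (rule shrink)
      show "\<delta> *\<^sub>R w \<in> D n" using \<delta>(2) Dmono[OF n(2)] by blast
      show "1 / (\<delta> * real (Suc n)) \<le> 1"
        using ge1 by (simp add: divide_le_eq del: of_nat_Suc)
    qed (use n \<delta> in auto)
    then have "(1 / real (Suc n)) *\<^sub>R w \<in> closure (D n)"
      using \<delta> closure_subset by (auto simp del: of_nat_Suc)
    then have "real (Suc n) *\<^sub>R ((1 / real (Suc n)) *\<^sub>R w) \<in> K n" unfolding K_def by (rule imageI)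
    then show "w \<in> \<Union> (range K)" by (auto simp del: of_nat_Suc)
  qed
  have "\<exists>n. top_of_set L interior_of K n \<noteq> {}"
  proof (rule ccontr)
    assume "\<not> ?thesis"
    then have "top_of_set L interior_of \<Union> (range K) = {}"
      using calculation
      by (intro Baire_category_alt disjI1 completely_metrizable_space_closedin[OF completely_metrizable_space_euclidean])
         (auto simp: L(2))
    moreover have "L \<subseteq> top_of_set L interior_of \<Union> (range K)"
      using cover by (intro interior_of_maximal) auto
    ultimately show False using zero_L by blast
  qed
  then obtain n w0 where "w0 \<in> top_of_set L interior_of K n" by blast
  then obtain U where U: "openin (top_of_set L) U" "w0 \<in> U" "U \<subseteq> K n" by (auto simp: interior_of_def)
  obtain \<rho> where \<rho>: "\<rho> > 0" "\<And>w. w \<in> L \<Longrightarrow> dist w w0 < \<rho> \<Longrightarrow> w \<in> K n"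
    using U by (meson openin_euclidean_subtopology_iff subset_iff)
  have w0: "w0 \<in> L" using U openin_subset by force
  obtain \<delta> m where \<delta>: "\<delta> > 0" "\<delta> *\<^sub>R (- w0) \<in> D m"
    using absorb[of "- w0"] L(1) w0 by (auto simp: D_def subspace_neg)
  define N where "N = max n m"
  define k where "k = real (Suc n)"
  have k: "k > 0" by (simp add: k_def)
  \<comment> \<open>The weights s k and 1 / (1 + \<delta> k) add up to 1 and cancel
    \<open>w0\<close>: the first point contributes w + s w0, the second -s w0.\<close>
  define s where "s = \<delta> / (1 + \<delta> * k)"
  have s: "s > 0" using \<delta> k by (simp add: s_def add_pos_pos)
  have nz: "1 + \<delta> * k > 0" using \<delta> k by (simp add: add_pos_pos)
  then have sk: "s * k + 1 / (1 + \<delta> * k) = 1"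
    by (simp add: s_def add_divide_distrib[symmetric] add.commute)
  define r where "r = s * \<rho>"
  have r: "r > 0" using s \<rho> by (simp add: r_def)
  have near: "w \<in> closure (D N)" if w: "w \<in> L" "norm w < r" for w
  proof -
    have "w /\<^sub>R s + w0 \<in> K n"
    proof (rule \<rho>(2))
      show "w /\<^sub>R s + w0 \<in> L" using L(1) w w0 by (simp add: subspace_add subspace_scale)
      show "dist (w /\<^sub>R s + w0) w0 < \<rho>" using w s by (simp add: dist_norm r_def field_simps)
    qed
    then obtain v where v: "v \<in> closure (D n)" "w /\<^sub>R s + w0 = k *\<^sub>R v" by (auto simp: K_def k_def)
    have "closure (D n) \<subseteq> closure (D N)" using Dmono by (intro closure_mono) (simp add: N_def)
    then have "v \<in> closure (D N)" using v by blast
    moreover have "\<delta> *\<^sub>R (- w0) \<in> closure (D N)"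
      using \<delta> Dmono[of m N] closure_subset by (auto simp: N_def)
    ultimately have "(s * k) *\<^sub>R v + (1 / (1 + \<delta> * k)) *\<^sub>R (\<delta> *\<^sub>R (- w0)) \<in> closure (D N)"
      using s k nz by (intro convexD[OF convex_closure[OF Dc]] sk) auto
    also have "(s * k) *\<^sub>R v + (1 / (1 + \<delta> * k)) *\<^sub>R (\<delta> *\<^sub>R (- w0)) = w"
    proof -
      have "(s * k) *\<^sub>R v = s *\<^sub>R (w /\<^sub>R s + w0)" by (simp add: v(2))
      also have "\<dots> = w + s *\<^sub>R w0" using s by (simp add: scaleR_add_right)
      finally show ?thesis by (simp add: s_def)
    qed
    finally show ?thesis .
  qed
  have step: "\<exists>c\<in>Q N. norm (v - blinfun_apply j c) < r / 2" if v: "v \<in> L" "norm v < r" for v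
  proof -
    obtain d where "d \<in> D N" "dist d v < r / 2"
      using near[OF v] r unfolding closure_approachable by (meson half_gt_zero)
    then show ?thesis by (auto simp: D_def dist_norm norm_minus_commute)
  qed
  then obtain g where g: "\<And>v. v \<in> L \<Longrightarrow> norm v < r \<Longrightarrow> g v \<in> Q N"
    "\<And>v. v \<in> L \<Longrightarrow> norm v < r \<Longrightarrow> norm (v - blinfun_apply j (g v)) < r / 2" by metis
  obtain B where B: "\<And>c. c \<in> Q N \<Longrightarrow> norm c \<le> B" using Q(4)[of N] by (auto simp: bounded_iff)
  show ?thesis
  proof (rule that[of "r / 4" N])
    show "r / 4 > 0" using r by simp
    fix w assume w: "w \<in> L" "norm w \<le> r / 4"
    \<comment> \<open>Doubled residuals: approximation by \<open>g\<close> leaves an error below r /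
      2, and doubling brings it back below r. Hence w is the sum of the images of g (W i) with
      weights 2^-(i+1).\<close>
    define W where "W k = ((\<lambda>v. 2 *\<^sub>R (v - blinfun_apply j (g v))) ^^ k) (2 *\<^sub>R w)" for k
    have W0: "W 0 = 2 *\<^sub>R w" and WS: "W (Suc k) = 2 *\<^sub>R (W k - blinfun_apply j (g (W k)))" for k
      by (simp_all add: W_def)
    have W: "W k \<in> L \<and> norm (W k) < r" for k
    proof (induction k)
      case 0
      then show ?case using w r L(1) by (simp add: W0 subspace_scale)
    next
      case (Suc k)
      then have "blinfun_apply j (g (W k)) \<in> L" using L(3) g(1) by blast
      then show ?case using Suc g(2)[of "W k"] L(1) by (simp add: WS subspace_scale subspace_diff)
    qed
    have gW: "g (W k) \<in> Q N" for k using g(1) W by blast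
    define f where "f i = (1/2) ^ Suc i *\<^sub>R g (W i)" for i
    have jsum: "blinfun_apply j (\<Sum>i<k. f i) = w - (1/2) ^ Suc k *\<^sub>R W k" for k
    proof (induction k)
      case 0
      then show ?case by (simp add: W0 blinfun.zero_right)
    next
      case (Suc k)
      then show ?case
        by (simp add: blinfun.add_right blinfun.scaleR_right f_def WS scaleR_diff_right)
    qed
    have geo: "summable (\<lambda>i. B * (1/2::real) ^ Suc i)"
      by (intro summable_mult summable_Suc_iff[THEN iffD2] summable_geometric) simp
    have "summable f"
    proof (rule summable_comparison_test[OF _ geo])
      show "\<exists>M. \<forall>n\<ge>M. norm (f n) \<le> B * (1/2) ^ Suc n"
        using B[OF gW] by (auto simp: f_def mult.commute intro!: mult_left_mono)
    qed
    then have lim: "(\<lambda>k. \<Sum>i<k. f i) \<longlonglongrightarrow> suminf f" by (rule summable_LIMSEQ)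
    \<comment> \<open>The weights of the partial sum add up to 1 - 2^-k; one more point of weight
      2^-k completes a convex combination.\<close>
    have in_Q: "(\<Sum>i<k. f i) + (1/2) ^ k *\<^sub>R c \<in> Q N" if "c \<in> Q N" for k c
      using that
    proof (induction k arbitrary: c)
      case (Suc k)
      have "(1/2) *\<^sub>R g (W k) + (1/2) *\<^sub>R c \<in> Q N" using Suc.prems gW by (intro convexD[OF Q(2)]) auto
      from Suc.IH[OF this] show ?case by (simp add: f_def scaleR_add_right add.assoc mult.commute)
    qed simp
    have half: "(\<lambda>k. (1/2::real) ^ k) \<longlonglongrightarrow> 0" by (rule LIMSEQ_power_zero) simp
    have "(\<lambda>k. (\<Sum>i<k. f i) + (1/2) ^ k *\<^sub>R g (W 0)) \<longlonglongrightarrow> suminf f + 0 *\<^sub>R g (W 0)"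
      by (intro tendsto_intros lim half)
    then have "suminf f \<in> Q N"
      using closed_sequentially[OF Q(1), of "\<lambda>k. (\<Sum>i<k. f i) + (1/2) ^ k *\<^sub>R g (W 0)"] in_Q[OF gW] by simp
    moreover have "blinfun_apply j (suminf f) = w"
    proof (rule LIMSEQ_unique)
      show "(\<lambda>k. blinfun_apply j (\<Sum>i<k. f i)) \<longlonglongrightarrow> blinfun_apply j (suminf f)"
        by (intro blinfun.tendsto tendsto_const lim)
      have "(\<lambda>k. (1/2) ^ Suc k *\<^sub>R W k) \<longlonglongrightarrow> 0"
      proof (rule Lim_null_comparison)
        show "\<forall>\<^sub>F k in sequentially. norm ((1/2) ^ Suc k *\<^sub>R W k) \<le> (1/2) ^ Suc k * r"
          using W by (auto intro!: always_eventually mult_left_mono simp: less_imp_le)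
        have "(\<lambda>k. (1/2) ^ Suc k * r) \<longlonglongrightarrow> 0 * r" by (intro tendsto_intros LIMSEQ_Suc half)
        then show "(\<lambda>k. (1/2) ^ Suc k * r) \<longlonglongrightarrow> 0" by simp
      qed
      then have "(\<lambda>k. w - (1/2) ^ Suc k *\<^sub>R W k) \<longlonglongrightarrow> w - 0" by (intro tendsto_intros)
      then show "(\<lambda>k. blinfun_apply j (\<Sum>i<k. f i)) \<longlonglongrightarrow> w" by (simp add: jsum)
    qed
    ultimately show "w \<in> blinfun_apply j ` Q N" by blast
  qed
qed

text \<open>The opposite point -(r / norm w) w lies in the ball where \<open>G\<close> has values at
  most \<open>N\<close>, and a convex combination of the two lies over 0, where values are at least
  -\<mu>. So k is bounded below by -\<mu> minus a multiple of norm w, which is the domination that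
  Mazur-Orlicz asks for.\<close>

lemma lagrange_multiplier:
  fixes G :: "('w::real_normed_vector \<times> real) set"
  assumes G: "convex G" and L: "subspace L" "\<And>w k. (w, k) \<in> G \<Longrightarrow> w \<in> L"
    and r: "r > 0" and N: "\<And>w. w \<in> L \<Longrightarrow> norm w \<le> r \<Longrightarrow> \<exists>k\<le>N. (w, k) \<in> G"
    and zero: "\<And>k. (0, k) \<in> G \<Longrightarrow> - \<mu> \<le> k"
  obtains f :: "'w \<Rightarrow>\<^sub>L real" where "\<And>w k. (w, k) \<in> G \<Longrightarrow> - \<mu> \<le> blinfun_apply f w + k"
proof (rule mazur_orlicz_blinfun[OF _ G])
  show "0 \<le> (\<bar>N\<bar> + \<bar>\<mu>\<bar>) / r" using r by simp
  fix w k assume wk: "(w, k) \<in> G"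
  define a where "a = norm w"
  have a: "a \<ge> 0" by (simp add: a_def)
  show "- \<mu> \<le> (\<bar>N\<bar> + \<bar>\<mu>\<bar>) / r * norm w + k"
  proof (cases "w = 0")
    case False
    then have a: "a > 0" by (simp add: a_def)
    have "(- (r / a)) *\<^sub>R w \<in> L" using L wk by (intro subspace_scale) auto
    moreover have "norm ((- (r / a)) *\<^sub>R w) \<le> r" using r a by (simp add: a_def)
    ultimately obtain k' where k': "k' \<le> N" "((- (r / a)) *\<^sub>R w, k') \<in> G" using N by blast
    have "(r / (r + a)) *\<^sub>R (w, k) + (a / (r + a)) *\<^sub>R ((- (r / a)) *\<^sub>R w, k') \<in> G"
      using r a wk k' by (intro convexD[OF G]) (auto simp: add_divide_distrib[symmetric])
    also have "(r / (r + a)) *\<^sub>R (w, k) + (a / (r + a)) *\<^sub>R ((- (r / a)) *\<^sub>R w, k')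
        = (0, (r * k + a * k') / (r + a))"
      using a by (simp add: add_divide_distrib)
    finally have "- \<mu> \<le> (r * k + a * k') / (r + a)" by (rule zero)
    then have "- \<mu> * (r + a) \<le> r * k + a * k'" using r a by (simp add: pos_le_divide_eq)
    also have "\<dots> \<le> r * k + a * \<bar>N\<bar>" using k' a by (intro add_left_mono mult_left_mono) auto
    finally have "- \<mu> * r \<le> r * k + a * \<bar>N\<bar> + a * \<mu>" by (simp add: algebra_simps)
    also have "a * \<mu> \<le> a * \<bar>\<mu>\<bar>" using a by (intro mult_left_mono) auto
    also have "r * k + a * \<bar>N\<bar> + a * \<bar>\<mu>\<bar> = ((\<bar>N\<bar> + \<bar>\<mu>\<bar>) / r * a + k) * r"
    proof -
      have "(\<bar>N\<bar> + \<bar>\<mu>\<bar>) / r * a * r = (\<bar>N\<bar> + \<bar>\<mu>\<bar>) * a" using r by simp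
      then show ?thesis by (simp only: distrib_right) (simp add: algebra_simps)
    qed
    finally have "- \<mu> * r \<le> ((\<bar>N\<bar> + \<bar>\<mu>\<bar>) / r * a + k) * r" by simp
    then show ?thesis using r by (simp only: mult_le_cancel_right_pos a_def)
  qed (use zero wk in auto)
qed (use that in blast)

section \<open>Conjugate of the infimal convolution\<close>

lemma blinfun_bounded_below_zero:
  fixes g :: "'v::real_normed_vector \<Rightarrow>\<^sub>L real"
  assumes "\<And>x. m \<le> blinfun_apply g x"
  shows "g = 0"
proof (rule blinfun_eqI)
  fix x
  show "blinfun_apply g x = blinfun_apply 0 x"
  proof (rule ccontr)
    assume "blinfun_apply g x \<noteq> blinfun_apply 0 x"
    then have "blinfun_apply g (((m - 1) / blinfun_apply g x) *\<^sub>R x) = m - 1"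
      by (simp add: blinfun.scaleR_right)
    then show False using assms[of "((m - 1) / blinfun_apply g x) *\<^sub>R x"] by simp
  qed
qed

lemma (in strong_epigraph) minorant_above:
  assumes "((x, y), r) \<notin> H"
  obtains a :: "'a dual" and b :: "'a dual dual" and s :: real
    where "r < a x + b y + s" "\<And>u v t. ((u, v), t) \<in> H \<Longrightarrow> a u + b v + s \<le> t"
proof -
  obtain p0 r0 where p0: "(p0, r0) \<in> H" using nonempty by auto
  have p1: "(p0, blinfun_apply (snd p0) (fst p0) - 1) \<notin> H"
    using ge[of "fst p0" "snd p0"] by fastforce
  show ?thesis
  proof (rule affine_minorant_above_point[OF closed cvx _ p0 p1 assms])
    show "(p, r') \<in> H" if "(p, r) \<in> H" "r \<le> r'" for p r r' using up that by blast
  qed (use that in blast)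
qed

text \<open>At a point of \<open>M\<close> the conjugate equals the coupling too: the inequality is the derivative at \<open>t = 0\<close>
  of \<open>h \<ge> c\<close> along the segment towards an arbitrary point of \<open>H\<close>.\<close>

lemma (in strong_epigraph) conjugate_at_M:
  assumes "((x, x'), blinfun_apply x' x) \<in> H" "((y, y'), r) \<in> H"
  shows "blinfun_apply x' y + blinfun_apply y' x - r \<le> blinfun_apply x' x"
proof -
  let ?X = "blinfun_apply x' y + blinfun_apply y' x - blinfun_apply x' x"
  let ?c = "blinfun_apply y' y"
  have "(1 - t) * ?X + t * ?c \<le> r" if t: "0 < t" "t < 1" for t
  proof -
    have "(1 - t) *\<^sub>R ((x, x'), blinfun_apply x' x) + t *\<^sub>R ((y, y'), r) \<in> H"
      using t assms by (intro convexD[OF cvx]) auto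
    then have "(((1 - t) *\<^sub>R x + t *\<^sub>R y, (1 - t) *\<^sub>R x' + t *\<^sub>R y'), (1 - t) * blinfun_apply x' x + t * r) \<in> H"
      by simp
    from ge[OF this] have "t * ((1 - t) * ?X + t * ?c) \<le> t * r"
      by (simp add: blinfun.bilinear_simps algebra_simps)
    then show ?thesis using t by simp
  qed
  then have "eventually (\<lambda>t. (1 - t) * ?X + t * ?c \<le> r) (at_right 0)"
    by (auto simp: eventually_at_right_field intro!: exI[of _ 1])
  moreover have "((\<lambda>t. (1 - t) * ?X + t * ?c) \<longlongrightarrow> (1 - 0) * ?X + 0 * ?c) (at_right 0)"
    by (intro tendsto_intros)
  ultimately have "(1 - 0) * ?X + 0 * ?c \<le> r"
    by (intro tendsto_upperbound) auto
  then show ?thesis by simp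
qed

text \<open>\<open>closure G\<close> is the epigraph of the norm closure of the infimal convolution; \<open>dual_attained\<close> says
  that its conjugate at \<open>(x', z)\<close> is the minimum of \<open>h_S\<^sup>*(x', z1) + h_T\<^sup>*(b, A\<^sup>*\<^sup>*(z - z1))\<close> over all
  \<open>z1\<close> and all \<open>b\<close> with \<open>A\<^sup>* b = x'\<close>.\<close>

locale parallel_epigraphs =
  S: strong_epigraph HS + T: strong_epigraph HT
  for HS :: "(('a::banach \<times> 'a dual) \<times> real) set" and HT :: "(('b::banach \<times> 'b dual) \<times> real) set" +
  fixes A :: "'a \<Rightarrow>\<^sub>L 'b"
  assumes feasible: "\<exists>u x v s t. ((u, blinfun_apply (adj A) v), s) \<in> HS \<and> ((blinfun_apply A x, v), t) \<in> HT"
begin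

definition G :: "(('a \<times> 'a dual) \<times> real) set" where
  "G = {((u + w, blinfun_apply (adj A) v), s + t) | u w v s t.
     ((u, blinfun_apply (adj A) v), s) \<in> HS \<and> ((blinfun_apply A w, v), t) \<in> HT}"

text \<open>This is \<open>h_S\<^sup>*(b1, z1) + h_T\<^sup>*(b2, z2) \<le> r\<close>.\<close>

definition conj_sum_le where
  "conj_sum_le b1 z1 b2 z2 r \<longleftrightarrow> (\<forall>u p s y v t. ((u, p), s) \<in> HS \<longrightarrow> ((y, v), t) \<in> HT \<longrightarrow>
     blinfun_apply b1 u + blinfun_apply z1 p - s + (blinfun_apply b2 y + blinfun_apply z2 v - t) \<le> r)"

text \<open>Phrased for every upper bound \<mu> of the conjugate instead of its value, so that no
  infinite values occur; with \<mu> a finite value it gives attainment.\<close>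

definition dual_attained :: bool where
  "dual_attained \<longleftrightarrow> (\<forall>x' z \<mu>. (\<forall>x y' r. ((x, y'), r) \<in> G \<longrightarrow> blinfun_apply x' x + blinfun_apply z y' - r \<le> \<mu>)
     \<longrightarrow> (\<exists>z1 b. blinfun_apply (adj A) b = x' \<and> conj_sum_le x' z1 b (blinfun_apply (adj (adj A)) (z - z1)) \<mu>))"

text \<open>The primal constraints y = A x, v' = v and p = \<open>adj A\<close> v are perturbed, and
  \<open>D\<close> collects the admissible perturbations. A multiplier has components f1, f2, f3. As
  x and v are free, their coefficients vanish, which forces the two adjoint equations for b = -f1
  and z1 = -f3.\<close>

lemma dual_attained_interior:
  defines "D \<equiv> {(y - blinfun_apply A x, v' - v, p - blinfun_apply (adj A) v) | y x v' v p.
      (\<exists>t. ((y, v'), t) \<in> HT) \<and> (\<exists>u s. ((u, p), s) \<in> HS)}"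
  assumes D: "0 \<in> ic D"
  shows "dual_attained"
  unfolding dual_attained_def
proof (intro allI impI)
  fix x' z \<mu>
  assume *: "\<forall>x y' r. ((x, y'), r) \<in> G \<longrightarrow> blinfun_apply x' x + blinfun_apply z y' - r \<le> \<mu>"
  define L where "L = affine hull D"
  have L: "closed L" and icr: "0 \<in> icr D" using D by (auto simp: ic_def L_def split: if_splits)
  obtain u0 p0 s0 where p0: "((u0, p0), s0) \<in> HS" using S.nonempty by auto
  obtain y0 v0 t0 where v0: "((y0, v0), t0) \<in> HT" using T.nonempty by auto
  have inD: "(y - blinfun_apply A x, v' - v, p - blinfun_apply (adj A) v) \<in> D"
    if "((u, p), s) \<in> HS" "((y, v'), t) \<in> HT" for u p s y v' t x v
    using that unfolding D_def by blast
  have absorb0: "\<exists>\<delta>>0. \<forall>t\<in>{0..\<delta>}. t *\<^sub>R w \<in> D" if "w \<in> affine hull {a - b | a b. a \<in> D \<and> b \<in> D}" for w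
    using icr that unfolding icr_def by auto
  have zero_D: "0 \<in> D"
  proof -
    have "0 \<in> {a - b | a b. a \<in> D \<and> b \<in> D}" using inD[OF p0 v0] by force
    from absorb0[OF hull_inc[OF this]] show ?thesis by force
  qed
  then have zero_L: "0 \<in> L" by (simp add: L_def hull_inc)
  then have sub: "subspace L" by (simp add: L_def subspace_affine)
  have absorb: "\<exists>\<delta>>0. \<delta> *\<^sub>R w \<in> D" if "w \<in> L" for w
  proof -
    have "D \<subseteq> {a - b | a b. a \<in> D \<and> b \<in> D}"
    proof
      fix d assume "d \<in> D"
      then have "d - 0 \<in> {a - b | a b. a \<in> D \<and> b \<in> D}" using zero_D by blast
      then show "d \<in> {a - b | a b. a \<in> D \<and> b \<in> D}" by simp
    qed
    then have "w \<in> affine hull {a - b | a b. a \<in> D \<and> b \<in> D}" using that hull_mono unfolding L_def by blast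
    from absorb0[OF this] show ?thesis by force
  qed
  define jf where "jf = (\<lambda>w::'a \<times> 'a dual \<times> 'b \<times> 'b dual \<times> 'a \<times> 'b dual.
     (fst (snd (snd w)) - blinfun_apply A (fst (snd (snd (snd (snd w))))),
      fst (snd (snd (snd w))) - snd (snd (snd (snd (snd w)))),
      fst (snd w) - blinfun_apply (adj A) (snd (snd (snd (snd (snd w)))))))"
  have "bounded_linear jf" unfolding jf_def
    by (intro bounded_linear_Pair bounded_linear_sub bounded_linear_fst_comp bounded_linear_snd_comp
        bounded_linear_ident bounded_linear_compose[OF blinfun.bounded_linear_right])
  define j where "j = Blinfun jf"
  have j: "blinfun_apply j (u, p, y, v', x, v) = (y - blinfun_apply A x, v' - v, p - blinfun_apply (adj A) v)"
    for u p y v' x v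
    by (simp add: j_def bounded_linear_Blinfun_apply[OF \<open>bounded_linear jf\<close>]) (simp add: jf_def)
  \<comment> \<open>Truncation makes these sets bounded and closed, and also bounds the objective on
    them, which provides the constant \<open>N\<close> of the multiplier lemma.\<close>
  define Q where "Q n = {w::'a \<times> 'a dual \<times> 'b \<times> 'b dual \<times> 'a \<times> 'b dual. norm w \<le> real n
      \<and> ((fst w, fst (snd w)), real n) \<in> HS \<and> ((fst (snd (snd w)), fst (snd (snd (snd w)))), real n) \<in> HT}" for n
  obtain r n where r: "r > 0" "\<And>w. w \<in> L \<Longrightarrow> norm w \<le> r \<Longrightarrow> w \<in> blinfun_apply j ` Q n"
  proof (rule convex_image_neighbourhood_zero[of Q L j])
    show "closed (Q n)" for n
    proof -
      have "closed {w::'a \<times> 'a dual \<times> 'b \<times> 'b dual \<times> 'a \<times> 'b dual. norm w \<le> real n}"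
        by (intro closed_Collect_le continuous_intros)
      moreover have "closed ((\<lambda>w::'a \<times> 'a dual \<times> 'b \<times> 'b dual \<times> 'a \<times> 'b dual. ((fst w, fst (snd w)), real n)) -` HS)"
        by (intro closed_vimage S.closed continuous_intros)
      moreover have "closed ((\<lambda>w::'a \<times> 'a dual \<times> 'b \<times> 'b dual \<times> 'a \<times> 'b dual.
          ((fst (snd (snd w)), fst (snd (snd (snd w)))), real n)) -` HT)"
        by (intro closed_vimage T.closed continuous_intros)
      ultimately show ?thesis unfolding Q_def by (auto simp: vimage_def intro!: closed_Collect_conj)
    qed
    show "convex (Q n)" for n
    proof (rule convexI)
      fix w w' and a b :: real assume w: "w \<in> Q n" "w' \<in> Q n" and ab: "0 \<le> a" "0 \<le> b" "a + b = 1"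
      have r: "a * real n + b * real n = real n" using ab(3) by (simp add: distrib_right[symmetric])
      have "a *\<^sub>R w + b *\<^sub>R w' \<in> cball 0 (real n)"
        using w ab by (intro convexD[OF convex_cball]) (auto simp: Q_def)
      moreover have "a *\<^sub>R ((fst w, fst (snd w)), real n) + b *\<^sub>R ((fst w', fst (snd w')), real n) \<in> HS"
        using w ab by (intro convexD[OF S.cvx]) (auto simp: Q_def)
      moreover have "a *\<^sub>R ((fst (snd (snd w)), fst (snd (snd (snd w)))), real n)
          + b *\<^sub>R ((fst (snd (snd w')), fst (snd (snd (snd w')))), real n) \<in> HT"
        using w ab by (intro convexD[OF T.cvx]) (auto simp: Q_def)
      ultimately show "a *\<^sub>R w + b *\<^sub>R w' \<in> Q n" by (simp add: Q_def r)
    qed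
    show "Q m \<subseteq> Q n" if "m \<le> n" for m n
      using that S.up[of _ "real m" "real n"] T.up[of _ "real m" "real n"] by (auto simp: Q_def)
    show "bounded (Q n)" for n unfolding bounded_iff by (auto simp: Q_def)
    show "subspace L" by (rule sub)
    show "closed L" by (rule L)
    show "blinfun_apply j ` Q n \<subseteq> L" for n
    proof
      fix w assume "w \<in> blinfun_apply j ` Q n"
      then obtain q where q: "q \<in> Q n" "w = blinfun_apply j q" by blast
      obtain u p y v' x v where q': "q = (u, p, y, v', x, v)" by (metis prod.collapse)
      have "w \<in> D"
        unfolding q(2) q' j by (rule inD[of u p "real n" y v' "real n"]) (use q in \<open>auto simp: Q_def q'\<close>)
      then show "w \<in> L" by (simp add: L_def hull_inc)
    qed
    show "\<exists>\<delta>>0. \<exists>n. \<delta> *\<^sub>R w \<in> blinfun_apply j ` Q n" if wL: "w \<in> L" for w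
    proof -
      obtain \<delta> where \<delta>: "\<delta> > 0" "\<delta> *\<^sub>R w \<in> D" using absorb[OF wL] by blast
      then obtain y x v' v p t u s where 1: "((y, v'), t) \<in> HT" "((u, p), s) \<in> HS"
        "\<delta> *\<^sub>R w = (y - blinfun_apply A x, v' - v, p - blinfun_apply (adj A) v)" by (auto simp: D_def)
      obtain n where n: "max (max s t) (norm (u, p, y, v', x, v)) \<le> real n" using real_arch_simple by blast
      have "(u, p, y, v', x, v) \<in> Q n"
        using n 1 S.up[OF 1(2), of "real n"] T.up[OF 1(1), of "real n"] by (auto simp: Q_def)
      then have "blinfun_apply j (u, p, y, v', x, v) \<in> blinfun_apply j ` Q n" by (rule imageI)
      then show ?thesis using \<delta>(1) 1(3) unfolding j by metis
    qed
  qed blast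
  \<comment> \<open>Pairs of constraint defect and primal objective; over defect 0 the objective is
    at least -\<mu> by \<open>*\<close>.\<close>
  define K where "K = (\<lambda>((((u, p), s), ((y, v'), t)), x, v).
      ((y - blinfun_apply A x, v' - v, p - blinfun_apply (adj A) v),
       s + t - blinfun_apply x' u - blinfun_apply x' x - blinfun_apply z (blinfun_apply (adj A) v))) ` ((HS \<times> HT) \<times> UNIV)"
  have K_mem: "((y - blinfun_apply A x, v' - v, p - blinfun_apply (adj A) v),
       s + t - blinfun_apply x' u - blinfun_apply x' x - blinfun_apply z (blinfun_apply (adj A) v)) \<in> K"
    if "((u, p), s) \<in> HS" "((y, v'), t) \<in> HT" for u p s y v' t x v
    unfolding K_def by (rule image_eqI[of _ _ "((((u, p), s), ((y, v'), t)), x, v)"]) (use that in auto)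
  have K_cases: "\<exists>u p s y v' t x v. ((u, p), s) \<in> HS \<and> ((y, v'), t) \<in> HT
      \<and> w = (y - blinfun_apply A x, v' - v, p - blinfun_apply (adj A) v)
      \<and> k = s + t - blinfun_apply x' u - blinfun_apply x' x - blinfun_apply z (blinfun_apply (adj A) v)"
    if "(w, k) \<in> K" for w k
    using that unfolding K_def by (clarsimp, intro exI conjI) (assumption | rule refl)+
  obtain f :: "('b \<times> 'b dual \<times> 'a dual) \<Rightarrow>\<^sub>L real" where f: "\<And>w k. (w, k) \<in> K \<Longrightarrow> - \<mu> \<le> blinfun_apply f w + k"
  proof (rule lagrange_multiplier[of K L r _ \<mu>])
    show "convex K" unfolding K_def
      by (intro convex_linear_image convex_Times S.cvx T.cvx convex_UNIV)
         (auto simp: linear_iff blinfun.add_right blinfun.scaleR_right algebra_simps)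
    show "subspace L" by (rule sub)
    show "w \<in> L" if "(w, k) \<in> K" for w k
      using K_cases[OF that] inD by (auto simp: L_def intro!: hull_inc)
    show "r > 0" by (rule r)
    define N where "N = real n + real n + norm x' * real n + norm x' * real n + norm z * (norm (adj A) * real n)"
    show "\<exists>k\<le>N. (w, k) \<in> K" if w: "w \<in> L" "norm w \<le> r" for w
    proof -
      obtain q where q: "q \<in> Q n" "w = blinfun_apply j q" using r(2)[OF w] by blast
      obtain u p y v' x v where q': "q = (u, p, y, v', x, v)" by (metis prod.collapse)
      have nq: "norm q \<le> real n" using q by (simp add: Q_def)
      have "norm u \<le> real n" using nq norm_fst_le[of u] unfolding q' by (meson order_trans)
      moreover have "norm x \<le> real n" "norm v \<le> real n"
        using nq norm_snd_le norm_fst_le unfolding q' by (meson order_trans)+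
      ultimately have "- blinfun_apply x' u \<le> norm x' * real n" "- blinfun_apply x' x \<le> norm x' * real n"
        "- blinfun_apply z (blinfun_apply (adj A) v) \<le> norm z * (norm (adj A) * real n)"
      proof -
        assume n: "norm u \<le> real n" "norm x \<le> real n" "norm v \<le> real n"
        show "- blinfun_apply x' u \<le> norm x' * real n"
          using blinfun_ge[of x' u] mult_left_mono[OF n(1) norm_ge_zero[of x']] by linarith
        show "- blinfun_apply x' x \<le> norm x' * real n"
          using blinfun_ge[of x' x] mult_left_mono[OF n(2) norm_ge_zero[of x']] by linarith
        have "norm (blinfun_apply (adj A) v) \<le> norm (adj A) * real n"
          using norm_blinfun[of "adj A" v] mult_left_mono[OF n(3) norm_ge_zero[of "adj A"]] by linarith
        from mult_left_mono[OF this norm_ge_zero[of z]]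
        show "- blinfun_apply z (blinfun_apply (adj A) v) \<le> norm z * (norm (adj A) * real n)"
          using blinfun_ge[of z "blinfun_apply (adj A) v"] by linarith
      qed
      then have "real n + real n - blinfun_apply x' u - blinfun_apply x' x - blinfun_apply z (blinfun_apply (adj A) v) \<le> N"
        unfolding N_def by linarith
      moreover have "(w, real n + real n - blinfun_apply x' u - blinfun_apply x' x - blinfun_apply z (blinfun_apply (adj A) v)) \<in> K"
        unfolding q(2) q' j by (rule K_mem) (use q in \<open>auto simp: Q_def q'\<close>)
      ultimately show ?thesis by blast
    qed
    show "- \<mu> \<le> k" if k0: "(0, k) \<in> K" for k
    proof -
      obtain u p s y v' t x v where 1: "((u, p), s) \<in> HS" "((y, v'), t) \<in> HT"
        "0 = (y - blinfun_apply A x, v' - v, p - blinfun_apply (adj A) v)"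
        "k = s + t - blinfun_apply x' u - blinfun_apply x' x - blinfun_apply z (blinfun_apply (adj A) v)"
        using K_cases[OF k0] by blast
      then have eq: "y = blinfun_apply A x" "v' = v" "p = blinfun_apply (adj A) v" by (auto simp: zero_prod_def)
      have "((u + x, blinfun_apply (adj A) v), s + t) \<in> G" using 1(1,2) unfolding eq G_def by blast
      with * have "blinfun_apply x' (u + x) + blinfun_apply z (blinfun_apply (adj A) v) - (s + t) \<le> \<mu>" by blast
      then show ?thesis by (simp add: 1(4) blinfun.add_right)
    qed
  qed blast
  obtain f1 f' where f1: "\<And>y w. blinfun_apply f (y, w) = blinfun_apply f1 y + blinfun_apply f' w"
    using blinfun_on_Times by blast
  obtain f2 f3 where f2: "\<And>v p. blinfun_apply f' (v, p) = blinfun_apply f2 v + blinfun_apply f3 p"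
    using blinfun_on_Times by blast
  have ineq: "- \<mu> \<le> blinfun_apply f1 (y - blinfun_apply A x) + blinfun_apply f2 (v' - v)
      + blinfun_apply f3 (p - blinfun_apply (adj A) v)
      + (s + t - blinfun_apply x' u - blinfun_apply x' x - blinfun_apply z (blinfun_apply (adj A) v))"
    if "((u, p), s) \<in> HS" "((y, v'), t) \<in> HT" for u p s y v' t x v
    using f[OF K_mem[OF that]] by (simp add: f1 f2 add.assoc)
  define c where "c = blinfun_apply f1 y0 + blinfun_apply f2 v0 + blinfun_apply f3 p0 + s0 + t0 - blinfun_apply x' u0"
  have "- (blinfun_apply (adj A) f1 + x') = 0"
  proof (rule blinfun_bounded_below_zero)
    fix x
    show "- \<mu> - c \<le> blinfun_apply (- (blinfun_apply (adj A) f1 + x')) x"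
      using ineq[OF p0 v0, of x 0]
      by (simp add: c_def blinfun.bilinear_simps)
  qed
  then have b: "blinfun_apply (adj A) (- f1) = x'"
    by (simp add: blinfun.minus_right)
  have "- (f2 + blinfun_apply (adj (adj A)) (f3 + z)) = 0"
  proof (rule blinfun_bounded_below_zero)
    fix v
    show "- \<mu> - c \<le> blinfun_apply (- (f2 + blinfun_apply (adj (adj A)) (f3 + z))) v"
      using ineq[OF p0 v0, of 0 v]
      by (simp add: c_def blinfun.bilinear_simps)
  qed
  then have "blinfun_apply (adj (adj A)) (z - (- f3)) = - f2"
    by (simp add: add.commute)
  moreover have "conj_sum_le x' (- f3) (- f1) (- f2) \<mu>"
    unfolding conj_sum_le_def
  proof (intro allI impI)
    fix u p s y v t assume "((u, p), s) \<in> HS" "((y, v), t) \<in> HT"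
    from ineq[OF this, of 0 0]
    show "blinfun_apply x' u + blinfun_apply (- f3) p - s + (blinfun_apply (- f1) y + blinfun_apply (- f2) v - t) \<le> \<mu>"
      by (simp add: blinfun.bilinear_simps)
  qed
  ultimately show "\<exists>z1 b. blinfun_apply (adj A) b = x'
      \<and> conj_sum_le x' z1 b (blinfun_apply (adj (adj A)) (z - z1)) \<mu>"
    using b by metis
qed

lemma convex_conj_sum:
  "convex {(b1, blinfun_apply (adj A) b2, blinfun_apply (adj (adj A)) z1 + z2, r) | b1 b2 z1 z2 r. conj_sum_le b1 z1 b2 z2 r}"
    (is "convex ?E")
proof (rule convexI)
  fix e e' and a a' :: real assume e: "e \<in> ?E" "e' \<in> ?E" and a: "0 \<le> a" "0 \<le> a'" "a + a' = 1"
  obtain b1 b2 z1 z2 r where 1: "e = (b1, blinfun_apply (adj A) b2, blinfun_apply (adj (adj A)) z1 + z2, r)"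
    "conj_sum_le b1 z1 b2 z2 r" using e(1) by blast
  obtain b1' b2' z1' z2' r' where 2: "e' = (b1', blinfun_apply (adj A) b2', blinfun_apply (adj (adj A)) z1' + z2', r')"
    "conj_sum_le b1' z1' b2' z2' r'" using e(2) by blast
  have a': "a' = 1 - a" using a by simp
  have "conj_sum_le (a *\<^sub>R b1 + a' *\<^sub>R b1') (a *\<^sub>R z1 + a' *\<^sub>R z1') (a *\<^sub>R b2 + a' *\<^sub>R b2') (a *\<^sub>R z2 + a' *\<^sub>R z2') (a * r + a' * r')"
    unfolding conj_sum_le_def
  proof (intro allI impI)
    fix u p s y v t assume H: "((u, p), s) \<in> HS" "((y, v), t) \<in> HT"
    have "a * (blinfun_apply b1 u + blinfun_apply z1 p - s + (blinfun_apply b2 y + blinfun_apply z2 v - t))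
      + a' * (blinfun_apply b1' u + blinfun_apply z1' p - s + (blinfun_apply b2' y + blinfun_apply z2' v - t))
      \<le> a * r + a' * r'"
      using 1(2) 2(2) H a unfolding conj_sum_le_def by (intro add_mono mult_left_mono) blast+
    then show "blinfun_apply (a *\<^sub>R b1 + a' *\<^sub>R b1') u + blinfun_apply (a *\<^sub>R z1 + a' *\<^sub>R z1') p - s
      + (blinfun_apply (a *\<^sub>R b2 + a' *\<^sub>R b2') y + blinfun_apply (a *\<^sub>R z2 + a' *\<^sub>R z2') v - t) \<le> a * r + a' * r'"
      unfolding a' by (simp add: blinfun.add_left blinfun.diff_left blinfun.scaleR_left algebra_simps)
  qed
  moreover have "a *\<^sub>R e + a' *\<^sub>R e' = (a *\<^sub>R b1 + a' *\<^sub>R b1', blinfun_apply (adj A) (a *\<^sub>R b2 + a' *\<^sub>R b2'),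
      blinfun_apply (adj (adj A)) (a *\<^sub>R z1 + a' *\<^sub>R z1') + (a *\<^sub>R z2 + a' *\<^sub>R z2'), a * r + a' * r')"
    by (simp add: 1(1) 2(1) blinfun.add_right blinfun.scaleR_right algebra_simps)
  ultimately show "a *\<^sub>R e + a' *\<^sub>R e' \<in> ?E" by blast
qed

text \<open>The Fenchel--Moreau theorem for \<open>h_S\<close> and \<open>h_T\<close>.\<close>

lemma conj_sum_le_minorant:
  assumes gap: "\<And>s t. ((u, p), s) \<in> HS \<Longrightarrow> ((y, v), t) \<in> HT \<Longrightarrow> \<tau> \<le> s + t" and \<delta>: "\<delta> > 0"
  obtains b1 z1 b2 z2 r where "conj_sum_le b1 z1 b2 z2 r"
    "\<tau> - \<delta> < blinfun_apply b1 u + blinfun_apply z1 p + blinfun_apply b2 y + blinfun_apply z2 v - r"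
proof -
  \<comment> \<open>Split \<tau> - \<delta> into one height below each function. If
    \<open>HS\<close> has no point over (u, p), the second height is taken one below the coupling
    and the first absorbs the rest; otherwise the first is \<delta> / 4 below its infimum and
    \<open>gap\<close> keeps the second out of \<open>HT\<close>.\<close>
  have "\<exists>r1 r2. ((u, p), r1) \<notin> HS \<and> ((y, v), r2) \<notin> HT \<and> r1 + r2 = \<tau> - \<delta>"
  proof (cases "\<exists>s. ((u, p), s) \<in> HS")
    case False
    have "((y, v), blinfun_apply v y - 1) \<notin> HT" using T.ge by force
    with False show ?thesis by (intro exI[of _ "\<tau> - \<delta> - (blinfun_apply v y - 1)"] exI[of _ "blinfun_apply v y - 1"]) auto
  next
    case True
    define I where "I = {s. ((u, p), s) \<in> HS}"
    have I: "I \<noteq> {}" "bdd_below I" using True S.ge by (auto simp: I_def intro!: bdd_belowI[of _ "blinfun_apply p u"])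
    define r1 where "r1 = Inf I - \<delta> / 4"
    have "r1 \<notin> I" using cInf_lower[OF _ I(2), of r1] \<delta> by (auto simp: r1_def)
    moreover obtain s where s: "s \<in> I" "s < Inf I + \<delta> / 4"
      using cInf_lessD[OF I(1), of "Inf I + \<delta> / 4"] \<delta> by auto
    have "((y, v), \<tau> - \<delta> - r1) \<notin> HT"
    proof
      assume "((y, v), \<tau> - \<delta> - r1) \<in> HT"
      then have "\<tau> \<le> s + (\<tau> - \<delta> - r1)" using gap s(1) by (simp add: I_def)
      then show False using s(2) \<delta> by (simp add: r1_def)
    qed
    ultimately show ?thesis by (intro exI[of _ r1] exI[of _ "\<tau> - \<delta> - r1"]) (simp add: I_def)
  qed
  then obtain r1 r2 where r: "((u, p), r1) \<notin> HS" "((y, v), r2) \<notin> HT" "r1 + r2 = \<tau> - \<delta>" by blast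
  obtain b1 z1 s1 where 1: "r1 < blinfun_apply b1 u + blinfun_apply z1 p + s1"
    "\<And>u p s. ((u, p), s) \<in> HS \<Longrightarrow> blinfun_apply b1 u + blinfun_apply z1 p + s1 \<le> s"
    using S.minorant_above[OF r(1)] by metis
  obtain b2 z2 s2 where 2: "r2 < blinfun_apply b2 y + blinfun_apply z2 v + s2"
    "\<And>y v t. ((y, v), t) \<in> HT \<Longrightarrow> blinfun_apply b2 y + blinfun_apply z2 v + s2 \<le> t"
    using T.minorant_above[OF r(2)] by metis
  have "conj_sum_le b1 z1 b2 z2 (- s1 - s2)"
    unfolding conj_sum_le_def
  proof (intro allI impI)
    fix u p s y v t assume "((u, p), s) \<in> HS" "((y, v), t) \<in> HT"
    then show "blinfun_apply b1 u + blinfun_apply z1 p - s + (blinfun_apply b2 y + blinfun_apply z2 v - t) \<le> - s1 - s2"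
      using 1(2)[of u p s] 2(2)[of y v t] by simp
  qed
  then show ?thesis by (rule that) (use 1(1) 2(1) r(3) in linarith)
qed

text \<open>A weak-star separating functional may have weight \<open>\<rho> = 0\<close> on the last coordinate; adding the
  functional given by a feasible primal point makes the weight positive, and then the Fenchel--Moreau
  theorem turns it into a point of \<open>G\<close> that violates the bound \<open>\<mu>\<close>.\<close>

lemma dual_attained_closed:
  assumes cl: "closed_regarding (prod_topology wstar (prod_topology wstar (prod_topology wstar euclideanreal)))
     {(b1, blinfun_apply (adj A) b2, blinfun_apply (adj (adj A)) z1 + z2, r) | b1 b2 z1 z2 r. conj_sum_le b1 z1 b2 z2 r}
     {(x', x', z, r) | x' z r. z \<in> range (blinfun_apply (adj (adj A)))}"
    (is "closed_regarding ?X ?E ?W")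
  shows "dual_attained"
  unfolding dual_attained_def
proof (intro allI impI)
  fix x' z \<mu>
  assume *: "\<forall>x y' r. ((x, y'), r) \<in> G \<longrightarrow> blinfun_apply x' x + blinfun_apply z y' - r \<le> \<mu>"
  let ?A2 = "blinfun_apply (adj (adj A))"
  have "(x', x', ?A2 z, \<mu>) \<in> ?X closure_of ?E"
  proof (rule ccontr)
    assume "(x', x', ?A2 z, \<mu>) \<notin> ?X closure_of ?E"
    then obtain a b c \<rho> \<epsilon> where \<epsilon>: "\<epsilon> > 0" and sep: "\<And>e1 e2 e3 e4. (e1, e2, e3, e4) \<in> ?E \<Longrightarrow>
      \<epsilon> \<le> blinfun_apply (e1 - x') a + blinfun_apply (e2 - x') b + blinfun_apply (e3 - ?A2 z) c + \<rho> * (e4 - \<mu>)"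
      using wstar_separation[OF convex_conj_sum] by (smt (verit, best))
    have sep': "\<epsilon> \<le> blinfun_apply (b1 - x') a + blinfun_apply (blinfun_apply (adj A) b2 - x') b
        + blinfun_apply (?A2 z1 + z2 - ?A2 z) c + \<rho> * (r - \<mu>)"
      if "conj_sum_le b1 z1 b2 z2 r" for b1 z1 b2 z2 r
      using that by (intro sep) blast
    obtain u0 x0 v0 s0 t0 where p0: "((u0, blinfun_apply (adj A) v0), s0) \<in> HS" "((blinfun_apply A x0, v0), t0) \<in> HT"
      using feasible by blast
    \<comment> \<open>\<open>?E\<close> is closed upwards in r, so a negative weight would violate
      the lower bound \<epsilon>.\<close>
    have \<rho>: "\<rho> \<ge> 0"
    proof (rule ccontr)
      assume n: "\<not> \<rho> \<ge> 0"
      obtain b1 z1 b2 z2 r where e: "conj_sum_le b1 z1 b2 z2 r"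
      proof (rule conj_sum_le_minorant[of u0 "blinfun_apply (adj A) v0" "blinfun_apply A x0" v0
            "blinfun_apply (blinfun_apply (adj A) v0) u0 + blinfun_apply v0 (blinfun_apply A x0)" 1])
        show "blinfun_apply (blinfun_apply (adj A) v0) u0 + blinfun_apply v0 (blinfun_apply A x0) \<le> s + t"
          if "((u0, blinfun_apply (adj A) v0), s) \<in> HS" "((blinfun_apply A x0, v0), t) \<in> HT" for s t
          using S.ge[OF that(1)] T.ge[OF that(2)] by simp
      qed auto
      define k where "k = (blinfun_apply (b1 - x') a + blinfun_apply (blinfun_apply (adj A) b2 - x') b
        + blinfun_apply (?A2 z1 + z2 - ?A2 z) c + \<rho> * (r - \<mu>)) / (- \<rho>)"
      have "k \<ge> 0" unfolding k_def using sep'[OF e] n \<epsilon> by (intro divide_nonneg_pos) auto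
      then have "conj_sum_le b1 z1 b2 z2 (r + k)" using e unfolding conj_sum_le_def by (meson add_increasing2 order_trans order_refl)
      from sep'[OF this] have "\<epsilon> \<le> (blinfun_apply (b1 - x') a + blinfun_apply (blinfun_apply (adj A) b2 - x') b
        + blinfun_apply (?A2 z1 + z2 - ?A2 z) c + \<rho> * (r - \<mu>)) + \<rho> * k" by (simp add: algebra_simps)
      moreover have "\<rho> * k = - (blinfun_apply (b1 - x') a + blinfun_apply (blinfun_apply (adj A) b2 - x') b
        + blinfun_apply (?A2 z1 + z2 - ?A2 z) c + \<rho> * (r - \<mu>))" unfolding k_def using n by simp
      ultimately show False using \<epsilon> by linarith
    qed
    \<comment> \<open>\<open>conj_sum_le\<close> at the feasible point is an affine inequality with
      weight 1 on r and constant -(s0 + t0 + w0). The multiple \<tau> of the separation raises the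
      combined constant to at least 1, and division by \<sigma> normalizes the weight of r.\<close>
    define w0 where "w0 = \<mu> - blinfun_apply x' u0 - blinfun_apply x' x0 - blinfun_apply (?A2 z) v0"
    define \<tau> where "\<tau> = (\<bar>s0 + t0 + w0\<bar> + 1) / \<epsilon>"
    have \<tau>: "\<tau> > 0" "\<tau> * \<epsilon> = \<bar>s0 + t0 + w0\<bar> + 1" using \<epsilon> by (auto simp: \<tau>_def)
    define \<sigma> where "\<sigma> = 1 + \<tau> * \<rho>"
    have \<sigma>: "\<sigma> > 0" using \<tau> \<rho> by (simp add: \<sigma>_def add_pos_nonneg)
    define a1 where "a1 = (1 / \<sigma>) *\<^sub>R (\<tau> *\<^sub>R a - u0)"
    define c1 where "c1 = (1 / \<sigma>) *\<^sub>R (\<tau> *\<^sub>R b - x0)"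
    define d1 where "d1 = (1 / \<sigma>) *\<^sub>R (\<tau> *\<^sub>R c - v0)"
    have low: "1 / \<sigma> \<le> blinfun_apply (b1 - x') a1 + blinfun_apply (blinfun_apply (adj A) b2 - x') c1
        + blinfun_apply (?A2 z1 + z2 - ?A2 z) d1 + (r - \<mu>)"
      if e: "conj_sum_le b1 z1 b2 z2 r" for b1 z1 b2 z2 r
    proof -
      let ?l0 = "blinfun_apply (b1 - x') a + blinfun_apply (blinfun_apply (adj A) b2 - x') b
        + blinfun_apply (?A2 z1 + z2 - ?A2 z) c + \<rho> * (r - \<mu>)"
      have "blinfun_apply b1 u0 + blinfun_apply z1 (blinfun_apply (adj A) v0) - s0
          + (blinfun_apply b2 (blinfun_apply A x0) + blinfun_apply z2 v0 - t0) \<le> r"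
        using e p0 unfolding conj_sum_le_def by blast
      then have "- (s0 + t0 + w0) \<le> r - \<mu> - (blinfun_apply (b1 - x') u0 + blinfun_apply (blinfun_apply (adj A) b2 - x') x0
        + blinfun_apply (?A2 z1 + z2 - ?A2 z) v0)"
        by (simp add: w0_def blinfun.add_left blinfun.diff_left)
      moreover have "\<tau> * \<epsilon> \<le> \<tau> * ?l0" using sep'[OF e] \<tau> by (intro mult_left_mono) auto
      ultimately have "1 \<le> r - \<mu> - (blinfun_apply (b1 - x') u0 + blinfun_apply (blinfun_apply (adj A) b2 - x') x0
        + blinfun_apply (?A2 z1 + z2 - ?A2 z) v0) + \<tau> * ?l0"
        using \<tau>(2) by linarith
      also have "\<dots> = \<sigma> * (r - \<mu>) + blinfun_apply (b1 - x') (\<tau> *\<^sub>R a - u0)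
          + blinfun_apply (blinfun_apply (adj A) b2 - x') (\<tau> *\<^sub>R b - x0) + blinfun_apply (?A2 z1 + z2 - ?A2 z) (\<tau> *\<^sub>R c - v0)"
        unfolding \<sigma>_def blinfun.diff_right blinfun.scaleR_right by (simp add: algebra_simps)
      finally have "1 / \<sigma> \<le> (\<sigma> * (r - \<mu>) + blinfun_apply (b1 - x') (\<tau> *\<^sub>R a - u0)
          + blinfun_apply (blinfun_apply (adj A) b2 - x') (\<tau> *\<^sub>R b - x0)
          + blinfun_apply (?A2 z1 + z2 - ?A2 z) (\<tau> *\<^sub>R c - v0)) / \<sigma>"
        using \<sigma> by (intro divide_right_mono) auto
      then show ?thesis
        using \<sigma> by (simp add: a1_def c1_def d1_def blinfun.scaleR_right add_divide_distrib)
    qed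
    \<comment> \<open>The negated separating vectors form a primal point over -(a1 + c1), where
      \<open>*\<close> bounds s + t below by \<tau>'. A minorant that misses \<tau>' there by less
      than 1 / (2 \<sigma>) gives an element of \<open>?E\<close> that breaks the margin 1 /
      \<sigma>.\<close>
    define \<tau>' where "\<tau>' = - (blinfun_apply x' (a1 + c1) + blinfun_apply (?A2 z) d1 + \<mu>)"
    obtain b1 z1 b2 z2 r where e: "conj_sum_le b1 z1 b2 z2 r"
      "\<tau>' - 1 / (2 * \<sigma>) < blinfun_apply b1 (- a1) + blinfun_apply z1 (blinfun_apply (adj A) (- d1))
        + blinfun_apply b2 (blinfun_apply A (- c1)) + blinfun_apply z2 (- d1) - r"
    proof (rule conj_sum_le_minorant[of "- a1" "blinfun_apply (adj A) (- d1)" "blinfun_apply A (- c1)" "- d1"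
          \<tau>' "1 / (2 * \<sigma>)"])
      fix s t assume "((- a1, blinfun_apply (adj A) (- d1)), s) \<in> HS" "((blinfun_apply A (- c1), - d1), t) \<in> HT"
      then have "((- a1 + - c1, blinfun_apply (adj A) (- d1)), s + t) \<in> G" unfolding G_def by blast
      with * have "blinfun_apply x' (- a1 + - c1) + blinfun_apply z (blinfun_apply (adj A) (- d1)) - (s + t) \<le> \<mu>" by blast
      then show "\<tau>' \<le> s + t" by (simp add: \<tau>'_def blinfun.bilinear_simps)
    qed (use \<sigma> in auto)
    have "1 / \<sigma> < 1 / (2 * \<sigma>)"
      using low[OF e(1)] e(2) by (simp add: \<tau>'_def blinfun.bilinear_simps)
    then show False using \<sigma> by (simp add: field_simps)
  qed
  moreover have "(x', x', ?A2 z, \<mu>) \<in> ?W" by blast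
  ultimately have "(x', x', ?A2 z, \<mu>) \<in> ?E" using cl unfolding closed_regarding_def by blast
  then obtain b z1 z2 where 1: "x' = blinfun_apply (adj A) b" "?A2 z = ?A2 z1 + z2" "conj_sum_le x' z1 b z2 \<mu>"
    by auto
  have "?A2 (z - z1) = z2" using 1(2) by (simp add: blinfun.diff_right)
  with 1 show "\<exists>z1 b. blinfun_apply (adj A) b = x' \<and> conj_sum_le x' z1 b (?A2 (z - z1)) \<mu>" by blast
qed

text \<open>Each conjugate dominates its coupling, so a bound \<mu> on their sum bounds each by
  \<mu> minus the coupling of the other.\<close>

lemma conj_sum_le_dual:
  assumes b: "blinfun_apply (adj A) b = x'" and le: "conj_sum_le x' z1 b (blinfun_apply (adj (adj A)) (z - z1)) \<mu>"
  shows "((u, p), s) \<in> HS \<Longrightarrow> blinfun_apply x' u + blinfun_apply z1 p - s \<le> \<mu> - blinfun_apply (z - z1) x'"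
    and "((y, v), t) \<in> HT \<Longrightarrow> blinfun_apply b y + blinfun_apply (blinfun_apply (adj (adj A)) (z - z1)) v - t
      \<le> \<mu> - blinfun_apply z1 x'"
    and "blinfun_apply z x' \<le> \<mu>"
proof -
  note le' = le[unfolded conj_sum_le_def, rule_format]
  have T: "blinfun_apply (blinfun_apply (adj (adj A)) (z - z1)) b = blinfun_apply (z - z1) x'"
    using b by simp
  show 1: "blinfun_apply x' u + blinfun_apply z1 p - s \<le> \<mu> - blinfun_apply (z - z1) x'"
    if "((u, p), s) \<in> HS" for u p s
  proof -
    have "blinfun_apply (blinfun_apply (adj (adj A)) (z - z1)) b \<le> \<mu> - (blinfun_apply x' u + blinfun_apply z1 p - s)"
      by (rule T.conj_ge) (use le'[OF that] in \<open>simp add: algebra_simps\<close>)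
    then show ?thesis unfolding T by linarith
  qed
  show "blinfun_apply b y + blinfun_apply (blinfun_apply (adj (adj A)) (z - z1)) v - t \<le> \<mu> - blinfun_apply z1 x'"
    if H: "((y, v), t) \<in> HT"
  proof -
    have "blinfun_apply z1 x' \<le> \<mu> - (blinfun_apply b y + blinfun_apply (blinfun_apply (adj (adj A)) (z - z1)) v - t)"
      by (rule S.conj_ge) (use le'[OF _ H] in \<open>simp add: algebra_simps\<close>)
    then show ?thesis by linarith
  qed
  have "blinfun_apply z1 x' \<le> \<mu> - blinfun_apply (z - z1) x'" by (rule S.conj_ge) (rule 1)
  then show "blinfun_apply z x' \<le> \<mu>" by (simp add: blinfun.diff_left)
qed

lemma convex_G: "convex G"
proof (rule convexI)
  fix e e' and a a' :: real assume e: "e \<in> G" "e' \<in> G" and a: "0 \<le> a" "0 \<le> a'" "a + a' = 1"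
  obtain u w v s t where 1: "e = ((u + w, blinfun_apply (adj A) v), s + t)"
    "((u, blinfun_apply (adj A) v), s) \<in> HS" "((blinfun_apply A w, v), t) \<in> HT"
    using e(1) unfolding G_def by blast
  obtain u' w' v' s' t' where 2: "e' = ((u' + w', blinfun_apply (adj A) v'), s' + t')"
    "((u', blinfun_apply (adj A) v'), s') \<in> HS" "((blinfun_apply A w', v'), t') \<in> HT"
    using e(2) unfolding G_def by blast
  have "((a *\<^sub>R u + a' *\<^sub>R u', blinfun_apply (adj A) (a *\<^sub>R v + a' *\<^sub>R v')), a * s + a' * s') \<in> HS"
    using convexD[OF S.cvx 1(2) 2(2) a] by (simp add: blinfun.add_right blinfun.scaleR_right)
  moreover have "((blinfun_apply A (a *\<^sub>R w + a' *\<^sub>R w'), a *\<^sub>R v + a' *\<^sub>R v'), a * t + a' * t') \<in> HT"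
    using convexD[OF T.cvx 1(3) 2(3) a] by (simp add: blinfun.add_right blinfun.scaleR_right)
  ultimately have "((a *\<^sub>R u + a' *\<^sub>R u' + (a *\<^sub>R w + a' *\<^sub>R w'), blinfun_apply (adj A) (a *\<^sub>R v + a' *\<^sub>R v')),
      a * s + a' * s' + (a * t + a' * t')) \<in> G"
    unfolding G_def by blast
  also have "((a *\<^sub>R u + a' *\<^sub>R u' + (a *\<^sub>R w + a' *\<^sub>R w'), blinfun_apply (adj A) (a *\<^sub>R v + a' *\<^sub>R v')),
      a * s + a' * s' + (a * t + a' * t')) = a *\<^sub>R e + a' *\<^sub>R e'"
    by (simp add: 1(1) 2(1) blinfun.add_right blinfun.scaleR_right algebra_simps)
  finally show "a *\<^sub>R e + a' *\<^sub>R e' \<in> G" .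
qed

text \<open>Upward closure and h \<ge> c pass from \<open>G\<close> to its closure by continuity;
  the conjugate inequality comes from the dual decomposition.\<close>

lemma strong_epigraph_closure:
  assumes dual_attained
  shows "strong_epigraph (closure G)"
proof
  show "convex (closure G)" by (rule convex_closure[OF convex_G])
  show "closed (closure G)" by simp
  show "(p, r') \<in> closure G" if "(p, r) \<in> closure G" "r \<le> r'" for p r r'
  proof -
    have G_up: "(p, r + k) \<in> G" if pr: "(p, r) \<in> G" and k: "k \<ge> 0" for p r k
    proof -
      obtain u w v s t where 1: "(p, r) = ((u + w, blinfun_apply (adj A) v), s + t)"
        "((u, blinfun_apply (adj A) v), s) \<in> HS" "((blinfun_apply A w, v), t) \<in> HT"
        using pr unfolding G_def by blast
      have "((blinfun_apply A w, v), t + k) \<in> HT" using T.up[OF 1(3), of "t + k"] k by simp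
      with 1(2) have "((u + w, blinfun_apply (adj A) v), s + (t + k)) \<in> G" unfolding G_def by blast
      then show ?thesis using 1(1) by (simp add: add.assoc)
    qed
    have "(\<lambda>q. (fst q, snd q + (r' - r))) ` closure G \<subseteq> closure G"
    proof (rule image_closure_subset)
      show "continuous_on (closure G) (\<lambda>q. (fst q, snd q + (r' - r)))" by (intro continuous_intros)
      show "(\<lambda>q. (fst q, snd q + (r' - r))) ` G \<subseteq> closure G"
        using G_up[of _ _ "r' - r"] that(2) closure_subset by fastforce
    qed simp
    then show ?thesis using that(1) by force
  qed
  show "blinfun_apply x' x \<le> r" if "((x, x'), r) \<in> closure G" for x x' r
  proof -
    have "closure G \<subseteq> {q. blinfun_apply (snd (fst q)) (fst (fst q)) \<le> snd q}"
    proof (rule closure_minimal)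
      show "G \<subseteq> {q. blinfun_apply (snd (fst q)) (fst (fst q)) \<le> snd q}"
        unfolding G_def using S.ge T.ge by (fastforce simp: blinfun.add_right intro: add_mono)
      show "closed {q::(('a \<times> 'a dual) \<times> real). blinfun_apply (snd (fst q)) (fst (fst q)) \<le> snd q}"
        by (intro closed_Collect_le continuous_intros blinfun.continuous_on)
    qed
    with that show ?thesis by force
  qed
  show "blinfun_apply z b \<le> s"
    if "\<And>x x' r. ((x, x'), r) \<in> closure G \<Longrightarrow> blinfun_apply b x + blinfun_apply z x' - r \<le> s" for b z s
  proof -
    have "\<forall>x y' r. ((x, y'), r) \<in> G \<longrightarrow> blinfun_apply b x + blinfun_apply z y' - r \<le> s"
      using that closure_subset by blast
    with assms show ?thesis unfolding dual_attained_def using conj_sum_le_dual(3) by blast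
  qed
qed

text \<open>\<open>conjugate_at_M\<close> allows the dual decomposition to be taken with \<mu> equal
  to the coupling, which leaves no slack in \<open>conj_sum_le_dual\<close>.\<close>

lemma coincidence_decomposition:
  assumes da: dual_attained and x: "((x, x'), blinfun_apply x' x) \<in> closure G"
  shows "\<exists>z1 b. blinfun_apply (adj A) b = x'
    \<and> (\<forall>u p s. ((u, p), s) \<in> HS \<longrightarrow> blinfun_apply x' u + blinfun_apply z1 p - s \<le> blinfun_apply z1 x')
    \<and> (\<forall>y v t. ((y, v), t) \<in> HT \<longrightarrow>
        blinfun_apply b y + blinfun_apply (blinfun_apply (adj (adj A)) (emb x - z1)) v - t
          \<le> blinfun_apply x' x - blinfun_apply z1 x')"
proof -
  have "\<forall>y y' r. ((y, y'), r) \<in> G \<longrightarrow> blinfun_apply x' y + blinfun_apply (emb x) y' - r \<le> blinfun_apply x' x"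
    using strong_epigraph.conjugate_at_M[OF strong_epigraph_closure[OF da] x] closure_subset by force
  then obtain z1 b where b: "blinfun_apply (adj A) b = x'"
    "conj_sum_le x' z1 b (blinfun_apply (adj (adj A)) (emb x - z1)) (blinfun_apply x' x)"
    using da unfolding dual_attained_def by blast
  show ?thesis
  proof (intro exI[of _ z1] exI[of _ b] conjI allI impI b(1))
    show "blinfun_apply x' u + blinfun_apply z1 p - s \<le> blinfun_apply z1 x'" if "((u, p), s) \<in> HS" for u p s
      using conj_sum_le_dual(1)[OF b that] by (simp add: blinfun.diff_left)
  qed (rule conj_sum_le_dual(2)[OF b])
qed

end

section \<open>Translation to extended-real functions\<close>

lemma epigraph_up: "(p, r) \<in> epigraph h \<Longrightarrow> r \<le> r' \<Longrightarrow> (p, r') \<in> epigraph h"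
  by (simp add: epigraph_def) (meson ereal_less_eq(3) order_trans)

lemma fconj_le_iff:
  "fconj h (b, z) \<le> ereal s \<longleftrightarrow>
    (\<forall>x y' r. ((x, y'), r) \<in> epigraph h \<longrightarrow> blinfun_apply b x + blinfun_apply z y' - r \<le> s)"
proof -
  have sub: "ereal a - k \<le> ereal s \<longleftrightarrow> (\<forall>r. k \<le> ereal r \<longrightarrow> a - r \<le> s)" for a k
  proof (cases k)
    case MInf
    have "\<not> (\<forall>r. a - r \<le> s)" by (metis add_diff_cancel_left' diff_diff_eq2 less_add_one not_le)
    then show ?thesis using MInf by simp
  qed (auto simp: intro: order_trans[OF diff_left_mono])
  have "fconj h (b, z) \<le> ereal s \<longleftrightarrow>
      (\<forall>x y'. ereal (blinfun_apply b x + blinfun_apply z y') - h (x, y') \<le> ereal s)"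
    by (auto simp: fconj_def Sup_le_iff)
  then show ?thesis unfolding sub by (auto simp: epigraph_def)
qed

text \<open>An empty epigraph has conjugate minus infinity, and \<open>?R\<close> would be vacuous
  whatever the other conjugate is. With points in both, fixing the second one shows that the first
  conjugate is a real c, and then r - c bounds the other.\<close>

lemma fconj_sum_le_iff:
  assumes "epigraph h \<noteq> {}" "epigraph k \<noteq> {}"
  shows "fconj h (b1, z1) + fconj k (b2, z2) \<le> ereal r \<longleftrightarrow>
    (\<forall>u p s y v t. ((u, p), s) \<in> epigraph h \<longrightarrow> ((y, v), t) \<in> epigraph k \<longrightarrow>
      blinfun_apply b1 u + blinfun_apply z1 p - s + (blinfun_apply b2 y + blinfun_apply z2 v - t) \<le> r)"
    (is "?L \<longleftrightarrow> ?R")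
proof
  have low: "ereal (blinfun_apply b u + blinfun_apply z p - s) \<le> fconj g (b, z)"
    if "((u, p), s) \<in> epigraph g" for g :: "'c::real_normed_vector \<times> 'c dual \<Rightarrow> ereal" and b z u p s
  proof (rule ereal_le_real)
    fix r assume "fconj g (b, z) \<le> ereal r"
    then have "blinfun_apply b u + blinfun_apply z p - s \<le> r"
      using that by (rule fconj_le_iff[THEN iffD1, rule_format])
    then show "ereal (blinfun_apply b u + blinfun_apply z p - s) \<le> ereal r" by simp
  qed
  show ?R if ?L
  proof (intro allI impI)
    fix u p s y v t assume "((u, p), s) \<in> epigraph h" "((y, v), t) \<in> epigraph k"
    then have "ereal (blinfun_apply b1 u + blinfun_apply z1 p - s) + ereal (blinfun_apply b2 y + blinfun_apply z2 v - t)
        \<le> fconj h (b1, z1) + fconj k (b2, z2)"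
      by (intro add_mono low)
    also note \<open>?L\<close>
    finally show "blinfun_apply b1 u + blinfun_apply z1 p - s + (blinfun_apply b2 y + blinfun_apply z2 v - t) \<le> r"
      by simp
  qed
  show ?L if R: ?R
  proof -
    obtain u p s y v t where p: "((u, p), s) \<in> epigraph h" "((y, v), t) \<in> epigraph k"
      using assms by fast
    have le: "fconj h (b1, z1) \<le> ereal (r - (blinfun_apply b2 y + blinfun_apply z2 v - t))"
      if "((y, v), t) \<in> epigraph k" for y v t
      unfolding fconj_le_iff
    proof (intro allI impI)
      fix u p s assume "((u, p), s) \<in> epigraph h"
      from R[rule_format, OF this that]
      show "blinfun_apply b1 u + blinfun_apply z1 p - s \<le> r - (blinfun_apply b2 y + blinfun_apply z2 v - t)" by linarith
    qed
    obtain c where c: "fconj h (b1, z1) = ereal c"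
      using le[OF p(2)] low[OF p(1), of b1 z1] by (cases "fconj h (b1, z1)") auto
    have "fconj k (b2, z2) \<le> ereal (r - c)"
      unfolding fconj_le_iff
    proof (intro allI impI)
      fix y v t assume "((y, v), t) \<in> epigraph k"
      from le[OF this]
      show "blinfun_apply b2 y + blinfun_apply z2 v - t \<le> r - c" by (simp add: c)
    qed
    then have "fconj h (b1, z1) + fconj k (b2, z2) \<le> ereal c + ereal (r - c)"
      unfolding c by (rule add_left_mono)
    then show ?L by simp
  qed
qed

lemma coupling_le_iff:
  "ereal c \<le> h p \<longleftrightarrow> (\<forall>r. (p, r) \<in> epigraph h \<longrightarrow> c \<le> r)"
proof
  show "ereal c \<le> h p" if "\<forall>r. (p, r) \<in> epigraph h \<longrightarrow> c \<le> r"
    by (rule ereal_le_real) (use that in \<open>simp add: epigraph_def\<close>)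
  show "\<forall>r. (p, r) \<in> epigraph h \<longrightarrow> c \<le> r" if "ereal c \<le> h p"
    using that by (auto simp: epigraph_def dest: order_trans)
qed

lemma strong_epigraph_epigraph:
  assumes "strong_representative S h"
  shows "strong_epigraph (epigraph h)"
proof
  show "convex (epigraph h)" "closed (epigraph h)"
    using assms by (auto simp: strong_representative_def representative_def econvex_def elsc_def)
  show "(p, r') \<in> epigraph h" if "(p, r) \<in> epigraph h" "r \<le> r'" for p r r' using that by (rule epigraph_up)
  show "blinfun_apply x' x \<le> r" if "((x, x'), r) \<in> epigraph h" for x x' r
    using assms that coupling_le_iff[of "blinfun_apply x' x" h "(x, x')"]
    by (auto simp: strong_representative_def representative_def)
  show "blinfun_apply z b \<le> s"
    if "\<And>x x' r. ((x, x'), r) \<in> epigraph h \<Longrightarrow> blinfun_apply b x + blinfun_apply z x' - r \<le> s" for b z s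
  proof -
    have "ereal (blinfun_apply z b) \<le> fconj h (b, z)" using assms by (simp add: strong_representative_def)
    also have "\<dots> \<le> ereal s" unfolding fconj_le_iff using that by blast
    finally show ?thesis by simp
  qed
qed

lemma strong_representativeI:
  assumes H: "strong_epigraph (epigraph h)"
    and M: "\<And>x x'. (x, x') \<in> S \<Longrightarrow> ((x, x'), blinfun_apply x' x) \<in> epigraph h"
  shows "strong_representative S h"
proof -
  interpret strong_epigraph "epigraph h" by (rule H)
  have h_ge: "h (x, x') \<ge> ereal (blinfun_apply x' x)" for x x'
    unfolding coupling_le_iff using ge by blast
  moreover have "h (x, x') = ereal (blinfun_apply x' x)" if "(x, x') \<in> S" for x x'
    using M[OF that] h_ge[of x' x] by (auto simp: epigraph_def intro: antisym)
  moreover have "fconj h (x', z) \<ge> ereal (blinfun_apply z x')" for x' z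
  proof (rule ereal_le_real)
    fix s assume "fconj h (x', z) \<le> ereal s"
    then have "blinfun_apply z x' \<le> s" by (intro conj_ge) (rule fconj_le_iff[THEN iffD1, rule_format])
    then show "ereal (blinfun_apply z x') \<le> ereal s" by simp
  qed
  ultimately show ?thesis
    using cvx closed by (auto simp: strong_representative_def representative_def econvex_def elsc_def)
qed

text \<open>The closure of an epigraph is still closed upwards, so it contains (p, r + 1/(n+1)) for
  any r not below the infimum, and in the limit (p, r).\<close>

lemma epigraph_lsc_hull: "epigraph (lsc_hull h) = closure (epigraph h)"
proof (intro set_eqI iffI)
  fix q :: "'a \<times> real"
  obtain p r where q: "q = (p, r)" by (cases q)
  define I where "I = {ereal r | r. (p, r) \<in> closure (epigraph h)}"
  have eq: "q \<in> epigraph (lsc_hull h) \<longleftrightarrow> Inf I \<le> ereal r" by (simp add: q epigraph_def lsc_hull_def I_def)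
  show "q \<in> epigraph (lsc_hull h)" if "q \<in> closure (epigraph h)"
    unfolding eq using that by (intro Inf_lower) (auto simp: I_def q)
  assume "q \<in> epigraph (lsc_hull h)"
  then have Inf: "Inf I \<le> ereal r" by (simp add: eq)
  have up: "(p, r') \<in> closure (epigraph h)" if pr: "(p, r0) \<in> closure (epigraph h)" "r0 \<le> r'" for r0 r'
  proof -
    have "(\<lambda>q. (fst q, snd q + (r' - r0))) ` closure (epigraph h) \<subseteq> closure (epigraph h)"
    proof (rule image_closure_subset)
      show "continuous_on (closure (epigraph h)) (\<lambda>q. (fst q, snd q + (r' - r0)))"
        by (intro continuous_intros)
      show "(\<lambda>q. (fst q, snd q + (r' - r0))) ` epigraph h \<subseteq> closure (epigraph h)"
        using epigraph_up[of _ _ h] pr(2) closure_subset[of "epigraph h"] by fastforce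
    qed simp
    then show ?thesis using pr(1) by force
  qed
  have "(p, r + 1 / real (Suc n)) \<in> closure (epigraph h)" for n
  proof -
    have "Inf I < ereal (r + 1 / real (Suc n))" using Inf by (rule order_le_less_trans) simp
    then obtain r' where r': "(p, r') \<in> closure (epigraph h)" "r' < r + 1 / real (Suc n)"
      unfolding Inf_less_iff by (auto simp: I_def)
    show ?thesis by (rule up[OF r'(1) less_imp_le[OF r'(2)]])
  qed
  moreover have "(\<lambda>n. (p, r + 1 / real (Suc n))) \<longlonglongrightarrow> (p, r + 0)"
    by (intro tendsto_intros LIMSEQ_Suc lim_1_over_n)
  ultimately have "(p, r + 0) \<in> closure (epigraph h)"
    by (rule closed_sequentially[OF closed_closure])
  then show "q \<in> closure (epigraph h)" by (simp add: q)
qed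

text \<open>The infimum need not be attained, so \<open>G\<close> can be smaller than the epigraph,
  but raising a height by any e > 0 leads into \<open>G\<close>. The coupling bounds exclude minus
  infinity, so a sum below a real number has two finite terms.\<close>

lemma closure_epigraph_infconv1:
  fixes hS :: "'a::banach \<times> 'a dual \<Rightarrow> ereal" and hT :: "'b::banach \<times> 'b dual \<Rightarrow> ereal"
  assumes "parallel_epigraphs (epigraph hS) (epigraph hT) A"
  shows "closure (epigraph (infconv1 hS A hT)) = closure (parallel_epigraphs.G (epigraph hS) (epigraph hT) A)"
proof -
  interpret parallel_epigraphs "epigraph hS" "epigraph hT" A by (rule assms)
  have "G \<subseteq> epigraph (infconv1 hS A hT)"
  proof
    fix q assume "q \<in> G"
    then obtain u w v s t where 1: "q = ((u + w, blinfun_apply (adj A) v), s + t)"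
      "((u, blinfun_apply (adj A) v), s) \<in> epigraph hS" "((blinfun_apply A w, v), t) \<in> epigraph hT"
      unfolding G_def by blast
    have "infconv1 hS A hT (u + w, blinfun_apply (adj A) v) \<le> hS (u, blinfun_apply (adj A) v) + hT (blinfun_apply A w, v)"
      unfolding infconv1_def prod.case by (rule Inf_lower) blast
    also have "\<dots> \<le> ereal s + ereal t" using 1 by (intro add_mono) (auto simp: epigraph_def)
    finally show "q \<in> epigraph (infconv1 hS A hT)" by (simp add: 1(1) epigraph_def)
  qed
  moreover have "epigraph (infconv1 hS A hT) \<subseteq> closure G"
  proof
    fix q assume q: "q \<in> epigraph (infconv1 hS A hT)"
    obtain x x' r where q': "q = ((x, x'), r)" by (metis prod.collapse)
    have "((x, x'), r + e) \<in> G" if "e > 0" for e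
    proof -
      have "infconv1 hS A hT (x, x') < ereal (r + e)"
        using q \<open>e > 0\<close> unfolding q' epigraph_def by (auto intro: order_le_less_trans)
      then obtain u w v where 1: "u + w = x" "blinfun_apply (adj A) v = x'"
        "hS (u, x') + hT (blinfun_apply A w, v) < ereal (r + e)"
        unfolding infconv1_def prod.case Inf_less_iff by blast
      have "ereal (blinfun_apply x' u) \<le> hS (u, x')" "ereal (blinfun_apply v (blinfun_apply A w)) \<le> hT (blinfun_apply A w, v)"
        unfolding coupling_le_iff using S.ge T.ge by blast+
      then obtain s t where "hS (u, x') = ereal s" "hT (blinfun_apply A w, v) = ereal t"
        using 1(3) by (cases "hS (u, x')"; cases "hT (blinfun_apply A w, v)") auto
      with 1 have "((u, blinfun_apply (adj A) v), s) \<in> epigraph hS" "((blinfun_apply A w, v), r + e - s) \<in> epigraph hT"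
        by (auto simp: epigraph_def)
      then have "((u + w, blinfun_apply (adj A) v), s + (r + e - s)) \<in> G" unfolding G_def by blast
      then show ?thesis by (simp add: 1)
    qed
    then have "((x, x'), r + 1 / real (Suc n)) \<in> closure G" for n
      using closure_subset[of G] by (meson divide_pos_pos of_nat_0_less_iff subsetD zero_less_Suc zero_less_one)
    moreover have "(\<lambda>n. ((x, x'), r + 1 / real (Suc n))) \<longlonglongrightarrow> ((x, x'), r + 0)"
      by (intro tendsto_intros LIMSEQ_Suc lim_1_over_n)
    ultimately have "((x, x'), r + 0) \<in> closure G"
      by (rule closed_sequentially[OF closed_closure])
    then show "q \<in> closure G" by (simp add: q')
  qed
  ultimately show ?thesis by (meson closure_closure closure_minimal closure_mono closed_closure subset_antisym)
qed

lemma edom_iff: "p \<in> edom h \<longleftrightarrow> (\<exists>r. (p, r) \<in> epigraph h)"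
proof -
  have "k < \<infinity> \<longleftrightarrow> (\<exists>r. k \<le> ereal r)" for k :: ereal by (cases k) auto
  then show ?thesis by (simp add: edom_def epigraph_def)
qed

lemma maximal_monotone_mem:
  assumes S: "maximal_monotone S" and rel: "\<And>y y'. (y, y') \<in> S \<Longrightarrow> 0 \<le> blinfun_apply (x' - y') (x - y)"
  shows "(x, x') \<in> S"
proof -
  have sym: "blinfun_apply (y' - x') (y - x) = blinfun_apply (x' - y') (x - y)" for y y'
    by (simp add: blinfun.diff_left blinfun.diff_right)
  have "monotone_op (insert (x, x') S)"
    using S rel unfolding monotone_op_def maximal_monotone_def by (auto simp: sym)
  then have "insert (x, x') S = S" using S unfolding maximal_monotone_def by blast
  then show ?thesis by blast
qed

theorem theorem3p2:
  fixes S :: "('a::banach \<times> 'a dual) set"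
    and T :: "('b::banach \<times> 'b dual) set"
    and hS :: "'a \<times> 'a dual \<Rightarrow> ereal"
    and hT :: "'b \<times> 'b dual \<Rightarrow> ereal"
    and A :: "'a \<Rightarrow>\<^sub>L 'b"
  assumes X_nonzero: "\<exists>x::'a. x \<noteq> 0"
    and Y_nonzero: "\<exists>y::'b. y \<noteq> 0"
    and S_D: "gossez_type_D S"
    and T_D: "gossez_type_D T"
    and hS_rep: "strong_representative S hS"
    and hT_rep: "strong_representative T hT"
    and nonempty:
      "{(y, y', x') | y y' x'. (y, y') \<in> edom hT \<and> x' \<in> snd ` edom hS}
       \<inter> {(blinfun_apply A x, v', blinfun_apply (adj A) v') | x v'. True} \<noteq> {}"
    and dom_closure: "fst ` gossez_closure S \<subseteq> range emb"
    and cond: "(0, 0, 0) \<in> ic {p - q | p q. p \<in> {(y, y', x') | y y' x'. (y, y') \<in> edom hT \<and> x' \<in> snd ` edom hS}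
                   \<and> q \<in> {(blinfun_apply A x, v', blinfun_apply (adj A) v') | x v'. True}}
       \<or> closed_regarding
           (prod_topology wstar (prod_topology wstar (prod_topology wstar euclideanreal)))
           {(u', blinfun_apply (adj A) v', blinfun_apply (adj (adj A)) u'' + v'', r) | u' v' u'' v'' r.
               fconj hS (u', u'') + fconj hT (v', v'') \<le> ereal r}
           {(x', x', z, r) | x' z r. z \<in> range (blinfun_apply (adj (adj A)))}"
  shows "strong_representative (par_sum S A T) (lsc_hull (infconv1 hS A hT))
       \<and> gossez_type_D (par_sum S A T)"
proof -
  have snd_edom: "x' \<in> snd ` edom hS \<longleftrightarrow> (\<exists>u s. ((u, x'), s) \<in> epigraph hS)" for x'
    by (force simp: edom_iff)
  interpret HS: strong_epigraph "epigraph hS" by (rule strong_epigraph_epigraph[OF hS_rep])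
  interpret HT: strong_epigraph "epigraph hT" by (rule strong_epigraph_epigraph[OF hT_rep])
  have "\<exists>u x v s t. ((u, blinfun_apply (adj A) v), s) \<in> epigraph hS \<and> ((blinfun_apply A x, v), t) \<in> epigraph hT"
    using nonempty unfolding snd_edom edom_iff by blast
  then interpret P: parallel_epigraphs "epigraph hS" "epigraph hT" A by unfold_locales
  have att: P.dual_attained
    using cond
  proof
    assume "(0, 0, 0) \<in> ic {p - q | p q. p \<in> {(y, y', x') | y y' x'. (y, y') \<in> edom hT \<and> x' \<in> snd ` edom hS}
                   \<and> q \<in> {(blinfun_apply A x, v', blinfun_apply (adj A) v') | x v'. True}}"
    also have "{p - q | p q. p \<in> {(y, y', x') | y y' x'. (y, y') \<in> edom hT \<and> x' \<in> snd ` edom hS}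
                   \<and> q \<in> {(blinfun_apply A x, v', blinfun_apply (adj A) v') | x v'. True}}
      = {(y - blinfun_apply A x, v' - v, p - blinfun_apply (adj A) v) | y x v' v p.
          (\<exists>t. ((y, v'), t) \<in> epigraph hT) \<and> (\<exists>u s. ((u, p), s) \<in> epigraph hS)}" (is "?D = ?D'")
    proof (intro set_eqI iffI)
      fix d assume "d \<in> ?D"
      then show "d \<in> ?D'" unfolding snd_edom edom_iff by force
    next
      fix d assume "d \<in> ?D'"
      then obtain y x v' v p where "d = (y - blinfun_apply A x, v' - v, p - blinfun_apply (adj A) v)"
        "\<exists>t. ((y, v'), t) \<in> epigraph hT" "\<exists>u s. ((u, p), s) \<in> epigraph hS" by blast
      moreover from this have "d = (y, v', p) - (blinfun_apply A x, v, blinfun_apply (adj A) v)" by simp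
      ultimately show "d \<in> ?D" unfolding snd_edom edom_iff by blast
    qed
    finally show ?thesis unfolding zero_prod_def[symmetric] by (rule P.dual_attained_interior)
  next
    assume "closed_regarding
           (prod_topology wstar (prod_topology wstar (prod_topology wstar euclideanreal)))
           {(u', blinfun_apply (adj A) v', blinfun_apply (adj (adj A)) u'' + v'', r) | u' v' u'' v'' r.
               fconj hS (u', u'') + fconj hT (v', v'') \<le> ereal r}
           {(x', x', z, r) | x' z r. z \<in> range (blinfun_apply (adj (adj A)))}"
    then show ?thesis
      unfolding fconj_sum_le_iff[OF HS.nonempty HT.nonempty] P.conj_sum_le_def[symmetric]
      by (rule P.dual_attained_closed)
  qed
  have epi: "epigraph (lsc_hull (infconv1 hS A hT)) = closure P.G"
    unfolding epigraph_lsc_hull by (rule closure_epigraph_infconv1) (rule P.parallel_epigraphs_axioms)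
  interpret H: strong_epigraph "closure P.G" by (rule P.strong_epigraph_closure[OF att])
  have S: "((x, x'), blinfun_apply x' x) \<in> epigraph hS" if "(x, x') \<in> S" for x x'
    using hS_rep that by (auto simp: strong_representative_def representative_def epigraph_def)
  have T: "((y, y'), blinfun_apply y' y) \<in> epigraph hT" if "(y, y') \<in> T" for y y'
    using hT_rep that by (auto simp: strong_representative_def representative_def epigraph_def)
  have par_sum_in: "((x, x'), blinfun_apply x' x) \<in> closure P.G" if xx: "(x, x') \<in> par_sum S A T" for x x'
  proof -
    obtain u w v where 1: "x = u + w" "(u, x') \<in> S" "(blinfun_apply A w, v) \<in> T" "x' = blinfun_apply (adj A) v"
      using xx unfolding par_sum_def by blast
    have "((u + w, blinfun_apply (adj A) v), blinfun_apply (blinfun_apply (adj A) v) u + blinfun_apply v (blinfun_apply A w)) \<in> P.G"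
      using S[OF 1(2)] T[OF 1(3)] unfolding P.G_def 1(4) by blast
    also have "((u + w, blinfun_apply (adj A) v), blinfun_apply (blinfun_apply (adj A) v) u + blinfun_apply v (blinfun_apply A w))
        = ((x, x'), blinfun_apply x' x)"
      by (simp add: 1(1,4) blinfun.add_right)
    finally show ?thesis using closure_subset by blast
  qed
  have in_par_sum: "(x, x') \<in> par_sum S A T" if xx: "((x, x'), blinfun_apply x' x) \<in> closure P.G" for x x'
  proof -
    obtain z b where b: "blinfun_apply (adj A) b = x'"
      and z: "\<forall>u p s. ((u, p), s) \<in> epigraph hS \<longrightarrow> blinfun_apply x' u + blinfun_apply z p - s \<le> blinfun_apply z x'"
      and bT: "\<forall>y v t. ((y, v), t) \<in> epigraph hT \<longrightarrow>
        blinfun_apply b y + blinfun_apply (blinfun_apply (adj (adj A)) (emb x - z)) v - t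
          \<le> blinfun_apply x' x - blinfun_apply z x'"
      using P.coincidence_decomposition[OF att xx] by (elim exE conjE)
    \<comment> \<open>\<open>hS\<close> equals the coupling on \<open>S\<close>, so there the
      conjugate inequality is Gossez's inequality for (z, x').\<close>
    have rel: "0 \<le> blinfun_apply (z - emb y) (x' - y')" if "(y, y') \<in> S" for y y'
      using z[rule_format, OF S[OF that]] by (simp add: blinfun.diff_left blinfun.diff_right)
    then have "(z, x') \<in> gossez_closure S" by (auto simp: gossez_closure_def)
    then obtain u where u: "z = emb u" using dom_closure by force
    have "(u, x') \<in> S"
    proof (rule maximal_monotone_mem)
      show "maximal_monotone S" using S_D by (simp add: gossez_type_D_def)
      show "0 \<le> blinfun_apply (x' - y') (u - y)" if "(y, y') \<in> S" for y y'
        using rel[OF that] by (simp add: u emb_diff[symmetric])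
    qed
    \<comment> \<open>With z = emb u the bidual argument for \<open>hT\<close> is the image of A (x
      - u), so the same test on \<open>T\<close> becomes monotone relatedness.\<close>
    moreover have "(blinfun_apply A (x - u), b) \<in> T"
    proof (rule maximal_monotone_mem)
      show "maximal_monotone T" using T_D by (simp add: gossez_type_D_def)
      show "0 \<le> blinfun_apply (b - y') (blinfun_apply A (x - u) - y)" if "(y, y') \<in> T" for y y'
        using bT[rule_format, OF T[OF that]] b[symmetric]
        by (simp add: u emb_diff[symmetric] adj_adj_emb blinfun.diff_left blinfun.diff_right)
    qed
    ultimately have "(u + (x - u), x') \<in> par_sum S A T" unfolding par_sum_def using b by blast
    then show ?thesis by simp
  qed
  have "H.M = par_sum S A T" using par_sum_in in_par_sum by (auto simp: H.M_def)
  moreover have "strong_representative (par_sum S A T) (lsc_hull (infconv1 hS A hT))"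
    by (rule strong_representativeI) (use H.strong_epigraph_axioms par_sum_in in \<open>auto simp: epi\<close>)
  ultimately show ?thesis using H.gossez_type_D_M by simp
qed

end
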